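(* Let $K:\mathbf{R}^d\times\mathbf{R}^d\to\mathbf{R}^d$ be continuous, with $K(z,z')+K(z',z)=0$ for all $z,z'$, and Lipschitz in each variable with constant $L$: $\sup_{z'}|K(z_1,z')-K(z_2,z')|\le L|z_1-z_2|$ and $\sup_{z}|K(z,z_1)-K(z,z_2)|\le L|z_1-z_2|$ for all $z_1,z_2\in\mathbf{R}^d$. For each $N\ge1$ let $T^N_t$ be the associated $N$-particle flow on $(\mathbf{R}^d)^N$. Let $\mathcal{E}$ be the set of $P^{in}\in\mathcal{P}_1(\mathcal{P}_1(\mathbf{R}^d))$ such that $\int_{\mathcal{P}_1(\mathbf{R}^d)}\langle f,|z|^{d+5}\rangle P^{in}(df)<\infty$. There exists a unique $1$-parameter group $(T^\infty_t)_{t\in\mathbf{R}}$ defined on $\mathcal{E}$ and satisfying the following properties: (a) For each $P^{in}\in\mathcal{E}$ and each sequence $P^{in}_N\in\mathcal{P}_1((\mathbf{R}^d)^N/\mathfrak{S}_N)$ such that $\operatorname{Dist}_{MK,1}(P^{in}_N,P^{in})\to0$ as $N\to\infty$, one has $$\operatorname{Dist}_{MK,1}(T^N_t\#P^{in}_N,T^\infty_tP^{in})\to0\quad\text{as }N\to\infty,$$ uniformly in $t\in[-T,T]$ for all $T>0$. (b) For each $P^{in}\in\mathcal{E}$, the map $\mathbf{R}\ni t\mapsto T^\infty_tP^{in}\in\mathcal{P}_1(\mathcal{P}_1(\mathbf{R}^d))$ is continuous for the distance $\operatorname{Dist}_{MK,1}$. (c) For each $P^{in}\in\mathcal{E}$,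 the family $(P_m)_{m\ge1}$ defined for all $m\ge1$ by $$P_m(t):=\int_{\mathcal{P}_1(\mathbf{R}^d)}f^{\otimes m}\,(T^\infty_tP^{in})(df)$$ is a solution, in the sense of distributions, of the infinite mean field hierarchy $$\partial_tP_m(t)+\sum_{k=1}^m\operatorname{div}_{z_k}\left(\int_{\mathbf{R}^d}K(z_k,z_{m+1})P_{m+1}(t,dz_{m+1})\right)=0,\qquad m\ge1.$$ (d) For each $P^{in},Q^{in}\in\mathcal{E}$, one has $$\operatorname{Dist}_{MK,1}(T^\infty_tP^{in},T^\infty_tQ^{in})\le e^{2L|t|}\operatorname{Dist}_{MK,1}(P^{in},Q^{in}),\qquad t\in\mathbf{R}.$$
   Context: $|\cdot|$ is the Euclidean norm. $\mathcal{P}_1(\mathbf{R}^n)$ is the set of Borel probability measures $\mu$ on $\mathbf{R}^n$ with $\int|z|\,\mu(dz)<\infty$. For $\mu,\nu\in\mathcal{P}_1(\mathbf{R}^d)$, $\operatorname{dist}_{MK,1}(\mu,\nu)=\inf_{\pi\in\Pi(\mu,\nu)}\iint|x-y|\,\pi(dx\,dy)$; with this distance $\mathcal{P}_1(\mathbf{R}^d)$ is a Polish space. $\mathcal{P}(\mathcal{P}_1(\mathbf{R}^d))$ is the set of Borel probability measures on it, and $$\mathcal{P}_1(\mathcal{P}_1(\mathbf{R}^d))=\Big\{P\in\mathcal{P}(\mathcal{P}_1(\mathbf{R}^d)):\ \int_{\mathcal{P}_1(\mathbf{R}^d)}\operatorname{dist}_{MK,1}(\mu,\delta_0)\,P(d\mu)<\infty\Big\}.$$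 For $P,Q\in\mathcal{P}_1(\mathcal{P}_1(\mathbf{R}^d))$, $$\operatorname{Dist}_{MK,1}(P,Q)=\inf_{\rho\in\Pi(P,Q)}\iint_{\mathcal{P}_1(\mathbf{R}^d)\times\mathcal{P}_1(\mathbf{R}^d)}\operatorname{dist}_{MK,1}(\mu,\nu)\,\rho(d\mu,d\nu).$$ In both cases $\Pi(\cdot,\cdot)$ denotes the set of Borel probability measures on the product space whose marginals are the two given measures. Here $\langle f,\phi\rangle=\int\phi\,df$ and $\#$ denotes push-forward of measures. $\mathcal{P}_1((\mathbf{R}^d)^N/\mathfrak{S}_N)$ denotes the set of $P_N\in\mathcal{P}_1((\mathbf{R}^d)^N)$ that are symmetric, i.e. invariant under push-forward by all permutations $(x_1,\ldots,x_N)\mapsto(x_{\sigma(1)},\ldots,x_{\sigma(N)})$, $\sigma\in\mathfrak{S}_N$. Each such $P_N$ is identified with the element of $\mathcal{P}_1(\mathcal{P}_1(\mathbf{R}^d))$ that is its push-forward under the map $Z_N=(z_1,\ldots,z_N)\mapsto\mu_{Z_N}=\frac1N\sum_{k=1}^N\delta_{z_k}$; $\operatorname{Dist}_{MK,1}$ is applied to elements of $\mathcal{P}_1((\mathbf{R}^d)^N/\mathfrak{S}_N)$ through this identification. $N$-particle flow: $T^N_t(z_1^{in},\ldots,z_N^{in})=(z_1(t),\ldots,z_N(t))$, where $(z_1,\ldots,z_N)$ is the (global, unique) solution of $$\dot z_k(t)=\frac1N\sum_{l=1}^NK(z_k(t),z_l(t)),\qquad z_k(0)=z_k^{in},\qquad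 k=1,\ldots,N,\ t\in\mathbf{R}.$$ $T^N_t\#P_N^{in}$ is the push-forward of $P_N^{in}$, as a measure on $(\mathbf{R}^d)^N$, under $T^N_t$; it is again symmetric. A $1$-parameter group on $\mathcal{E}$ is a family of maps $T^\infty_t:\mathcal{E}\to\mathcal{E}$, $t\in\mathbf{R}$, with $T^\infty_0=\mathrm{Id}$ and $T^\infty_{t+s}=T^\infty_t\circ T^\infty_s$ for all $t,s\in\mathbf{R}$. *)

theory Defs
  imports "HOL-Probability.Probability"
begin

definition borel_of :: "'a topology \<Rightarrow> 'a measure" where
  "borel_of X = sigma (topspace X) {U. openin X U}"

lemma borel_of_euclidean: "borel_of euclidean = borel"
  by (simp add: borel_of_def borel_def)

definition couplings :: "'a topology \<Rightarrow> 'a measure \<Rightarrow> 'a measure \<Rightarrow> ('a \<times> 'a) measure set" where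
  "couplings X \<mu> \<nu> = {\<pi>. prob_space \<pi> \<and> sets \<pi> = sets (borel_of (prod_topology X X)) \<and>
     distr \<pi> (borel_of X) fst = \<mu> \<and> distr \<pi> (borel_of X) snd = \<nu>}"

text \<open>
  The infimum is taken in the extended nonnegative reals. It is finite, so that the conversion to
  a real loses nothing, whenever both measures have a finite first moment.
\<close>
definition MK1 :: "'a topology \<Rightarrow> ('a \<Rightarrow> 'a \<Rightarrow> real) \<Rightarrow> 'a measure \<Rightarrow> 'a measure \<Rightarrow> real" where
  "MK1 X c \<mu> \<nu> = enn2real (INF \<pi>\<in>couplings X \<mu> \<nu>. \<integral>\<^sup>+p. ennreal (c (fst p) (snd p)) \<partial>\<pi>)"

definition P1 :: "(real^'d) measure set" where
  "P1 = {\<mu>. prob_space \<mu> \<and> sets \<mu> = sets borel \<and> (\<integral>\<^sup>+z. ennreal (norm z) \<partial>\<mu>) < \<infinity>}"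

definition dist_MK :: "(real^'d) measure \<Rightarrow> (real^'d) measure \<Rightarrow> real" where
  "dist_MK = MK1 euclidean dist"

definition P1_topology :: "(real^'d) measure topology" where
  "P1_topology = Metric_space.mtopology P1 dist_MK"

definition P1P1 :: "(real^'d) measure measure set" where
  "P1P1 = {P. prob_space P \<and> sets P = sets (borel_of P1_topology) \<and>
     (\<integral>\<^sup>+\<mu>. ennreal (dist_MK \<mu> (return borel 0)) \<partial>P) < \<infinity>}"

definition Dist_MK :: "(real^'d) measure measure \<Rightarrow> (real^'d) measure measure \<Rightarrow> real" where
  "Dist_MK = MK1 P1_topology dist_MK"

definition moment_class :: "(real^'d) measure measure set" where
  "moment_class =
     {P \<in> P1P1. (\<integral>\<^sup>+f. (\<integral>\<^sup>+z. ennreal (norm z ^ (CARD('d) + 5)) \<partial>f) \<partial>P) < \<infinity>}"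

text \<open>
  A point of the \<open>N\<close>-fold product of Euclidean space is an extensional function on the index set
  \<open>{..<N}\<close>, so indices start at 0. Since Euclidean space is second countable, the product
  sigma-algebra is the Borel sigma-algebra of the product.
\<close>
abbreviation config :: "nat \<Rightarrow> (nat \<Rightarrow> real^'d) set" where
  "config N \<equiv> {..<N} \<rightarrow>\<^sub>E UNIV"

abbreviation config_algebra :: "nat \<Rightarrow> (nat \<Rightarrow> real^'d) measure" where
  "config_algebra N \<equiv> PiM {..<N} (\<lambda>_. borel)"

text \<open>The Euclidean norm of a configuration is the 2-norm of the norms of its components.\<close>
definition P1_sym :: "nat \<Rightarrow> (nat \<Rightarrow> real^'d) measure set" where
  "P1_sym N = {P. prob_space P \<and> sets P = sets (config_algebra N) \<and>
     (\<integral>\<^sup>+Z. ennreal (L2_set (\<lambda>k. norm (Z k)) {..<N}) \<partial>P) < \<infinity> \<and>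
     (\<forall>\<sigma>. \<sigma> permutes {..<N} \<longrightarrow>
        distr P (config_algebra N) (\<lambda>Z. \<lambda>k\<in>{..<N}. Z (\<sigma> k)) = P)}"

definition empirical :: "nat \<Rightarrow> (nat \<Rightarrow> real^'d) \<Rightarrow> (real^'d) measure" where
  "empirical N Z = measure_of UNIV (sets borel)
     (\<lambda>A. ennreal (1 / real N) * (\<Sum>k<N. emeasure (return borel (Z k)) A))"

definition empirical_law :: "nat \<Rightarrow> (nat \<Rightarrow> real^'d) measure \<Rightarrow> (real^'d) measure measure" where
  "empirical_law N P = distr P (borel_of P1_topology) (empirical N)"

definition particle_solution ::
    "(real^'d \<Rightarrow> real^'d \<Rightarrow> real^'d) \<Rightarrow> nat \<Rightarrow> (nat \<Rightarrow> real^'d) \<Rightarrow> (real \<Rightarrow> nat \<Rightarrow> real^'d) \<Rightarrow> bool" where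
  "particle_solution K N Z0 z \<longleftrightarrow>
     (\<forall>t. z t \<in> config N) \<and> z 0 = Z0 \<and>
     (\<forall>t. \<forall>k<N. ((\<lambda>s. z s k) has_vector_derivative
        (1 / real N) *\<^sub>R (\<Sum>l<N. K (z t k) (z t l))) (at t))"

definition particle_flow ::
    "(real^'d \<Rightarrow> real^'d \<Rightarrow> real^'d) \<Rightarrow> nat \<Rightarrow> real \<Rightarrow> (nat \<Rightarrow> real^'d) \<Rightarrow> (nat \<Rightarrow> real^'d)" where
  "particle_flow K N t Z0 = (THE z. particle_solution K N Z0 z) t"

definition flow_push ::
    "(real^'d \<Rightarrow> real^'d \<Rightarrow> real^'d) \<Rightarrow> nat \<Rightarrow> real \<Rightarrow> (nat \<Rightarrow> real^'d) measure \<Rightarrow> (nat \<Rightarrow> real^'d) measure" where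
  "flow_push K N t P = distr P (config_algebra N) (particle_flow K N t)"

text \<open>
  Smoothness of a function of time and of \<open>m\<close> points is expressed through iterated partial
  derivatives along the coordinate directions. Only values on \<open>spacetime m\<close> matter. The topology
  on \<open>nat \<Rightarrow> real^'d\<close> is the product topology, which induces on configurations the Euclidean one.
\<close>
abbreviation spacetime :: "nat \<Rightarrow> (real \<times> (nat \<Rightarrow> real^'d)) set" where
  "spacetime m \<equiv> UNIV \<times> config m"

definition shift ::
    "real \<times> (nat \<Rightarrow> real^'d) \<Rightarrow> real \<times> (nat \<Rightarrow> real^'d) \<Rightarrow> real \<Rightarrow> real \<times> (nat \<Rightarrow> real^'d)" where
  "shift v p s = (fst p + s * fst v, \<lambda>i. snd p i + s *\<^sub>R snd v i)"

definition dir_deriv ::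
    "real \<times> (nat \<Rightarrow> real^'d) \<Rightarrow> (real \<times> (nat \<Rightarrow> real^'d) \<Rightarrow> real) \<Rightarrow> real \<times> (nat \<Rightarrow> real^'d) \<Rightarrow> real" where
  "dir_deriv v \<phi> p = deriv (\<lambda>s. \<phi> (shift v p s)) 0"

definition time_dir :: "real \<times> (nat \<Rightarrow> real^'d)" where
  "time_dir = (1, \<lambda>_. 0)"

definition space_dir :: "nat \<Rightarrow> real^'d \<Rightarrow> real \<times> (nat \<Rightarrow> real^'d)" where
  "space_dir k b = (0, (\<lambda>_. 0)(k := b))"

definition coord_dirs :: "nat \<Rightarrow> (real \<times> (nat \<Rightarrow> real^'d)) set" where
  "coord_dirs m = insert time_dir {space_dir k b | k b. k < m \<and> b \<in> Basis}"

primrec times_cont_diff :: "nat \<Rightarrow> nat \<Rightarrow> (real \<times> (nat \<Rightarrow> real^'d) \<Rightarrow> real) \<Rightarrow> bool" where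
  "times_cont_diff m 0 \<phi> \<longleftrightarrow> continuous_on (spacetime m) \<phi>"
| "times_cont_diff m (Suc n) \<phi> \<longleftrightarrow> continuous_on (spacetime m) \<phi> \<and>
     (\<forall>v\<in>coord_dirs m.
        (\<forall>p\<in>spacetime m. (\<lambda>s. \<phi> (shift v p s)) differentiable (at 0)) \<and>
        times_cont_diff m n (dir_deriv v \<phi>))"

definition test_functions :: "nat \<Rightarrow> (real \<times> (nat \<Rightarrow> real^'d) \<Rightarrow> real) set" where
  "test_functions m = {\<phi>. (\<forall>n. times_cont_diff m n \<phi>) \<and>
     (\<exists>C\<subseteq>spacetime m. compact C \<and> (\<forall>p\<in>spacetime m - C. \<phi> p = 0))}"

definition grad :: "nat \<Rightarrow> (real \<times> (nat \<Rightarrow> real^'d) \<Rightarrow> real) \<Rightarrow> real \<times> (nat \<Rightarrow> real^'d) \<Rightarrow> real^'d" where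
  "grad k \<phi> p = (\<Sum>b\<in>Basis. dir_deriv (space_dir k b) \<phi> p *\<^sub>R b)"

definition mixture_power :: "nat \<Rightarrow> (real^'d) measure measure \<Rightarrow> (nat \<Rightarrow> real^'d) measure" where
  "mixture_power m P = P \<bind> (\<lambda>f. PiM {..<m} (\<lambda>_. f))"

text \<open>
  The equation tested against \<open>\<phi>\<close>, after integrating by parts and multiplying by -1. With indices
  starting at 0, the additional variable of \<open>Q (Suc m) t\<close> is the one with index \<open>m\<close>, and
  \<open>restrict Z {..<m}\<close> drops it. The integrability clauses ensure that every term of the equation
  is meaningful, as the Bochner integral of a non-integrable function is 0 by convention.
\<close>
definition hierarchy_solution ::
    "(real^'d \<Rightarrow> real^'d \<Rightarrow> real^'d) \<Rightarrow> (nat \<Rightarrow> real \<Rightarrow> (nat \<Rightarrow> real^'d) measure) \<Rightarrow> bool" where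
  "hierarchy_solution K Q \<longleftrightarrow> (\<forall>m\<ge>1. \<forall>\<phi>\<in>test_functions m.
     (let A = (\<lambda>t Z. dir_deriv time_dir \<phi> (t, Z));
          B = (\<lambda>k t Z. K (Z k) (Z m) \<bullet> grad k \<phi> (t, restrict Z {..<m}))
      in (\<forall>t. integrable (Q m t) (A t)) \<and>
         (\<forall>t. \<forall>k<m. integrable (Q (Suc m) t) (B k t)) \<and>
         integrable lborel (\<lambda>t. \<integral>Z. A t Z \<partial>Q m t) \<and>
         (\<forall>k<m. integrable lborel (\<lambda>t. \<integral>Z. B k t Z \<partial>Q (Suc m) t)) \<and>
         (\<integral>t. (\<integral>Z. A t Z \<partial>Q m t) \<partial>lborel)
           + (\<Sum>k<m. \<integral>t. (\<integral>Z. B k t Z \<partial>Q (Suc m) t) \<partial>lborel) = 0))"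

text \<open>
  The maps are extensional, i.e. have a fixed value outside \<open>E\<close>, so that two groups are equal as
  soon as they agree on \<open>E\<close>.
\<close>
definition one_param_group :: "'a set \<Rightarrow> (real \<Rightarrow> 'a \<Rightarrow> 'a) \<Rightarrow> bool" where
  "one_param_group E T \<longleftrightarrow> (\<forall>t. T t \<in> E \<rightarrow>\<^sub>E E) \<and> (\<forall>x\<in>E. T 0 x = x) \<and>
     (\<forall>t s. \<forall>x\<in>E. T (t + s) x = T t (T s x))"

end

theory Submission
  imports Defs
begin

text \<open>
  Solutions of the mean field equation are treated in Lagrangian form: a family of random variables on
  an arbitrary probability space whose velocities are the averages of \<open>K\<close> over an independent copy.
  A single Gronwall estimate for two solutions on the same space then serves three purposes. On a
  coupling of two measures it is Dobrushin's estimate for the mean field flow; on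
  the uniform measure on \<open>N\<close> points it says that empirical measures of particles are transported by that
  same flow; and it gives uniqueness. Since \<open>T\<^sup>\<infinity>\<^sub>t\<close> has to be the push-forward under the flow on
  measures, and the \<open>N\<close>-particle evolution is the same push-forward restricted to empirical laws, (a), (b)
  and (d) follow from the Lipschitz bounds.

  Uniqueness needs that every law on measures is a limit of empirical laws of symmetric
  distributions. The mixtures of product measures provide such a sequence, by the law of large
  numbers in transport distance. The hierarchy (c) is the expectation of the chain rule along the flow of \<open>m\<close>
  independent samples of the initial random measure, where the mean field is the conditional expectation
  of the interaction with sample \<open>m + 1\<close>.
\<close>

subsection \<open>Transport cost on a separable metric space\<close>

text \<open>Both levels of transport are handled by one abstract theory:
  \<open>separable_metric\<close> is instantiated with Euclidean space and then with
  \<open>P1\<close> itself under \<open>dist_MK\<close>. Separability carries that theory. It makes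
  the Borel sets of the product space coincide with the product sigma-algebra, and it supplies the
  partitions that replace disintegration in the triangle inequality. The second instance therefore
  has to wait for the law of large numbers, from which separability of \<open>P1\<close> is deduced.

  The rate 2L has two sources of size L: two velocities differ by at most L times the distance of
  the two particles plus L times the mean distance. Antisymmetry enters through K(0,0) = 0: the
  Dirac mass at 0 is stationary, and comparison with it yields the growth bounds on the flow.

  The obstacle in (c) is measurability. The velocity of a sample depends on the random measure,
  which finitely many samples do not determine. So the samples are kept together with the measure
  they were drawn from (\<open>tagged_law\<close>), and flow and velocity are shown to be jointly
  measurable in measure, time and position.\<close>

lemma space_borel_of [simp]: "space (borel_of X) = topspace X"
  unfolding borel_of_def by (intro space_measure_of) (auto dest: openin_subset)

lemma sets_borel_of: "sets (borel_of X) = sigma_sets (topspace X) {U. openin X U}"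
  unfolding borel_of_def by (intro sets_measure_of) (auto dest: openin_subset)

lemma openin_borel_of: "openin X U \<Longrightarrow> U \<in> sets (borel_of X)"
  by (auto simp: sets_borel_of)

lemma closedin_borel_of: "closedin X C \<Longrightarrow> C \<in> sets (borel_of X)"
proof -
  assume "closedin X C"
  then have "topspace X - (topspace X - C) \<in> sets (borel_of X)"
    by (metis openin_borel_of openin_diff openin_topspace sets.compl_sets space_borel_of)
  with \<open>closedin X C\<close> show ?thesis
    by (simp add: closedin_def double_diff)
qed

lemma measurable_borel_of:
  assumes "continuous_map X Y f"
  shows "f \<in> borel_of X \<rightarrow>\<^sub>M borel_of Y"
proof (rule measurable_sigma_sets[OF sets_borel_of])
  show "{U. openin Y U} \<subseteq> Pow (topspace Y)" by (auto dest: openin_subset)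
  show "f \<in> space (borel_of X) \<rightarrow> topspace Y"
    using assms by (auto simp: continuous_map_def)
  fix U assume "U \<in> {U. openin Y U}"
  then have "openin X {x \<in> topspace X. f x \<in> U}"
    using assms by (auto simp: continuous_map_def)
  moreover have "f -` U \<inter> space (borel_of X) = {x \<in> topspace X. f x \<in> U}" by auto
  ultimately show "f -` U \<inter> space (borel_of X) \<in> sets (borel_of X)"
    by (simp add: openin_borel_of)
qed

locale separable_metric = Metric_space M d for M :: "'a set" and d +
  assumes separable: "\<exists>D. countable D \<and> D \<subseteq> M \<and> (\<forall>x\<in>M. \<forall>e>0. \<exists>a\<in>D. d x a < e)"
begin

abbreviation "BM \<equiv> borel_of mtopology"

text \<open>An open set of the product is the union of the products of balls inside it that have
  centres in the dense set and a common rational radius. There are only countably many of these, so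
  the union lies in the product sigma-algebra. The other inclusion is continuity of the
  projections.\<close>

lemma sets_borel_of_prod:
  "sets (borel_of (prod_topology mtopology mtopology)) = sets (BM \<Otimes>\<^sub>M BM)"
proof
  obtain D where D: "countable D" "D \<subseteq> M" "\<And>x e. x \<in> M \<Longrightarrow> e > 0 \<Longrightarrow> \<exists>a\<in>D. d x a < e"
    using separable by blast
  have "U \<in> sets (BM \<Otimes>\<^sub>M BM)" if U: "openin (prod_topology mtopology mtopology) U" for U
  proof -
    let ?I = "{(a, b, r). a \<in> D \<and> b \<in> D \<and> r \<in> \<rat> \<and> mball a r \<times> mball b r \<subseteq> U}"
    have "countable ?I"
      by (rule countable_subset[of _ "D \<times> D \<times> \<rat>"]) (use D countable_rat in auto)
    moreover have "U = (\<Union>(a, b, r)\<in>?I. mball a r \<times> mball b r)"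
    proof (intro subset_antisym subsetI)
      fix p assume p: "p \<in> U"
      obtain x y where xy: "p = (x, y)" by fastforce
      obtain V W where VW: "openin mtopology V" "openin mtopology W" "x \<in> V" "y \<in> W" "V \<times> W \<subseteq> U"
        using U p xy unfolding openin_prod_topology_alt by metis
      have xyM: "x \<in> M" "y \<in> M" using VW openin_subset by fastforce+
      obtain r where r: "r > 0" "mball x r \<subseteq> V" using VW(1,3) unfolding openin_mtopology by metis
      obtain s where s: "s > 0" "mball y s \<subseteq> W" using VW(2,4) unfolding openin_mtopology by metis
      note rs = r s xyM
      \<comment> \<open>Less than half of both radii: a ball of radius \<open>q\<close> about a
        dense point within \<open>q\<close> of \<open>x\<close> contains \<open>x\<close> and stays
        in the ball of radius \<open>r\<close> about \<open>x\<close>; likewise for \<open>y\<close>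
        and \<open>s\<close>.\<close>
      obtain q where q: "q \<in> \<rat>" "0 < q" "q < min r s / 2"
        using Rats_dense_in_real[of 0 "min r s / 2"] rs by auto
      obtain a b where ab: "a \<in> D" "d x a < q" "b \<in> D" "d y b < q"
        using D(3)[of x q] D(3)[of y q] rs q by metis
      have sub: "mball u q \<subseteq> mball v t" if "d v u < q" "u \<in> M" "v \<in> M" "2 * q < t" for u v t
      proof
        fix w assume w: "w \<in> mball u q"
        then have "d v w \<le> d v u + d u w" using that by (intro triangle) auto
        also have "\<dots> < t" using w that by auto
        finally show "w \<in> mball v t" using w that by auto
      qed
      have "mball a q \<subseteq> mball x r" "mball b q \<subseteq> mball y s"
        by (rule sub; use ab q rs D(2) in auto)+
      then have "mball a q \<times> mball b q \<subseteq> U" using VW rs by blast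
      moreover have "x \<in> mball a q" "y \<in> mball b q" using ab D(2) rs by (auto simp: commute)
      ultimately show "p \<in> (\<Union>(a, b, r)\<in>?I. mball a r \<times> mball b r)"
        using ab q xy by (intro UN_I[of "(a, b, q)"]) auto
    qed auto
    ultimately show ?thesis
      using sets.countable_UN''[of ?I "\<lambda>(a, b, r). mball a r \<times> mball b r" "BM \<Otimes>\<^sub>M BM"]
      by (auto intro!: pair_measureI openin_borel_of)
  qed
  then have "sigma_sets (space (BM \<Otimes>\<^sub>M BM)) {U. openin (prod_topology mtopology mtopology) U} \<subseteq> sets (BM \<Otimes>\<^sub>M BM)"
    by (intro sets.sigma_sets_subset) auto
  then show "sets (borel_of (prod_topology mtopology mtopology)) \<subseteq> sets (BM \<Otimes>\<^sub>M BM)"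
    by (simp add: sets_borel_of space_pair_measure)
next
  have pair: "(\<lambda>p. (fst p, snd p)) \<in> borel_of (prod_topology mtopology mtopology) \<rightarrow>\<^sub>M BM \<Otimes>\<^sub>M BM"
    by (intro measurable_Pair measurable_borel_of continuous_map_fst continuous_map_snd)
  show "sets (BM \<Otimes>\<^sub>M BM) \<subseteq> sets (borel_of (prod_topology mtopology mtopology))"
  proof
    fix A assume A: "A \<in> sets (BM \<Otimes>\<^sub>M BM)"
    then have "(\<lambda>p. (fst p, snd p)) -` A \<inter> space (borel_of (prod_topology mtopology mtopology)) = A"
      using sets.sets_into_space[OF A] by (auto simp: space_pair_measure)
    with measurable_sets[OF pair A] show "A \<in> sets (borel_of (prod_topology mtopology mtopology))" by simp
  qed
qed

lemma dist_measurable [measurable]: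
  "(\<lambda>p. d (fst p) (snd p)) \<in> borel_measurable (BM \<Otimes>\<^sub>M BM)"
proof -
  have "continuous_map (prod_topology mtopology mtopology) euclideanreal (\<lambda>p. d (fst p) (snd p))"
    using continuous_map_mdist[of "prod_topology mtopology mtopology" Self fst snd]
    by (simp add: Self_def continuous_map_fst continuous_map_snd)
  from measurable_borel_of[OF this] show ?thesis
    unfolding borel_of_euclidean measurable_cong_sets[OF sets_borel_of_prod refl] .
qed

lemma dist_measurable' [measurable (raw)]:
  assumes "f \<in> N \<rightarrow>\<^sub>M BM" "g \<in> N \<rightarrow>\<^sub>M BM"
  shows "(\<lambda>x. d (f x) (g x)) \<in> borel_measurable N"
  using measurable_compose[OF measurable_Pair[OF assms] dist_measurable] by simp

text \<open>Kept in the extended nonnegative reals so that symmetry and the triangle inequality hold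
  with no moment condition. The real-valued distance \<open>W\<close> is derived from it on measures
  with finite first moment.\<close>

definition MKe :: "'a measure \<Rightarrow> 'a measure \<Rightarrow> ennreal" where
  "MKe \<mu> \<nu> = (INF \<pi>\<in>couplings mtopology \<mu> \<nu>. \<integral>\<^sup>+p. ennreal (d (fst p) (snd p)) \<partial>\<pi>)"

lemma couplings_iff:
  "\<pi> \<in> couplings mtopology \<mu> \<nu> \<longleftrightarrow> prob_space \<pi> \<and> sets \<pi> = sets (BM \<Otimes>\<^sub>M BM) \<and>
     distr \<pi> BM fst = \<mu> \<and> distr \<pi> BM snd = \<nu>"
  by (simp add: couplings_def sets_borel_of_prod)

lemma coupling_marginals:
  assumes "\<pi> \<in> couplings mtopology \<mu> \<nu>"
  shows "prob_space \<mu>" "prob_space \<nu>" "sets \<mu> = sets BM" "sets \<nu> = sets BM"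
proof -
  have s: "prob_space \<pi>" "sets \<pi> = sets (BM \<Otimes>\<^sub>M BM)" "distr \<pi> BM fst = \<mu>" "distr \<pi> BM snd = \<nu>"
    using assms by (auto simp: couplings_iff)
  note [measurable_cong] = s(2)
  have [measurable]: "fst \<in> \<pi> \<rightarrow>\<^sub>M BM" "snd \<in> \<pi> \<rightarrow>\<^sub>M BM" by measurable
  show "prob_space \<mu>" "prob_space \<nu>" "sets \<mu> = sets BM" "sets \<nu> = sets BM"
    unfolding s(3,4)[symmetric] by (auto intro!: prob_space.prob_space_distr[OF s(1)])
qed

lemma coupling_distr:
  assumes "prob_space \<Omega>" and [measurable]: "f \<in> \<Omega> \<rightarrow>\<^sub>M BM" "g \<in> \<Omega> \<rightarrow>\<^sub>M BM"
  shows "distr \<Omega> (BM \<Otimes>\<^sub>M BM) (\<lambda>\<omega>. (f \<omega>, g \<omega>)) \<in> couplings mtopology (distr \<Omega> BM f) (distr \<Omega> BM g)"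
  unfolding couplings_iff
  by (auto simp: distr_distr comp_def intro!: prob_space.prob_space_distr[OF assms(1)])

text \<open>The joint law of two random variables on any common probability space is a coupling of
  their laws. Upper bounds on transport distances are obtained below by exhibiting such a
  space.\<close>

lemma MKe_distr_le:
  assumes "prob_space \<Omega>" and [measurable]: "f \<in> \<Omega> \<rightarrow>\<^sub>M BM" "g \<in> \<Omega> \<rightarrow>\<^sub>M BM"
  shows "MKe (distr \<Omega> BM f) (distr \<Omega> BM g) \<le> (\<integral>\<^sup>+\<omega>. ennreal (d (f \<omega>) (g \<omega>)) \<partial>\<Omega>)"
  unfolding MKe_def
  by (rule INF_lower2[OF coupling_distr[OF assms]]) (simp add: nn_integral_distr)

text \<open>Gluing without disintegration: the two couplings are made conditionally independent given the cell of
  the middle point, in a countable partition into cells of diameter less than \<open>e\<close>.\<close>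

lemma coupling_glue:
  assumes p1: "\<pi>1 \<in> couplings mtopology \<mu> \<nu>" and p2: "\<pi>2 \<in> couplings mtopology \<nu> \<kappa>" and "e > 0"
  shows "MKe \<mu> \<kappa> \<le> (\<integral>\<^sup>+p. ennreal (d (fst p) (snd p)) \<partial>\<pi>1) + ennreal e
                    + (\<integral>\<^sup>+p. ennreal (d (fst p) (snd p)) \<partial>\<pi>2)"
proof -
  have s1: "prob_space \<pi>1" "sets \<pi>1 = sets (BM \<Otimes>\<^sub>M BM)" "distr \<pi>1 BM fst = \<mu>" "distr \<pi>1 BM snd = \<nu>"
    and s2: "prob_space \<pi>2" "sets \<pi>2 = sets (BM \<Otimes>\<^sub>M BM)" "distr \<pi>2 BM fst = \<nu>" "distr \<pi>2 BM snd = \<kappa>"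
    using p1 p2 by (auto simp: couplings_iff)
  note [measurable_cong] = s1(2) s2(2)
  interpret P1: prob_space \<pi>1 by fact
  interpret P2: prob_space \<pi>2 by fact
  interpret PP: pair_sigma_finite \<pi>1 \<pi>2 ..
  interpret N: prob_space \<nu> using coupling_marginals[OF p1] by simp
  have snu[measurable_cong]: "sets \<nu> = sets BM" using coupling_marginals[OF p1] by simp
  have sp: "space \<pi>1 = M \<times> M" "space \<pi>2 = M \<times> M" "space \<nu> = M"
    using sets_eq_imp_space_eq[OF s1(2)] sets_eq_imp_space_eq[OF s2(2)] sets_eq_imp_space_eq[OF snu]
    by (auto simp: space_pair_measure)
  have "M \<noteq> {}" using N.not_empty sp by simp
  obtain D where D: "countable D" "D \<subseteq> M" "\<And>x e. x \<in> M \<Longrightarrow> e > 0 \<Longrightarrow> \<exists>a\<in>D. d x a < e"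
    using separable by blast
  have "D \<noteq> {}" using D(3)[of _ 1] \<open>M \<noteq> {}\<close> by fastforce
  define a where "a = from_nat_into D"
  have aM: "a n \<in> M" for n using from_nat_into[OF \<open>D \<noteq> {}\<close>] D(2) a_def by blast
  define idx where "idx y = (LEAST n. d y (a n) < e / 2)" for y
  have idx: "d y (a (idx y)) < e / 2" if y: "y \<in> M" for y
  proof -
    obtain b where "b \<in> D" "d y b < e / 2" using D(3)[OF y, of "e/2"] \<open>e > 0\<close> by auto
    then have "\<exists>n. d y (a n) < e / 2" unfolding a_def using from_nat_into_surj[OF D(1)] by metis
    then show ?thesis unfolding idx_def by (rule LeastI_ex)
  qed
  have idx_close: "d y y' < e" if "y \<in> M" "y' \<in> M" "idx y = idx y'" for y y'
    using idx[OF that(1)] idx[OF that(2)] that triangle[of y "a (idx y)" y'] aM by (simp add: commute)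
  have aB: "(\<lambda>y. a n) \<in> BM \<rightarrow>\<^sub>M BM" for n using aM by (intro measurable_const) auto
  have [measurable]: "idx \<in> BM \<rightarrow>\<^sub>M count_space UNIV"
    unfolding idx_def using aB by measurable
  have idx_sets: "{y \<in> M. idx y = n} \<in> sets BM" for n
  proof -
    have "{y \<in> space BM. idx y = n} \<in> sets BM" by measurable
    then show ?thesis by simp
  qed
  define q where "q n = emeasure \<nu> {y \<in> space \<nu>. idx y = n}" for n
  have q1: "q n \<le> 1" for n unfolding q_def by (rule N.emeasure_le_1)
  have qi: "inverse (q n) * q n = 1" if "q n \<noteq> 0" for n
    using ennreal_divide_self[of "q n"] that le_less_trans[OF q1[of n] ennreal_one_less_top]
    by (simp add: divide_ennreal_def mult.commute)
  have qp1: "emeasure \<pi>1 {p \<in> space \<pi>1. idx (snd p) = n} = q n" for n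
    unfolding q_def s1(4)[symmetric] by (subst emeasure_distr) (auto simp: sp idx_sets intro!: arg_cong[where f="emeasure \<pi>1"])
  have qp2: "emeasure \<pi>2 {p \<in> space \<pi>2. idx (fst p) = n} = q n" for n
    unfolding q_def s2(3)[symmetric] by (subst emeasure_distr) (auto simp: sp idx_sets intro!: arg_cong[where f="emeasure \<pi>2"])
  \<comment> \<open>Only cells of positive mass matter. On a null cell the factor
    \<open>inverse (q n)\<close> used below would be infinite.\<close>
  have AEq: "AE y in \<nu>. q (idx y) \<noteq> 0"
  proof -
    have "AE y in \<nu>. \<forall>n. q n = 0 \<longrightarrow> idx y \<noteq> n"
      unfolding AE_all_countable
    proof (intro allI AE_impI)
      fix n assume "q n = 0"
      then show "AE y in \<nu>. idx y \<noteq> n" by (intro AE_I[of _ _ "{y \<in> space \<nu>. idx y = n}"]) (auto simp: q_def)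
    qed
    then show ?thesis by eventually_elim auto
  qed
  have qidx_sets: "{x \<in> M. q (idx x) \<noteq> 0} \<in> sets BM"
  proof -
    have "{x \<in> space BM. q (idx x) \<noteq> 0} \<in> sets BM" by measurable
    then show ?thesis by simp
  qed
  have AE1: "AE p in \<pi>1. q (idx (snd p)) \<noteq> 0"
    using AEq unfolding s1(4)[symmetric] by (subst (asm) AE_distr_iff) (auto simp: qidx_sets)
  have AE2: "AE p in \<pi>2. q (idx (fst p)) \<noteq> 0"
    using AEq unfolding s2(3)[symmetric] by (subst (asm) AE_distr_iff) (auto simp: qidx_sets)
  \<comment> \<open>Density of the glued law with respect to the product of the two couplings: the
    middle points must share a cell, and given the cell \<open>n\<close> the couplings are
    independent. Integrating out either coupling gives inverse(q n) times q n, that is 1, so the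
    other one is left unchanged (\<open>G1\<close>, \<open>G2\<close>).\<close>
  define h where "h w = (if idx (snd (fst w)) = idx (fst (snd w)) then inverse (q (idx (snd (fst w)))) else 0)"
    for w :: "('a \<times> 'a) \<times> ('a \<times> 'a)"
  have [measurable]: "Measurable.pred (\<pi>1 \<Otimes>\<^sub>M \<pi>2) (\<lambda>w. idx (snd (fst w)) = idx (fst (snd w)))"
  proof -
    have eq: "(\<lambda>w. idx (snd (fst w)) = idx (fst (snd w)))
        = (\<lambda>w :: ('a \<times> 'a) \<times> ('a \<times> 'a). \<exists>n. idx (snd (fst w)) = n \<and> idx (fst (snd w)) = n)" by auto
    show ?thesis unfolding eq by measurable
  qed
  have [measurable]: "h \<in> borel_measurable (\<pi>1 \<Otimes>\<^sub>M \<pi>2)" unfolding h_def by measurable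
  define \<Gamma> where "\<Gamma> = density (\<pi>1 \<Otimes>\<^sub>M \<pi>2) h"
  have G1: "(\<integral>\<^sup>+w. F (fst w) \<partial>\<Gamma>) = (\<integral>\<^sup>+p. F p \<partial>\<pi>1)" if [measurable]: "F \<in> borel_measurable \<pi>1" for F
  proof -
    have "(\<integral>\<^sup>+w. F (fst w) \<partial>\<Gamma>) = (\<integral>\<^sup>+p. \<integral>\<^sup>+p'. h (p, p') * F p \<partial>\<pi>2 \<partial>\<pi>1)"
      unfolding \<Gamma>_def by (subst nn_integral_density) (auto simp flip: P2.nn_integral_fst)
    also have "\<dots> = (\<integral>\<^sup>+p. F p \<partial>\<pi>1)"
    proof (rule nn_integral_cong_AE, use AE1 in eventually_elim)
      fix p :: "'a \<times> 'a" assume "q (idx (snd p)) \<noteq> 0"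
      have "(\<integral>\<^sup>+p'. h (p, p') * F p \<partial>\<pi>2) =
          (\<integral>\<^sup>+p'. (inverse (q (idx (snd p))) * F p) * indicator {p' \<in> space \<pi>2. idx (fst p') = idx (snd p)} p' \<partial>\<pi>2)"
        by (intro nn_integral_cong) (auto simp: h_def indicator_def)
      also have "\<dots> = inverse (q (idx (snd p))) * F p * q (idx (snd p))"
        by (subst nn_integral_cmult_indicator) (auto simp: qp2)
      also have "\<dots> = F p" using qi[OF \<open>q (idx (snd p)) \<noteq> 0\<close>] by (simp add: mult.commute mult.left_commute)
      finally show "(\<integral>\<^sup>+p'. h (p, p') * F p \<partial>\<pi>2) = F p" .
    qed
    finally show ?thesis .
  qed
  have G2: "(\<integral>\<^sup>+w. F (snd w) \<partial>\<Gamma>) = (\<integral>\<^sup>+p. F p \<partial>\<pi>2)" if [measurable]: "F \<in> borel_measurable \<pi>2" for F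
  proof -
    have "(\<integral>\<^sup>+w. F (snd w) \<partial>\<Gamma>) = (\<integral>\<^sup>+p'. \<integral>\<^sup>+p. h (p, p') * F p' \<partial>\<pi>1 \<partial>\<pi>2)"
      unfolding \<Gamma>_def by (subst nn_integral_density) (auto simp flip: PP.nn_integral_snd)
    also have "\<dots> = (\<integral>\<^sup>+p. F p \<partial>\<pi>2)"
    proof (rule nn_integral_cong_AE, use AE2 in eventually_elim)
      fix p' :: "'a \<times> 'a" assume "q (idx (fst p')) \<noteq> 0"
      have "(\<integral>\<^sup>+p. h (p, p') * F p' \<partial>\<pi>1) =
          (\<integral>\<^sup>+p. (inverse (q (idx (fst p'))) * F p') * indicator {p \<in> space \<pi>1. idx (snd p) = idx (fst p')} p \<partial>\<pi>1)"
        by (intro nn_integral_cong) (auto simp: h_def indicator_def)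
      also have "\<dots> = inverse (q (idx (fst p'))) * F p' * q (idx (fst p'))"
        by (subst nn_integral_cmult_indicator) (auto simp: qp1)
      also have "\<dots> = F p'" using qi[OF \<open>q (idx (fst p')) \<noteq> 0\<close>] by (simp add: mult.commute mult.left_commute)
      finally show "(\<integral>\<^sup>+p. h (p, p') * F p' \<partial>\<pi>1) = F p'" .
    qed
    finally show ?thesis .
  qed
  have sG[measurable_cong]: "sets \<Gamma> = sets (\<pi>1 \<Otimes>\<^sub>M \<pi>2)" by (simp add: \<Gamma>_def)
  have GP: "prob_space \<Gamma>"
    using G1[of "\<lambda>_. 1"] P1.emeasure_space_1 by (intro prob_spaceI) simp
  have d1: "distr \<Gamma> BM (\<lambda>w. fst (fst w)) = \<mu>"
  proof (rule measure_eqI)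
    show "sets (distr \<Gamma> BM (\<lambda>w. fst (fst w))) = sets \<mu>" using coupling_marginals[OF p1] by simp
    fix A assume "A \<in> sets (distr \<Gamma> BM (\<lambda>w. fst (fst w)))"
    then have [measurable]: "A \<in> sets BM" by simp
    have "emeasure (distr \<Gamma> BM (\<lambda>w. fst (fst w))) A = (\<integral>\<^sup>+w. indicator A (fst (fst w)) \<partial>\<Gamma>)"
      by (simp add: nn_integral_distr flip: nn_integral_indicator)
    also have "\<dots> = (\<integral>\<^sup>+p. indicator A (fst p) \<partial>\<pi>1)" by (rule G1) measurable
    also have "\<dots> = emeasure \<mu> A" unfolding s1(3)[symmetric]
      by (simp add: nn_integral_distr flip: nn_integral_indicator)
    finally show "emeasure (distr \<Gamma> BM (\<lambda>w. fst (fst w))) A = emeasure \<mu> A" .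
  qed
  have d2: "distr \<Gamma> BM (\<lambda>w. snd (snd w)) = \<kappa>"
  proof (rule measure_eqI)
    show "sets (distr \<Gamma> BM (\<lambda>w. snd (snd w))) = sets \<kappa>" using coupling_marginals[OF p2] by simp
    fix A assume "A \<in> sets (distr \<Gamma> BM (\<lambda>w. snd (snd w)))"
    then have [measurable]: "A \<in> sets BM" by simp
    have "emeasure (distr \<Gamma> BM (\<lambda>w. snd (snd w))) A = (\<integral>\<^sup>+w. indicator A (snd (snd w)) \<partial>\<Gamma>)"
      by (simp add: nn_integral_distr flip: nn_integral_indicator)
    also have "\<dots> = (\<integral>\<^sup>+p. indicator A (snd p) \<partial>\<pi>2)" by (rule G2) measurable
    also have "\<dots> = emeasure \<kappa> A" unfolding s2(4)[symmetric]
      by (simp add: nn_integral_distr flip: nn_integral_indicator)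
    finally show "emeasure (distr \<Gamma> BM (\<lambda>w. snd (snd w))) A = emeasure \<kappa> A" .
  qed
  have "MKe \<mu> \<kappa> \<le> (\<integral>\<^sup>+w. ennreal (d (fst (fst w)) (snd (snd w))) \<partial>\<Gamma>)"
    using MKe_distr_le[OF GP, of "\<lambda>w. fst (fst w)" "\<lambda>w. snd (snd w)"] by (simp add: d1 d2)
  also have "\<dots> \<le> (\<integral>\<^sup>+w. ennreal (d (fst (fst w)) (snd (fst w))) + ennreal e
                       + ennreal (d (fst (snd w)) (snd (snd w))) \<partial>\<Gamma>)"
  proof (rule nn_integral_mono_AE)
    have "AE w in \<Gamma>. h w \<noteq> 0" unfolding \<Gamma>_def by (subst AE_density) (auto simp: zero_less_iff_neq_zero)
    moreover have "AE w in \<Gamma>. w \<in> space \<Gamma>" by (rule AE_space)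
    ultimately show "AE w in \<Gamma>. ennreal (d (fst (fst w)) (snd (snd w))) \<le> ennreal (d (fst (fst w)) (snd (fst w)))
        + ennreal e + ennreal (d (fst (snd w)) (snd (snd w)))"
    proof eventually_elim
      fix w assume w: "h w \<noteq> 0" "w \<in> space \<Gamma>"
      obtain x y y' z where xyz: "w = ((x, y), (y', z))" by (metis prod.collapse)
      with w have M: "x \<in> M" "y \<in> M" "y' \<in> M" "z \<in> M"
        by (auto simp: \<Gamma>_def space_pair_measure sp)
      have "idx y = idx y'" using w xyz by (auto simp: h_def split: if_splits)
      then have "d y y' < e" using idx_close M by blast
      then have "d x z \<le> d x y + e + d y' z"
        using triangle[of x y z] triangle[of y y' z] M by linarith
      then show "ennreal (d (fst (fst w)) (snd (snd w))) \<le> ennreal (d (fst (fst w)) (snd (fst w)))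
        + ennreal e + ennreal (d (fst (snd w)) (snd (snd w)))"
        using \<open>e > 0\<close> by (simp add: xyz ennreal_leI flip: ennreal_plus)
    qed
  qed
  also have "\<dots> = (\<integral>\<^sup>+w. ennreal (d (fst (fst w)) (snd (fst w))) \<partial>\<Gamma>) + ennreal e
      + (\<integral>\<^sup>+w. ennreal (d (fst (snd w)) (snd (snd w))) \<partial>\<Gamma>)"
    using prob_space.emeasure_space_1[OF GP] by (subst nn_integral_add, simp, simp, subst nn_integral_add) auto
  also have "\<dots> = (\<integral>\<^sup>+p. ennreal (d (fst p) (snd p)) \<partial>\<pi>1) + ennreal e
      + (\<integral>\<^sup>+p. ennreal (d (fst p) (snd p)) \<partial>\<pi>2)"
    using G1[of "\<lambda>p. ennreal (d (fst p) (snd p))"] G2[of "\<lambda>p. ennreal (d (fst p) (snd p))"] by simp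
  finally show ?thesis .
qed

end

lemma distr_pair_snd':
  assumes "prob_space M" "prob_space N"
  shows "distr (M \<Otimes>\<^sub>M N) N snd = N"
proof -
  interpret M: prob_space M by fact
  interpret N: prob_space N by fact
  show ?thesis
  proof (rule measure_eqI)
    fix A assume "A \<in> sets (distr (M \<Otimes>\<^sub>M N) N snd)"
    then have A: "A \<in> sets N" by simp
    then have "snd -` A \<inter> space (M \<Otimes>\<^sub>M N) = space M \<times> A"
      using sets.sets_into_space[OF A] by (auto simp: space_pair_measure)
    with A show "emeasure (distr (M \<Otimes>\<^sub>M N) N snd) A = emeasure N A"
      by (simp add: emeasure_distr N.emeasure_pair_measure_Times M.emeasure_space_1)
  qed simp
qed

context separable_metric begin

lemma MKe_obtain:
  assumes "MKe \<mu> \<nu> < \<infinity>" "e > 0"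
  obtains \<pi> where "\<pi> \<in> couplings mtopology \<mu> \<nu>"
    "(\<integral>\<^sup>+p. ennreal (d (fst p) (snd p)) \<partial>\<pi>) \<le> MKe \<mu> \<nu> + ennreal e"
proof -
  have "MKe \<mu> \<nu> < MKe \<mu> \<nu> + ennreal e" using assms by (simp add: ennreal_add_left_cancel_less[of _ 0, simplified])
  then obtain \<pi> where "\<pi> \<in> couplings mtopology \<mu> \<nu>"
    "(\<integral>\<^sup>+p. ennreal (d (fst p) (snd p)) \<partial>\<pi>) < MKe \<mu> \<nu> + ennreal e"
    by (subst (asm) (1) MKe_def) (auto simp: INF_less_iff)
  then show ?thesis using that by (auto simp: less_imp_le)
qed

lemma MKe_triangle: "MKe \<mu> \<kappa> \<le> MKe \<mu> \<nu> + MKe \<nu> \<kappa>"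
proof (rule ennreal_le_epsilon)
  fix e :: real assume fin: "MKe \<mu> \<nu> + MKe \<nu> \<kappa> < top" and e: "0 < e"
  then have f: "MKe \<mu> \<nu> < \<infinity>" "MKe \<nu> \<kappa> < \<infinity>" by auto
  obtain \<pi>1 where 1: "\<pi>1 \<in> couplings mtopology \<mu> \<nu>"
    "(\<integral>\<^sup>+p. ennreal (d (fst p) (snd p)) \<partial>\<pi>1) \<le> MKe \<mu> \<nu> + ennreal (e / 3)"
    using MKe_obtain[OF f(1), of "e / 3"] e by auto
  obtain \<pi>2 where 2: "\<pi>2 \<in> couplings mtopology \<nu> \<kappa>"
    "(\<integral>\<^sup>+p. ennreal (d (fst p) (snd p)) \<partial>\<pi>2) \<le> MKe \<nu> \<kappa> + ennreal (e / 3)"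
    using MKe_obtain[OF f(2), of "e / 3"] e by auto
  have "MKe \<mu> \<kappa> \<le> (MKe \<mu> \<nu> + ennreal (e / 3)) + ennreal (e / 3) + (MKe \<nu> \<kappa> + ennreal (e / 3))"
    using order_trans[OF coupling_glue[OF 1(1) 2(1), of "e / 3"] add_mono[OF add_right_mono[OF 1(2)] 2(2)]] e by simp
  also have "\<dots> = MKe \<mu> \<nu> + MKe \<nu> \<kappa> + (ennreal (e / 3) + ennreal (e / 3) + ennreal (e / 3))"
    by (simp add: ac_simps)
  also have "ennreal (e / 3) + ennreal (e / 3) + ennreal (e / 3) = ennreal e"
    using e by (simp flip: ennreal_plus)
  finally show "MKe \<mu> \<kappa> \<le> MKe \<mu> \<nu> + MKe \<nu> \<kappa> + ennreal e" .
qed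

lemma MKe_comm: "MKe \<mu> \<nu> = MKe \<nu> \<mu>"
proof -
  have "MKe \<nu> \<mu> \<le> MKe \<mu> \<nu>" for \<mu> \<nu>
    unfolding MKe_def[of \<mu>]
  proof (rule INF_greatest)
    fix \<pi> assume "\<pi> \<in> couplings mtopology \<mu> \<nu>"
    then have s: "prob_space \<pi>" "sets \<pi> = sets (BM \<Otimes>\<^sub>M BM)" "distr \<pi> BM fst = \<mu>" "distr \<pi> BM snd = \<nu>"
      by (auto simp: couplings_iff)
    note [measurable_cong] = s(2)
    show "MKe \<nu> \<mu> \<le> (\<integral>\<^sup>+p. ennreal (d (fst p) (snd p)) \<partial>\<pi>)"
      using MKe_distr_le[OF s(1), of snd fst] by (simp add: s commute)
  qed
  then show ?thesis by (intro antisym) auto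
qed

lemma MKe_refl:
  assumes "prob_space \<mu>" "sets \<mu> = sets BM"
  shows "MKe \<mu> \<mu> = 0"
proof -
  note [measurable_cong] = assms(2)
  have [simp]: "space \<mu> = M" using sets_eq_imp_space_eq[OF assms(2)] by simp
  have "distr \<mu> BM (\<lambda>x. x) = \<mu>" using assms(2) by (intro distr_id2) simp
  moreover have "(\<integral>\<^sup>+x. ennreal (d x x) \<partial>\<mu>) = (\<integral>\<^sup>+x. 0 \<partial>\<mu>)" by (intro nn_integral_cong) simp
  ultimately show ?thesis using MKe_distr_le[OF assms(1), of "\<lambda>x. x" "\<lambda>x. x"] by simp
qed

text \<open>Markov's inequality for a coupling: mass that starts in \<open>C\<close> and does not
  end in its \<delta>-neighbourhood has travelled at least \<delta>. It links the transport cost to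
  the masses of sets, and both definiteness and the identification of sigma-algebras rest on
  it.\<close>

lemma closed_neighbourhood_le:
  assumes "\<mu> \<in> {\<mu>. prob_space \<mu> \<and> sets \<mu> = sets BM}" "closedin mtopology C" "\<delta> > 0"
  shows "ennreal \<delta> * emeasure \<mu> C \<le> ennreal \<delta> * emeasure \<nu> (\<Union>y\<in>C. mball y \<delta>) + MKe \<mu> \<nu>"
proof (rule ennreal_le_epsilon)
  fix e :: real assume fin: "ennreal \<delta> * emeasure \<nu> (\<Union>y\<in>C. mball y \<delta>) + MKe \<mu> \<nu> < top" and e: "0 < e"
  obtain \<pi> where \<pi>: "\<pi> \<in> couplings mtopology \<mu> \<nu>"
    "(\<integral>\<^sup>+p. ennreal (d (fst p) (snd p)) \<partial>\<pi>) \<le> MKe \<mu> \<nu> + ennreal e"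
    using MKe_obtain[of \<mu> \<nu> e] fin e by auto
  then have s: "prob_space \<pi>" "sets \<pi> = sets (BM \<Otimes>\<^sub>M BM)" "distr \<pi> BM fst = \<mu>" "distr \<pi> BM snd = \<nu>"
    by (auto simp: couplings_iff)
  note [measurable_cong] = s(2)
  have sp: "space \<pi> = M \<times> M" using sets_eq_imp_space_eq[OF s(2)] by (simp add: space_pair_measure)
  let ?N = "\<Union>y\<in>C. mball y \<delta>"
  have CM: "C \<subseteq> M" using assms(2) closedin_subset by fastforce
  have [measurable]: "C \<in> sets BM" by (rule closedin_borel_of) fact
  have [measurable]: "?N \<in> sets BM" by (rule openin_borel_of) auto
  have "ennreal \<delta> * emeasure \<mu> C = (\<integral>\<^sup>+p. ennreal \<delta> * indicator C (fst p) \<partial>\<pi>)"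
    by (simp add: s(3)[symmetric] nn_integral_cmult nn_integral_distr flip: nn_integral_indicator)
  also have "\<dots> \<le> (\<integral>\<^sup>+p. ennreal \<delta> * indicator ?N (snd p) + ennreal (d (fst p) (snd p)) \<partial>\<pi>)"
  proof (rule nn_integral_mono)
    fix p assume "p \<in> space \<pi>"
    then obtain x y where p: "p = (x, y)" "x \<in> M" "y \<in> M" using sp by auto
    show "ennreal \<delta> * indicator C (fst p) \<le> ennreal \<delta> * indicator ?N (snd p) + ennreal (d (fst p) (snd p))"
    proof (cases "d x y < \<delta>")
      case True
      then show ?thesis using p by (auto simp: indicator_def)
    next
      case False
      then show ?thesis using p by (auto simp: indicator_def ennreal_leI intro: add_increasing)
    qed
  qed
  also have "\<dots> = ennreal \<delta> * emeasure \<nu> ?N + (\<integral>\<^sup>+p. ennreal (d (fst p) (snd p)) \<partial>\<pi>)"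
    by (subst nn_integral_add) (auto simp add: s(4)[symmetric] nn_integral_cmult nn_integral_distr simp flip: nn_integral_indicator)
  finally show "ennreal \<delta> * emeasure \<mu> C \<le> ennreal \<delta> * emeasure \<nu> ?N + MKe \<mu> \<nu> + ennreal e"
    using order_trans[OF _ add_left_mono[OF \<pi>(2)]] by (simp add: add.assoc)
qed

lemma neighbourhoods_decreasing:
  assumes "closedin mtopology C" "prob_space \<nu>" "sets \<nu> = sets BM"
  shows "(\<lambda>n. emeasure \<nu> (\<Union>y\<in>C. mball y (1 / Suc n))) \<longlonglongrightarrow> emeasure \<nu> C"
proof -
  interpret prob_space \<nu> by fact
  have CM: "C \<subseteq> M" using assms closedin_subset by fastforce
  let ?N = "\<lambda>n. \<Union>y\<in>C. mball y (1 / real (Suc n))"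
  have "(\<Inter>n. ?N n) = C"
  proof (intro subset_antisym subsetI)
    fix x assume x: "x \<in> (\<Inter>n. ?N n)"
    then have xM: "x \<in> M" by auto
    show "x \<in> C"
    proof (rule ccontr)
      assume "x \<notin> C"
      then obtain r where r: "r > 0" "disjnt C (mball x r)"
        using assms(1) xM unfolding closedin_metric by auto
      obtain n where n: "1 / real (Suc n) < r" using r(1) nat_approx_posE by blast
      have "x \<in> ?N n" using x by blast
      then obtain y where y: "y \<in> C" "d y x < 1 / real (Suc n)" by auto
      then have "y \<in> mball x r" using n CM xM by (auto simp: commute)
      then show False using r y by (auto simp: disjnt_iff)
    qed
  next
    fix x assume "x \<in> C"
    then show "x \<in> (\<Inter>n. ?N n)" using CM by (auto intro!: bexI[of _ x])
  qed
  moreover have "decseq ?N"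
    unfolding decseq_def
  proof (intro allI impI UN_mono mball_subset_concentric)
    fix m n :: nat assume "m \<le> n"
    then show "1 / real (Suc n) \<le> 1 / real (Suc m)" by (intro divide_left_mono) auto
  qed auto
  moreover have "range ?N \<subseteq> sets \<nu>"
    unfolding assms(3) by (auto intro!: openin_borel_of openin_Union)
  ultimately show ?thesis
    using Lim_emeasure_decseq[of ?N \<nu>] by auto
qed

lemma MKe_eq_0_imp_le:
  assumes mu: "prob_space \<mu>" "sets \<mu> = sets BM" and nu: "prob_space \<nu>" "sets \<nu> = sets BM"
    and 0: "MKe \<mu> \<nu> = 0" and C: "closedin mtopology C"
  shows "emeasure \<mu> C \<le> emeasure \<nu> C"
proof (rule LIMSEQ_le_const[OF neighbourhoods_decreasing[OF C nu]], intro exI allI impI)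
  fix n
  have "ennreal (1 / Suc n) * emeasure \<mu> C \<le> ennreal (1 / Suc n) * emeasure \<nu> (\<Union>y\<in>C. mball y (1 / Suc n))"
    using closed_neighbourhood_le[of \<mu> C "1 / Suc n" \<nu>] mu C 0 by simp
  then show "emeasure \<mu> C \<le> emeasure \<nu> (\<Union>y\<in>C. mball y (1 / Suc n))"
    by (subst (asm) ennreal_mult_le_mult_iff) (auto simp del: of_nat_Suc)
qed

text \<open>The masses of closed sets agree by the one-sided comparison used in both directions.
  Hence so do the masses of open sets, which are an intersection-stable generator.\<close>

lemma MKe_eq_0_imp_eq:
  assumes mu: "prob_space \<mu>" "sets \<mu> = sets BM" and nu: "prob_space \<nu>" "sets \<nu> = sets BM"
    and 0: "MKe \<mu> \<nu> = 0"
  shows "\<mu> = \<nu>"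
proof (rule measure_eqI_generator_eq[where \<Omega>=M and E="{U. openin mtopology U}" and A="\<lambda>_. M"])
  interpret mu: prob_space \<mu> by fact
  interpret nu: prob_space \<nu> by fact
  have sp: "space \<mu> = M" "space \<nu> = M"
    using sets_eq_imp_space_eq[OF mu(2)] sets_eq_imp_space_eq[OF nu(2)] by auto
  fix U assume "U \<in> {U. openin mtopology U}"
  then have U: "openin mtopology U" by simp
  then have cl: "closedin mtopology (M - U)" by blast
  have "U \<subseteq> M" using U openin_subset by fastforce
  then have U_eq: "U = M - (M - U)" by blast
  have eq: "emeasure \<mu> (M - U) = emeasure \<nu> (M - U)"
    using MKe_eq_0_imp_le[OF mu nu 0 cl] MKe_eq_0_imp_le[OF nu mu _ cl] 0 MKe_comm[of \<mu> \<nu>]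
    by (intro antisym) auto
  have "emeasure \<mu> U = emeasure \<mu> (space \<mu>) - emeasure \<mu> (M - U)"
    using closedin_borel_of[OF cl] mu(2) by (subst U_eq, subst sp(1)[symmetric], subst emeasure_compl) (auto simp: sp)
  moreover have "emeasure \<nu> U = emeasure \<nu> (space \<nu>) - emeasure \<nu> (M - U)"
    using closedin_borel_of[OF cl] nu(2) by (subst U_eq, subst sp(2)[symmetric], subst emeasure_compl) (auto simp: sp)
  ultimately show "emeasure \<mu> U = emeasure \<nu> U"
    by (simp add: eq mu.emeasure_space_1 nu.emeasure_space_1)
next
  show "Int_stable {U. openin mtopology U}" by (auto simp: Int_stable_def)
  show "{U. openin mtopology U} \<subseteq> Pow M" by (auto simp: openin_mtopology)
  show "sets \<mu> = sigma_sets M {U. openin mtopology U}" "sets \<nu> = sigma_sets M {U. openin mtopology U}"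
    using mu nu by (auto simp: sets_borel_of)
  show "emeasure \<mu> M \<noteq> \<infinity>"
    using prob_space.emeasure_le_1[OF mu(1), of M] by (auto simp: top_unique)
qed auto

end

section \<open>Measures with finite first moment as a metric space\<close>

locale pointed_separable_metric = separable_metric +
  fixes x0 assumes x0: "x0 \<in> M"
begin

definition fin :: "'a measure set" where
  "fin = {\<mu>. prob_space \<mu> \<and> sets \<mu> = sets BM \<and> (\<integral>\<^sup>+x. ennreal (d x x0) \<partial>\<mu>) < \<infinity>}"

definition W :: "'a measure \<Rightarrow> 'a measure \<Rightarrow> real" where
  "W = MK1 mtopology d"

lemma W_eq: "W \<mu> \<nu> = enn2real (MKe \<mu> \<nu>)"
  by (simp add: W_def MK1_def MKe_def)

lemma finD:
  assumes "\<mu> \<in> fin"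
  shows "prob_space \<mu>" "sets \<mu> = sets BM" "(\<integral>\<^sup>+x. ennreal (d x x0) \<partial>\<mu>) < \<infinity>" "space \<mu> = M"
  using assms sets_eq_imp_space_eq[of \<mu> BM] by (auto simp: fin_def)

lemma x0_measurable [measurable]: "(\<lambda>_. x0) \<in> N \<rightarrow>\<^sub>M BM"
  using x0 by (intro measurable_const) simp

text \<open>The product coupling has finite cost: the distance of two points is at most the sum of
  their distances to \<open>x0\<close>.\<close>

lemma MKe_fin:
  assumes "\<mu> \<in> fin" "\<nu> \<in> fin"
  shows "MKe \<mu> \<nu> < \<infinity>"
proof -
  note m = finD[OF assms(1)] and n = finD[OF assms(2)]
  note [measurable_cong] = m(2) n(2)
  interpret m: prob_space \<mu> by fact
  interpret n: prob_space \<nu> by fact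
  interpret pair_prob_space \<mu> \<nu> ..
  have e: "distr (\<mu> \<Otimes>\<^sub>M \<nu>) BM fst = \<mu>" "distr (\<mu> \<Otimes>\<^sub>M \<nu>) BM snd = \<nu>"
    using n.distr_pair_fst[of \<mu>] distr_pair_snd'[OF m(1) n(1)] m n distr_cong[of "\<mu> \<Otimes>\<^sub>M \<nu>" "\<mu> \<Otimes>\<^sub>M \<nu>" BM \<mu> fst fst]
      distr_cong[of "\<mu> \<Otimes>\<^sub>M \<nu>" "\<mu> \<Otimes>\<^sub>M \<nu>" BM \<nu> snd snd] by auto
  have "MKe \<mu> \<nu> \<le> (\<integral>\<^sup>+p. ennreal (d (fst p) (snd p)) \<partial>(\<mu> \<Otimes>\<^sub>M \<nu>))"
    using MKe_distr_le[OF P.prob_space_axioms, of fst snd] by (simp add: e)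
  also have "\<dots> \<le> (\<integral>\<^sup>+p. ennreal (d (fst p) x0) + ennreal (d (snd p) x0) \<partial>(\<mu> \<Otimes>\<^sub>M \<nu>))"
    using x0 triangle' by (intro nn_integral_mono) (auto simp: space_pair_measure m n ennreal_leI simp flip: ennreal_plus)
  also have "\<dots> = (\<integral>\<^sup>+p. ennreal (d (fst p) x0) \<partial>(\<mu> \<Otimes>\<^sub>M \<nu>)) + (\<integral>\<^sup>+p. ennreal (d (snd p) x0) \<partial>(\<mu> \<Otimes>\<^sub>M \<nu>))"
    by (intro nn_integral_add) auto
  also have "(\<integral>\<^sup>+p. ennreal (d (fst p) x0) \<partial>(\<mu> \<Otimes>\<^sub>M \<nu>)) = (\<integral>\<^sup>+x. ennreal (d x x0) \<partial>\<mu>)"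
    by (subst (2) e(1)[symmetric], subst nn_integral_distr) auto
  also have "(\<integral>\<^sup>+p. ennreal (d (snd p) x0) \<partial>(\<mu> \<Otimes>\<^sub>M \<nu>)) = (\<integral>\<^sup>+x. ennreal (d x x0) \<partial>\<nu>)"
    by (subst (2) e(2)[symmetric], subst nn_integral_distr) auto
  also have "(\<integral>\<^sup>+x. ennreal (d x x0) \<partial>\<mu>) + (\<integral>\<^sup>+x. ennreal (d x x0) \<partial>\<nu>) < \<infinity>"
    using m n by simp
  finally show ?thesis .
qed

lemma ennreal_W: "\<mu> \<in> fin \<Longrightarrow> \<nu> \<in> fin \<Longrightarrow> ennreal (W \<mu> \<nu>) = MKe \<mu> \<nu>"
  using MKe_fin[of \<mu> \<nu>] by (simp add: W_eq less_top)

lemma W_nonneg: "0 \<le> W \<mu> \<nu>" by (simp add: W_eq)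

sublocale W: Metric_space fin W
proof
  show "0 \<le> W \<mu> \<nu>" for \<mu> \<nu> by (rule W_nonneg)
  show "W \<mu> \<nu> = W \<nu> \<mu>" for \<mu> \<nu> by (simp add: W_eq MKe_comm)
  show "W \<mu> \<nu> = 0 \<longleftrightarrow> \<mu> = \<nu>" if "\<mu> \<in> fin" "\<nu> \<in> fin" for \<mu> \<nu>
  proof
    assume "W \<mu> \<nu> = 0"
    then have "MKe \<mu> \<nu> = 0" using ennreal_W[OF that] by simp
    then show "\<mu> = \<nu>" using MKe_eq_0_imp_eq finD that by blast
  qed (use that finD MKe_refl in \<open>simp add: W_eq\<close>)
  show "W \<mu> \<kappa> \<le> W \<mu> \<nu> + W \<nu> \<kappa>" if "\<mu> \<in> fin" "\<nu> \<in> fin" "\<kappa> \<in> fin" for \<mu> \<nu> \<kappa>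
    using MKe_triangle[of \<mu> \<kappa> \<nu>] that by (simp add: W_nonneg flip: ennreal_W ennreal_plus)
qed

lemma W_obtain:
  assumes "\<mu> \<in> fin" "\<nu> \<in> fin" "e > 0"
  obtains \<pi> where "\<pi> \<in> couplings mtopology \<mu> \<nu>"
    "(\<integral>\<^sup>+p. ennreal (d (fst p) (snd p)) \<partial>\<pi>) \<le> ennreal (W \<mu> \<nu> + e)"
proof -
  have "MKe \<mu> \<nu> + ennreal e = ennreal (W \<mu> \<nu> + e)"
    using assms by (simp add: ennreal_W W_nonneg)
  then show ?thesis using MKe_obtain[OF MKe_fin[OF assms(1,2)] assms(3)] that by auto
qed

lemma W_distr_le:
  assumes "prob_space \<Omega>" "f \<in> \<Omega> \<rightarrow>\<^sub>M BM" "g \<in> \<Omega> \<rightarrow>\<^sub>M BM"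
    "(\<integral>\<^sup>+\<omega>. ennreal (d (f \<omega>) (g \<omega>)) \<partial>\<Omega>) \<le> ennreal c" "0 \<le> c"
  shows "W (distr \<Omega> BM f) (distr \<Omega> BM g) \<le> c"
  using order_trans[OF MKe_distr_le[OF assms(1-3)] assms(4)] assms(5)
  by (simp add: W_eq enn2real_leI)

abbreviation "BW \<equiv> borel_of W.mtopology"

text \<open>Upper semicontinuity of the mass of a closed set. Some \<delta>-neighbourhood of
  \<open>C\<close> still has mass v < a under \<nu>. By \<open>closed_neighbourhood_le\<close>, a
  measure within \<delta> (a - v) of \<nu> gives \<open>C\<close> mass less than
  \<open>a\<close>.\<close>

lemma closed_evaluation_open:
  assumes C: "closedin mtopology C" and "0 < a"
  shows "openin W.mtopology {\<mu> \<in> fin. measure \<mu> C < a}"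
  unfolding W.openin_mtopology
proof safe
  fix \<nu> assume nu: "\<nu> \<in> fin" "measure \<nu> C < a"
  interpret nu: prob_space \<nu> using finD nu by blast
  have "(\<lambda>n. measure \<nu> (\<Union>y\<in>C. mball y (1 / Suc n))) \<longlonglongrightarrow> measure \<nu> C"
    using neighbourhoods_decreasing[OF C finD(1)[OF nu(1)] finD(2)[OF nu(1)]]
    by (simp add: nu.emeasure_eq_measure)
  then have "\<forall>\<^sub>F n in sequentially. measure \<nu> (\<Union>y\<in>C. mball y (1 / Suc n)) < a"
    using nu(2) by (rule order_tendstoD)
  then obtain n where n: "measure \<nu> (\<Union>y\<in>C. mball y (1 / Suc n)) < a"
    by (auto simp: eventually_sequentially)
  define \<delta> where "\<delta> = 1 / real (Suc n)"
  have d: "\<delta> > 0" by (simp add: \<delta>_def)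
  let ?v = "measure \<nu> (\<Union>y\<in>C. mball y \<delta>)"
  have "W.mball \<nu> (\<delta> * (a - ?v)) \<subseteq> {\<mu> \<in> fin. measure \<mu> C < a}"
  proof safe
    fix \<mu> assume "\<mu> \<in> W.mball \<nu> (\<delta> * (a - ?v))"
    then have mu: "\<mu> \<in> fin" "W \<mu> \<nu> < \<delta> * (a - ?v)" by (auto simp: W.commute)
    interpret mu: prob_space \<mu> using finD mu by blast
    have "ennreal (\<delta> * measure \<mu> C) \<le> ennreal (\<delta> * ?v + W \<mu> \<nu>)"
      using closed_neighbourhood_le[of \<mu> C \<delta> \<nu>] mu(1) nu(1) C finD(1,2)[OF mu(1)] d
      by (simp add: mu.emeasure_eq_measure nu.emeasure_eq_measure ennreal_mult W_nonneg flip: ennreal_W)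
    then have "\<delta> * measure \<mu> C \<le> \<delta> * ?v + W \<mu> \<nu>"
      by (subst (asm) ennreal_le_iff) (use d W_nonneg in auto)
    also have "\<dots> < \<delta> * a" using mu(2) by (simp add: algebra_simps)
    finally show "measure \<mu> C < a" using d by simp
  qed auto
  moreover have "\<delta> * (a - ?v) > 0" using n d by (simp add: \<delta>_def)
  ultimately show "\<exists>r>0. W.mball \<nu> r \<subseteq> {\<mu> \<in> fin. measure \<mu> C < a}" by blast
qed

text \<open>Every set of the sigma-algebra generated by the evaluations is Borel for the transport
  distance. This allows random measures given by the metric structure to be used as kernels, in
  \<open>bind\<close> and in product measures. Closed sets suffice as test sets because they are an
  intersection-stable generator, and for them evaluation is semicontinuous.\<close>

lemma id_measurable_prob_algebra: "(\<lambda>\<mu>. \<mu>) \<in> BW \<rightarrow>\<^sub>M prob_algebra BM"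
proof (rule measurable_prob_algebra_generated[where \<Omega>=M and G="{C. closedin mtopology C}"])
  show "sets BM = sigma_sets M {C. closedin mtopology C}"
  proof
    show "sets BM \<subseteq> sigma_sets M {C. closedin mtopology C}"
      unfolding sets_borel_of topspace_mtopology
    proof (rule sigma_sets_mono)
      show "{U. openin mtopology U} \<subseteq> sigma_sets M {C. closedin mtopology C}"
      proof safe
        fix U assume U: "openin mtopology U"
        then have "M - U \<in> sigma_sets M {C. closedin mtopology C}" by (intro sigma_sets.Basic) blast
        then have "M - (M - U) \<in> sigma_sets M {C. closedin mtopology C}" by (rule sigma_sets.Compl)
        moreover have "M - (M - U) = U" using openin_subset[OF U] by auto
        ultimately show "U \<in> sigma_sets M {C. closedin mtopology C}" by simp
      qed
    qed
    show "sigma_sets M {C. closedin mtopology C} \<subseteq> sets BM"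
      using sets.sigma_sets_subset[of "{C. closedin mtopology C}" BM] by (auto intro: closedin_borel_of)
  qed
  show "Int_stable {C. closedin mtopology C}" by (auto simp: Int_stable_def)
  show "{C. closedin mtopology C} \<subseteq> Pow M" by (auto simp: closedin_metric)
  show "prob_space \<mu>" "sets \<mu> = sets BM" if "\<mu> \<in> space BW" for \<mu>
    using that finD by auto
  fix C assume "C \<in> {C. closedin mtopology C}"
  then have C: "closedin mtopology C" by simp
  have "(\<lambda>\<mu>. measure \<mu> C) \<in> borel_measurable BW"
  proof (rule borel_measurableI_less)
    fix a :: real
    show "{\<mu> \<in> space BW. measure \<mu> C < a} \<in> sets BW"
    proof (cases "0 < a")
      case True
      then show ?thesis using openin_borel_of[OF closed_evaluation_open[OF C True]] by simp
    next
      case False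
      then have "{\<mu> \<in> space BW. measure \<mu> C < a} = {}"
        using order_trans[OF _ measure_nonneg, of a _ C] by (auto simp: not_less)
      then show ?thesis by (simp only: sets.empty_sets)
    qed
  qed
  then have "(\<lambda>\<mu>. ennreal (measure \<mu> C)) \<in> borel_measurable BW" by simp
  also have "?this \<longleftrightarrow> (\<lambda>\<mu>. emeasure \<mu> C) \<in> borel_measurable BW"
    using finD(1) by (intro measurable_cong) (auto simp: finite_measure.emeasure_eq_measure prob_space_def)
  finally show "(\<lambda>\<mu>. emeasure \<mu> C) \<in> borel_measurable BW" .
qed

end

subsection \<open>The mean field equation on a probability space\<close>

text \<open>The right-hand side \<open>V\<close> of the integral inequality is differentiable
  although \<open>w\<close> need not be, and V' = b w + g with w at most V. Hence exp(-b t) V(t) -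
  G(t) does not increase. The forcing term is kept because one path is estimated with the mean
  distance as forcing, before the mean itself is controlled.\<close>

lemma gronwall_forced:
  fixes w g :: "real \<Rightarrow> real"
  assumes w: "continuous_on {0..T} w" and g: "continuous_on {0..T} g" and b: "0 \<le> b"
    and le: "\<And>t. t \<in> {0..T} \<Longrightarrow> w t \<le> a + integral {0..t} (\<lambda>s. b * w s + g s)"
    and T: "0 \<le> T"
  shows "w T \<le> exp (b * T) * (a + integral {0..T} (\<lambda>s. exp (- b * s) * g s))"
proof -
  define V where "V t = a + integral {0..t} (\<lambda>s. b * w s + g s)" for t
  define G where "G t = integral {0..t} (\<lambda>s. exp (- b * s) * g s)" for t
  define \<Phi> where "\<Phi> t = exp (- b * t) * V t - G t" for t
  have V': "(V has_real_derivative (b * w t + g t)) (at t within {0..T})" if "t \<in> {0..T}" for t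
    unfolding V_def by (auto intro!: derivative_eq_intros integral_has_real_derivative continuous_intros w g that)
  have G': "(G has_real_derivative (exp (- b * t) * g t)) (at t within {0..T})" if "t \<in> {0..T}" for t
    unfolding G_def by (auto intro!: integral_has_real_derivative continuous_intros g that)
  have "(\<Phi> has_real_derivative (exp (- b * t) * b * (w t - V t))) (at t within {0..T})" if "t \<in> {0..T}" for t
    unfolding \<Phi>_def
    by (rule derivative_eq_intros V'[OF that] G'[OF that] refl)+ (simp add: algebra_simps)
  then have "((\<lambda>t. exp (- b * t) * b * (w t - V t)) has_integral (\<Phi> T - \<Phi> 0)) {0..T}"
    by (intro fundamental_theorem_of_calculus T) (simp add: has_real_derivative_iff_has_vector_derivative)
  from has_integral_neg[OF this] have "0 \<le> - (\<Phi> T - \<Phi> 0)"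
  proof (rule has_integral_nonneg)
    fix t assume "t \<in> {0..T}"
    then have "exp (- b * t) * b * (w t - V t) \<le> 0"
      using le b by (intro mult_nonneg_nonpos) (auto simp: V_def)
    then show "0 \<le> - (exp (- b * t) * b * (w t - V t))" by simp
  qed
  moreover have "\<Phi> 0 = a" by (simp add: \<Phi>_def V_def G_def)
  ultimately have "exp (- b * T) * V T \<le> a + G T" by (simp add: \<Phi>_def)
  then have "exp (b * T) * (exp (- b * T) * V T) \<le> exp (b * T) * (a + G T)" by simp
  moreover have "exp (b * T) * (exp (- b * T) * V T) = V T"
    by (simp add: exp_minus field_simps)
  moreover have "w T \<le> V T" using le[of T] T by (simp add: V_def)
  ultimately show ?thesis unfolding G_def by linarith
qed

text \<open>For \<open>\<mu>\<close> uniform on \<open>N\<close> points this is the \<open>N\<close>-particle system; for \<open>\<mu>\<close> a law on the phase space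
  and \<open>X 0\<close> the identity it is the flow of characteristics.\<close>

definition mf_solution ::
    "('v::euclidean_space \<Rightarrow> 'v \<Rightarrow> 'v) \<Rightarrow> 'w measure \<Rightarrow> (real \<Rightarrow> 'w \<Rightarrow> 'v) \<Rightarrow> bool" where
  "mf_solution K \<mu> X \<longleftrightarrow>
     (\<forall>t. X t \<in> borel_measurable \<mu>) \<and>
     (\<forall>T. \<exists>h. integrable \<mu> h \<and> (\<forall>t \<omega>. \<bar>t\<bar> \<le> T \<longrightarrow> \<omega> \<in> space \<mu> \<longrightarrow> norm (X t \<omega>) \<le> h \<omega>)) \<and>
     (\<forall>t. \<forall>\<omega>\<in>space \<mu>. ((\<lambda>s. X s \<omega>) has_vector_derivative (\<integral>\<omega>'. K (X t \<omega>) (X t \<omega>') \<partial>\<mu>)) (at t))"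

locale lipschitz_interaction =
  fixes K :: "'v::euclidean_space \<Rightarrow> 'v \<Rightarrow> 'v" and L :: real
  assumes K_cont: "continuous_on UNIV (\<lambda>(z, z'). K z z')"
    and K_anti: "\<And>z z'. K z z' + K z' z = 0"
    and K_lip1: "\<And>z1 z2 z'. norm (K z1 z' - K z2 z') \<le> L * norm (z1 - z2)"
    and K_lip2: "\<And>z1 z2 z. norm (K z z1 - K z z2) \<le> L * norm (z1 - z2)"
begin

lemma L_nonneg: "0 \<le> L"
proof -
  obtain b :: 'v where "b \<in> Basis" using nonempty_Basis by blast
  then have "norm b = 1" by simp
  moreover have "0 \<le> L * norm (b - 0)" using K_lip1[of b 0 0] norm_ge_zero order_trans by blast
  ultimately show ?thesis by simp
qed

lemma K_diag [simp]: "K z z = 0"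
  using K_anti[of z z] by (simp flip: scaleR_2)

lemma K_lip: "norm (K a b - K a' b') \<le> L * (norm (a - a') + norm (b - b'))"
  using norm_triangle_ineq[of "K a b - K a' b" "K a' b - K a' b'"] K_lip1[of a b a'] K_lip2[of a' b b']
  by (simp add: algebra_simps)

text \<open>Antisymmetry gives K(0,0) = 0, so the Lipschitz bound is a linear growth bound without a
  constant term.\<close>

lemma K_bound: "norm (K a b) \<le> L * (norm a + norm b)"
  using K_lip[of a b 0 0] by simp

lemma K_measurable [measurable]: "(\<lambda>(z, z'). K z z') \<in> borel_measurable (borel \<Otimes>\<^sub>M borel)"
  unfolding borel_prod by (rule borel_measurable_continuous_onI[OF K_cont])

lemma K_measurable' [measurable (raw)]:
  assumes "f \<in> borel_measurable N" "g \<in> borel_measurable N"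
  shows "(\<lambda>x. K (f x) (g x)) \<in> borel_measurable N"
  using measurable_compose[OF measurable_Pair[OF assms] K_measurable] by simp

lemma reversed: "lipschitz_interaction (\<lambda>z z'. - K z z') L"
proof
  show "continuous_on UNIV (\<lambda>(z, z'). - K z z')"
    using continuous_on_minus[OF K_cont] by (simp add: case_prod_unfold)
  show "- K z z' + - K z' z = 0" for z z' using K_anti[of z' z] by (simp add: add_eq_0_iff)
  show "norm (- K z1 z' - - K z2 z') \<le> L * norm (z1 - z2)" for z1 z2 z'
    using K_lip1[of z1 z' z2] by (simp add: norm_minus_commute)
  show "norm (- K z z1 - - K z z2) \<le> L * norm (z1 - z2)" for z1 z2 z
    using K_lip2[of z z1 z2] by (simp add: norm_minus_commute)
qed

end

lemma mf_solution_measurable [measurable_dest]: "mf_solution K \<mu> X \<Longrightarrow> X t \<in> borel_measurable \<mu>"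
  by (simp add: mf_solution_def)

lemma mf_solution_bound:
  "mf_solution K \<mu> X \<Longrightarrow>
    \<exists>h. integrable \<mu> h \<and> (\<forall>t \<omega>. \<bar>t\<bar> \<le> T \<longrightarrow> \<omega> \<in> space \<mu> \<longrightarrow> norm (X t \<omega>) \<le> h \<omega>)"
  by (simp add: mf_solution_def)

lemma mf_solution_deriv:
  "mf_solution K \<mu> X \<Longrightarrow> \<omega> \<in> space \<mu> \<Longrightarrow>
    ((\<lambda>s. X s \<omega>) has_vector_derivative (\<integral>\<omega>'. K (X t \<omega>) (X t \<omega>') \<partial>\<mu>)) (at t)"
  by (simp add: mf_solution_def)

lemma mf_solution_continuous: "mf_solution K \<mu> X \<Longrightarrow> \<omega> \<in> space \<mu> \<Longrightarrow> continuous_on S (\<lambda>s. X s \<omega>)"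
  by (intro continuous_at_imp_continuous_on ballI has_vector_derivative_continuous)
     (rule mf_solution_deriv)

lemma mf_solution_integrable:
  assumes "mf_solution K \<mu> X" shows "integrable \<mu> (X t)"
proof -
  obtain h where h: "integrable \<mu> h" "\<And>s \<omega>. \<bar>s\<bar> \<le> \<bar>t\<bar> \<Longrightarrow> \<omega> \<in> space \<mu> \<Longrightarrow> norm (X s \<omega>) \<le> h \<omega>"
    using mf_solution_bound[OF assms, of "\<bar>t\<bar>"] by blast
  show ?thesis
    using mf_solution_measurable[OF assms, of t] h(2)[of t]
    by (intro Bochner_Integration.integrable_bound[OF h(1)] AE_I2) force+
qed

text \<open>Together with \<open>reversed\<close> this transfers every estimate for positive times
  to negative times, with the same constant \<open>L\<close>.\<close>

lemma mf_solution_reverse: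
  assumes "mf_solution K \<mu> X"
  shows "mf_solution (\<lambda>z z'. - K z z') \<mu> (\<lambda>t. X (- t))"
  unfolding mf_solution_def
proof (intro conjI allI ballI)
  show "X (- t) \<in> borel_measurable \<mu>" for t using assms by measurable
  show "\<exists>h. integrable \<mu> h \<and> (\<forall>t \<omega>. \<bar>t\<bar> \<le> T \<longrightarrow> \<omega> \<in> space \<mu> \<longrightarrow> norm (X (- t) \<omega>) \<le> h \<omega>)" for T
  proof -
    obtain h where h: "integrable \<mu> h" "\<And>t \<omega>. \<bar>t\<bar> \<le> T \<Longrightarrow> \<omega> \<in> space \<mu> \<Longrightarrow> norm (X t \<omega>) \<le> h \<omega>"
      using mf_solution_bound[OF assms, of T] by blast
    then show ?thesis by (intro exI[of _ h]) auto
  qed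
  fix t \<omega> assume \<omega>: "\<omega> \<in> space \<mu>"
  have "((\<lambda>s. - s) has_vector_derivative - 1) (at t)" by (auto intro!: derivative_eq_intros)
  from vector_diff_chain_at[OF this mf_solution_deriv[OF assms \<omega>]]
  show "((\<lambda>s. X (- s) \<omega>) has_vector_derivative (\<integral>\<omega>'. - K (X (- t) \<omega>) (X (- t) \<omega>') \<partial>\<mu>)) (at t)"
    by (simp add: comp_def)
qed

text \<open>The mean field is an average over the same probability space at all times, so the
  equation is autonomous although the law of the solution moves. The group property comes from
  here.\<close>

lemma mf_solution_shift:
  assumes "mf_solution K \<mu> X"
  shows "mf_solution K \<mu> (\<lambda>t. X (t + s))"
  unfolding mf_solution_def
proof (intro conjI allI ballI)
  show "X (t + s) \<in> borel_measurable \<mu>" for t using assms by measurable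
  show "\<exists>h. integrable \<mu> h \<and> (\<forall>t \<omega>. \<bar>t\<bar> \<le> T \<longrightarrow> \<omega> \<in> space \<mu> \<longrightarrow> norm (X (t + s) \<omega>) \<le> h \<omega>)" for T
  proof -
    obtain h where h: "integrable \<mu> h"
      "\<And>t \<omega>. \<bar>t\<bar> \<le> T + \<bar>s\<bar> \<Longrightarrow> \<omega> \<in> space \<mu> \<Longrightarrow> norm (X t \<omega>) \<le> h \<omega>"
      using mf_solution_bound[OF assms, of "T + \<bar>s\<bar>"] by blast
    have "\<bar>t + s\<bar> \<le> T + \<bar>s\<bar>" if "\<bar>t\<bar> \<le> T" for t using that by linarith
    then show ?thesis using h by blast
  qed
  fix t \<omega> assume \<omega>: "\<omega> \<in> space \<mu>"
  have "((\<lambda>t. t + s) has_vector_derivative 1) (at t)" by (auto intro!: derivative_eq_intros)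
  from vector_diff_chain_at[OF this mf_solution_deriv[OF assms \<omega>]]
  show "((\<lambda>t. X (t + s) \<omega>) has_vector_derivative (\<integral>\<omega>'. K (X (t + s) \<omega>) (X (t + s) \<omega>') \<partial>\<mu>)) (at t)"
    by (simp add: comp_def)
qed

context lipschitz_interaction begin

text \<open>A measure preserving map carries a solution to another probability space. In this way
  the flows of two measures are brought to one coupling, and the flow of an empirical measure to the
  space of particle indices.\<close>

lemma mf_solution_comp:
  assumes X: "mf_solution K \<mu> X" and g [measurable]: "g \<in> \<nu> \<rightarrow>\<^sub>M \<mu>" and "distr \<nu> \<mu> g = \<mu>"
  shows "mf_solution K \<nu> (\<lambda>t \<omega>. X t (g \<omega>))"
  unfolding mf_solution_def
proof (intro conjI allI ballI)
  note [measurable] = mf_solution_measurable[OF X]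
  show "(\<lambda>\<omega>. X t (g \<omega>)) \<in> borel_measurable \<nu>" for t by measurable
  show "\<exists>h. integrable \<nu> h \<and> (\<forall>t \<omega>. \<bar>t\<bar> \<le> T \<longrightarrow> \<omega> \<in> space \<nu> \<longrightarrow> norm (X t (g \<omega>)) \<le> h \<omega>)" for T
  proof -
    obtain h where h: "integrable \<mu> h" "\<And>t \<omega>. \<bar>t\<bar> \<le> T \<Longrightarrow> \<omega> \<in> space \<mu> \<Longrightarrow> norm (X t \<omega>) \<le> h \<omega>"
      using mf_solution_bound[OF X, of T] by blast
    have "integrable \<nu> (\<lambda>\<omega>. h (g \<omega>))"
      using h(1) assms(3) by (subst integrable_distr_eq[OF g, symmetric]) auto
    then show ?thesis using h(2) measurable_space[OF g] by blast
  qed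
  fix t \<omega> assume \<omega>: "\<omega> \<in> space \<nu>"
  have "(\<integral>\<omega>'. K (X t (g \<omega>)) (X t \<omega>') \<partial>\<mu>) = (\<integral>\<omega>'. K (X t (g \<omega>)) (X t (g \<omega>')) \<partial>\<nu>)"
    by (subst assms(3)[symmetric], subst integral_distr) auto
  then show "((\<lambda>s. X s (g \<omega>)) has_vector_derivative (\<integral>\<omega>'. K (X t (g \<omega>)) (X t (g \<omega>')) \<partial>\<nu>)) (at t)"
    using mf_solution_deriv[OF X measurable_space[OF g \<omega>], of t] by simp
qed

lemma mf_solution_zero: "finite_measure \<mu> \<Longrightarrow> mf_solution K \<mu> (\<lambda>t \<omega>. 0)"
  unfolding mf_solution_def by (auto intro!: exI[of _ "\<lambda>_. 0"])

lemma integrable_K: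
  fixes Y Z :: "'w \<Rightarrow> 'v"
  assumes "finite_measure \<mu>" "integrable \<mu> Y" "Z \<in> borel_measurable \<mu>" "\<And>\<omega>. \<omega> \<in> space \<mu> \<Longrightarrow> norm (Z \<omega>) \<le> norm (Y \<omega>)"
  shows "integrable \<mu> (\<lambda>\<omega>. K z (Z \<omega>))"
proof (rule Bochner_Integration.integrable_bound[of _ "\<lambda>\<omega>. L * (norm z + norm (Y \<omega>))"])
  interpret finite_measure \<mu> by fact
  show "integrable \<mu> (\<lambda>\<omega>. L * (norm z + norm (Y \<omega>)))"
    using Bochner_Integration.integrable_norm[OF assms(2)] by auto
  show "(\<lambda>\<omega>. K z (Z \<omega>)) \<in> borel_measurable \<mu>" using assms(3) by measurable
  show "AE \<omega> in \<mu>. norm (K z (Z \<omega>)) \<le> norm (L * (norm z + norm (Y \<omega>)))"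
  proof (rule AE_I2)
    fix \<omega> assume "\<omega> \<in> space \<mu>"
    then have "L * (norm z + norm (Z \<omega>)) \<le> L * (norm z + norm (Y \<omega>))"
      using assms(4) L_nonneg by (intro mult_left_mono) auto
    then show "norm (K z (Z \<omega>)) \<le> norm (L * (norm z + norm (Y \<omega>)))"
      using K_bound[of z "Z \<omega>"] by (auto intro: order_trans)
  qed
qed

text \<open>For each sample point the velocities differ by at most L |X - Y| + L u, where
  \<open>u\<close> is the mean distance. Gronwall with \<open>u\<close> as forcing bounds every
  path; averaging this bound gives a closed inequality for \<open>u\<close>, and the result is
  inserted back into the bound for a single path. The second conclusion holds at every sample point,
  not just almost everywhere, and is later used at points that may carry no mass.\<close>

lemma stability_forward:
  assumes \<mu>: "prob_space \<mu>" and X: "mf_solution K \<mu> X" and Y: "mf_solution K \<mu> Y" and T: "0 \<le> T"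
  defines "u \<equiv> \<lambda>t. \<integral>\<omega>. norm (X t \<omega> - Y t \<omega>) \<partial>\<mu>"
  shows "u T \<le> exp (2 * L * T) * u 0"
    and "\<omega> \<in> space \<mu> \<Longrightarrow> norm (X T \<omega> - Y T \<omega>) \<le> exp (2 * L * T) * (norm (X 0 \<omega> - Y 0 \<omega>) + u 0)"
proof -
  interpret prob_space \<mu> by fact
  note [measurable] = mf_solution_measurable[OF X] mf_solution_measurable[OF Y]
  have iX: "integrable \<mu> (X t)" and iY: "integrable \<mu> (Y t)" for t
    using X Y by (auto intro: mf_solution_integrable)
  have intK: "integrable \<mu> (\<lambda>\<omega>. K z (X t \<omega>))" "integrable \<mu> (\<lambda>\<omega>. K z (Y t \<omega>))" for z t
    by (rule integrable_K[OF finite_measure_axioms]; use iX iY in auto)+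
  have u0: "0 \<le> u t" for t unfolding u_def by simp
  \<comment> \<open>Dominated convergence: this is the use of the locally uniform integrable bound
    demanded in \<open>mf_solution\<close>.\<close>
  have u_cont: "continuous_on {0..S} u" for S
  proof -
    obtain h where h: "integrable \<mu> h" "\<And>t \<omega>. \<bar>t\<bar> \<le> S \<Longrightarrow> \<omega> \<in> space \<mu> \<Longrightarrow> norm (X t \<omega>) \<le> h \<omega>"
      using mf_solution_bound[OF X, of S] by blast
    obtain h' where h': "integrable \<mu> h'" "\<And>t \<omega>. \<bar>t\<bar> \<le> S \<Longrightarrow> \<omega> \<in> space \<mu> \<Longrightarrow> norm (Y t \<omega>) \<le> h' \<omega>"
      using mf_solution_bound[OF Y, of S] by blast
    show ?thesis unfolding u_def
    proof (rule continuous_on_sequentiallyI)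
      fix \<tau> t assume \<tau>: "\<forall>n. \<tau> n \<in> {0..S}" "t \<in> {0..S}" "\<tau> \<longlonglongrightarrow> t"
      show "(\<lambda>n. \<integral>\<omega>. norm (X (\<tau> n) \<omega> - Y (\<tau> n) \<omega>) \<partial>\<mu>) \<longlonglongrightarrow> (\<integral>\<omega>. norm (X t \<omega> - Y t \<omega>) \<partial>\<mu>)"
      proof (rule integral_dominated_convergence[where w="\<lambda>\<omega>. h \<omega> + h' \<omega>"])
        show "AE \<omega> in \<mu>. (\<lambda>n. norm (X (\<tau> n) \<omega> - Y (\<tau> n) \<omega>)) \<longlonglongrightarrow> norm (X t \<omega> - Y t \<omega>)"
          using mf_solution_continuous[OF X, of _ UNIV] mf_solution_continuous[OF Y, of _ UNIV] \<tau>(3)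
          by (intro AE_I2 tendsto_intros)
            (auto simp: continuous_on_eq_continuous_at intro: isCont_tendsto_compose)
        show "AE \<omega> in \<mu>. norm (norm (X (\<tau> n) \<omega> - Y (\<tau> n) \<omega>)) \<le> h \<omega> + h' \<omega>" for n
        proof (rule AE_I2)
          fix \<omega> assume "\<omega> \<in> space \<mu>"
          then show "norm (norm (X (\<tau> n) \<omega> - Y (\<tau> n) \<omega>)) \<le> h \<omega> + h' \<omega>"
            using h(2)[of "\<tau> n" \<omega>] h'(2)[of "\<tau> n" \<omega>] norm_triangle_ineq4[of "X (\<tau> n) \<omega>" "Y (\<tau> n) \<omega>"] \<tau>(1)
            by (auto intro: order_trans[OF _ add_mono])
        qed
      qed (use h h' in auto)
    qed
  qed
  have pointwise: "norm (X t \<omega> - Y t \<omega>) \<le> exp (L * t) * (norm (X 0 \<omega> - Y 0 \<omega>) + integral {0..t} (\<lambda>s. exp (- L * s) * (L * u s)))"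
    if \<omega>: "\<omega> \<in> space \<mu>" and t: "0 \<le> t" for \<omega> t
  proof (rule gronwall_forced)
    show cont: "continuous_on {0..t} (\<lambda>t. norm (X t \<omega> - Y t \<omega>))"
      by (intro continuous_intros mf_solution_continuous[OF X \<omega>] mf_solution_continuous[OF Y \<omega>])
    show contu: "continuous_on {0..t} (\<lambda>s. L * u s)" by (intro continuous_intros u_cont)
    fix s assume s: "s \<in> {0..t}"
    define D where "D r = (\<integral>\<omega>'. K (X r \<omega>) (X r \<omega>') \<partial>\<mu>) - (\<integral>\<omega>'. K (Y r \<omega>) (Y r \<omega>') \<partial>\<mu>)" for r
    have "((\<lambda>r. X r \<omega> - Y r \<omega>) has_vector_derivative D r) (at r within {0..s})" for r
      unfolding D_def
      by (intro has_vector_derivative_diff has_vector_derivative_at_within[OF mf_solution_deriv] X Y \<omega>)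
    then have I: "(D has_integral ((X s \<omega> - Y s \<omega>) - (X 0 \<omega> - Y 0 \<omega>))) {0..s}"
      using s by (intro fundamental_theorem_of_calculus) auto
    have Dle: "norm (D r) \<le> L * norm (X r \<omega> - Y r \<omega>) + L * u r" for r
    proof -
      have "D r = (\<integral>\<omega>'. K (X r \<omega>) (X r \<omega>') - K (Y r \<omega>) (Y r \<omega>') \<partial>\<mu>)"
        unfolding D_def using intK by simp
      also have "norm \<dots> \<le> (\<integral>\<omega>'. norm (K (X r \<omega>) (X r \<omega>') - K (Y r \<omega>) (Y r \<omega>')) \<partial>\<mu>)"
        by (rule integral_norm_bound)
      also have "\<dots> \<le> (\<integral>\<omega>'. L * norm (X r \<omega> - Y r \<omega>) + L * norm (X r \<omega>' - Y r \<omega>') \<partial>\<mu>)"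
      proof (rule integral_mono)
        show "norm (K (X r \<omega>) (X r \<omega>') - K (Y r \<omega>) (Y r \<omega>')) \<le> L * norm (X r \<omega> - Y r \<omega>) + L * norm (X r \<omega>' - Y r \<omega>')" for \<omega>'
          using K_lip[of "X r \<omega>" "X r \<omega>'" "Y r \<omega>" "Y r \<omega>'"] by (simp add: algebra_simps)
      qed (use intK iX iY in auto)
      also have "\<dots> = L * norm (X r \<omega> - Y r \<omega>) + L * u r"
        using iX iY by (simp add: u_def prob_space)
      finally show ?thesis .
    qed
    have "norm ((X s \<omega> - Y s \<omega>) - (X 0 \<omega> - Y 0 \<omega>)) \<le> integral {0..s} (\<lambda>r. L * norm (X r \<omega> - Y r \<omega>) + L * u r)"
      unfolding integral_unique[OF I, symmetric]
    proof (rule integral_norm_bound_integral)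
      show "D integrable_on {0..s}" using I by auto
      have "continuous_on {0..s} (\<lambda>r. L * norm (X r \<omega> - Y r \<omega>) + L * u r)"
        by (intro continuous_intros u_cont mf_solution_continuous[OF X \<omega>] mf_solution_continuous[OF Y \<omega>])
      then show "(\<lambda>r. L * norm (X r \<omega> - Y r \<omega>) + L * u r) integrable_on {0..s}"
        by (rule integrable_continuous_interval)
    qed (rule Dle)
    then show "norm (X s \<omega> - Y s \<omega>) \<le> norm (X 0 \<omega> - Y 0 \<omega>) + integral {0..s} (\<lambda>r. L * norm (X r \<omega> - Y r \<omega>) + L * u r)"
      using norm_triangle_sub[of "X s \<omega> - Y s \<omega>" "X 0 \<omega> - Y 0 \<omega>"] by linarith
  qed (use L_nonneg t in auto)
  have averaged: "u t \<le> exp (L * t) * (u 0 + integral {0..t} (\<lambda>s. exp (- L * s) * (L * u s)))" if t: "0 \<le> t" for t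
  proof -
    have "u t = (\<integral>\<omega>. norm (X t \<omega> - Y t \<omega>) \<partial>\<mu>)" by (simp add: u_def)
    also have "\<dots> \<le> (\<integral>\<omega>. exp (L * t) * (norm (X 0 \<omega> - Y 0 \<omega>) + integral {0..t} (\<lambda>s. exp (- L * s) * (L * u s))) \<partial>\<mu>)"
    proof (rule integral_mono)
      show "norm (X t \<omega> - Y t \<omega>) \<le> exp (L * t) * (norm (X 0 \<omega> - Y 0 \<omega>) + integral {0..t} (\<lambda>s. exp (- L * s) * (L * u s)))"
        if "\<omega> \<in> space \<mu>" for \<omega> using pointwise[OF that t] .
    qed (use iX iY in auto)
    also have "\<dots> = exp (L * t) * (u 0 + integral {0..t} (\<lambda>s. exp (- L * s) * (L * u s)))"
      using iX iY by (simp add: u_def prob_space)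
    finally show ?thesis .
  qed
  \<comment> \<open>The averaged inequality already contains the factor exp(L t). So Gronwall is
    applied to exp(-L s) u(s), which grows at rate L; undoing the factor makes the rate 2L.\<close>
  have growth: "u t \<le> exp (2 * L * t) * u 0" if t: "0 \<le> t" for t
  proof -
    have "exp (- L * t) * u t \<le> exp (L * t) * (u 0 + integral {0..t} (\<lambda>s. exp (- L * s) * 0))"
    proof (rule gronwall_forced[where T = t and w = "\<lambda>t. exp (- L * t) * u t"])
      show "continuous_on {0..t} (\<lambda>t. exp (- L * t) * u t)" by (intro continuous_intros u_cont)
      fix s assume s: "s \<in> {0..t}"
      have "exp (- L * s) * u s \<le> exp (- L * s) * (exp (L * s) * (u 0 + integral {0..s} (\<lambda>s. exp (- L * s) * (L * u s))))"
        using averaged[of s] s by (intro mult_left_mono) auto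
      also have "\<dots> = u 0 + integral {0..s} (\<lambda>s. exp (- L * s) * (L * u s))"
        by (simp add: mult.assoc[symmetric] flip: exp_add)
      also have "(\<lambda>s. exp (- L * s) * (L * u s)) = (\<lambda>s. L * (exp (- L * s) * u s) + 0)"
        by (simp add: algebra_simps)
      finally show "exp (- L * s) * u s \<le> u 0 + integral {0..s} (\<lambda>s. L * (exp (- L * s) * u s) + 0)" .
    qed (use L_nonneg t in auto)
    then have "exp (L * t) * (exp (- L * t) * u t) \<le> exp (L * t) * (exp (L * t) * u 0)"
      by (intro mult_left_mono) auto
    then show ?thesis by (simp add: mult.assoc[symmetric] flip: exp_add)
  qed
  show "u T \<le> exp (2 * L * T) * u 0" by (rule growth[OF T])
  show "norm (X T \<omega> - Y T \<omega>) \<le> exp (2 * L * T) * (norm (X 0 \<omega> - Y 0 \<omega>) + u 0)" if \<omega>: "\<omega> \<in> space \<mu>"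
  proof -
    have "((\<lambda>s. exp (L * s) * u 0) has_vector_derivative (exp (L * s) * (L * u 0))) (at s within {0..T})" for s
      unfolding has_real_derivative_iff_has_vector_derivative[symmetric]
      by (auto intro!: derivative_eq_intros)
    then have I: "((\<lambda>s. exp (L * s) * (L * u 0)) has_integral (exp (L * T) * u 0 - exp (L * 0) * u 0)) {0..T}"
      using T by (intro fundamental_theorem_of_calculus)
    \<comment> \<open>With \<open>growth\<close> the forcing exp(-L s) L u(s) is at most L exp(L s)
      u(0), whose integral is exactly exp(L T) u(0) - u(0).\<close>
    have "integral {0..T} (\<lambda>s. exp (- L * s) * (L * u s)) \<le> integral {0..T} (\<lambda>s. exp (L * s) * (L * u 0))"
    proof (rule integral_le)
      show "(\<lambda>s. exp (- L * s) * (L * u s)) integrable_on {0..T}"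
        by (intro integrable_continuous_interval continuous_intros u_cont)
      show "exp (- L * s) * (L * u s) \<le> exp (L * s) * (L * u 0)" if "s \<in> {0..T}" for s
      proof -
        have "exp (- L * s) * (L * u s) \<le> exp (- L * s) * (L * (exp (2 * L * s) * u 0))"
          using growth[of s] that L_nonneg by (intro mult_left_mono) auto
        also have "\<dots> = exp (- L * s + 2 * L * s) * (L * u 0)" unfolding exp_add by (simp add: algebra_simps)
        finally show ?thesis by simp
      qed
    qed (use I in auto)
    also have "\<dots> = exp (L * T) * u 0 - u 0" using integral_unique[OF I] by simp
    finally have le: "integral {0..T} (\<lambda>s. exp (- L * s) * (L * u s)) \<le> exp (L * T) * u 0 - u 0" .
    have e1: "1 \<le> exp (L * T)" using L_nonneg T by simp
    have "norm (X T \<omega> - Y T \<omega>) \<le> exp (L * T) * (norm (X 0 \<omega> - Y 0 \<omega>) + (exp (L * T) * u 0 - u 0))"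
      by (rule order_trans[OF pointwise[OF \<omega> T] mult_left_mono[OF add_left_mono[OF le]]]) simp
    \<comment> \<open>The term - u(0) is dropped and the initial distance is multiplied by exp(L T),
      which is at least 1, so that both contributions carry the common factor exp(2 L T).\<close>
    also have "\<dots> \<le> exp (L * T) * (exp (L * T) * norm (X 0 \<omega> - Y 0 \<omega>) + exp (L * T) * u 0)"
      using u0[of 0] mult_right_mono[OF e1 norm_ge_zero[of "X 0 \<omega> - Y 0 \<omega>"]]
      by (intro mult_left_mono) auto
    also have "\<dots> = exp (2 * L * T) * (norm (X 0 \<omega> - Y 0 \<omega>) + u 0)"
    proof -
      have "exp (2 * L * T) = exp (L * T) * exp (L * T)" by (simp flip: exp_add)
      then show ?thesis by (simp add: algebra_simps)
    qed
    finally show ?thesis .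
  qed
qed

lemma stability:
  assumes "prob_space \<mu>" and X: "mf_solution K \<mu> X" and Y: "mf_solution K \<mu> Y"
  shows "(\<integral>\<omega>. norm (X t \<omega> - Y t \<omega>) \<partial>\<mu>) \<le> exp (2 * L * \<bar>t\<bar>) * (\<integral>\<omega>. norm (X 0 \<omega> - Y 0 \<omega>) \<partial>\<mu>)"
    and "\<omega> \<in> space \<mu> \<Longrightarrow> norm (X t \<omega> - Y t \<omega>)
      \<le> exp (2 * L * \<bar>t\<bar>) * (norm (X 0 \<omega> - Y 0 \<omega>) + (\<integral>\<omega>. norm (X 0 \<omega> - Y 0 \<omega>) \<partial>\<mu>))"
proof -
  interpret R: lipschitz_interaction "\<lambda>z z'. - K z z'" L by (rule reversed)
  note F = stability_forward[OF assms] 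
    and B = R.stability_forward[OF assms(1) mf_solution_reverse[OF X] mf_solution_reverse[OF Y], of "- t"]
  show "(\<integral>\<omega>. norm (X t \<omega> - Y t \<omega>) \<partial>\<mu>) \<le> exp (2 * L * \<bar>t\<bar>) * (\<integral>\<omega>. norm (X 0 \<omega> - Y 0 \<omega>) \<partial>\<mu>)"
    using F(1)[of t] B(1) by (cases "t \<ge> 0") auto
  show "norm (X t \<omega> - Y t \<omega>)
      \<le> exp (2 * L * \<bar>t\<bar>) * (norm (X 0 \<omega> - Y 0 \<omega>) + (\<integral>\<omega>. norm (X 0 \<omega> - Y 0 \<omega>) \<partial>\<mu>))" if "\<omega> \<in> space \<mu>"
    using F(2)[of t \<omega>] B(2)[of \<omega>] that by (cases "t \<ge> 0") auto
qed

end

text \<open>By substitution the expression is the signed integral of \<open>g\<close> from 0 to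
  \<open>t\<close>. Over the fixed interval from 0 to 1 it makes sense for both signs of
  \<open>t\<close>, and continuity in further parameters is direct.\<close>

lemma has_vector_derivative_scaled_integral:
  fixes g :: "real \<Rightarrow> 'b::banach"
  assumes g: "continuous_on UNIV g"
  shows "((\<lambda>t. t *\<^sub>R integral {0..1} (\<lambda>\<sigma>. g (t * \<sigma>))) has_vector_derivative g t) (at t)"
proof -
  define R where "R = \<bar>t\<bar> + 1"
  obtain h where h: "\<And>x. x \<in> {-R..R} \<Longrightarrow> (h has_vector_derivative g x) (at x within {-R..R})"
    using antiderivative_continuous[OF continuous_on_subset[OF g subset_UNIV, of "{-R..R}"]] by metis
  have eq: "s *\<^sub>R integral {0..1} (\<lambda>\<sigma>. g (s * \<sigma>)) = h s - h 0" if s: "s \<in> {-R..R}" for s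
  proof -
    have s1: "s * \<sigma> \<in> {-R..R}" if "\<sigma> \<in> {0..1}" for \<sigma>
    proof -
      have "\<bar>s * \<sigma>\<bar> \<le> R * 1" unfolding abs_mult using s that by (intro mult_mono) auto
      then show ?thesis by auto
    qed
    have "((\<lambda>\<sigma>. h (s * \<sigma>)) has_vector_derivative s *\<^sub>R g (s * \<sigma>)) (at \<sigma> within {0..1})"
      if \<sigma>: "\<sigma> \<in> {0..1}" for \<sigma>
    proof -
      have "((*) s has_vector_derivative s) (at \<sigma> within {0..1})"
        by (auto intro!: derivative_eq_intros)
      moreover have "(h has_vector_derivative g (s * \<sigma>)) (at (s * \<sigma>) within ((*) s ` {0..1}))"
        by (rule has_vector_derivative_within_subset[OF h[OF s1[OF \<sigma>]]]) (use s1 in auto)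
      ultimately show ?thesis using vector_diff_chain_within[of "(*) s" s \<sigma> "{0..1}" h] by (simp add: comp_def)
    qed
    then have "((\<lambda>\<sigma>. s *\<^sub>R g (s * \<sigma>)) has_integral (h (s * 1) - h (s * 0))) {0..1}"
      by (intro fundamental_theorem_of_calculus) auto
    from integral_unique[OF this] show ?thesis by simp
  qed
  have "(h has_vector_derivative g t) (at t within {-R<..<R})"
    by (rule has_vector_derivative_within_subset[OF h]) (auto simp: R_def)
  then have "(h has_vector_derivative g t) (at t)"
    by (subst (asm) has_vector_derivative_within_open) (auto simp: R_def)
  then have "((\<lambda>s. h s - h 0) has_vector_derivative g t - 0) (at t)"
    by (intro has_vector_derivative_diff has_vector_derivative_const)
  then have "((\<lambda>s. h s - h 0) has_vector_derivative g t) (at t)" by simp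
  then show ?thesis
    by (rule has_vector_derivative_transform_within_open[where S="{-R<..<R}"]) (auto simp: R_def eq)
qed

context lipschitz_interaction begin

text \<open>Picard iteration as one global contraction, on functions of time and position that are a
  bounded continuous function times the weight exp(l |t|) (1 + |z|). The exponential makes the map
  contract on all of the time axis at once, and the linear factor admits the identity as initial
  datum. Joint continuity comes with the function space.\<close>

theorem mf_flow_exists:
  assumes f: "prob_space f" and sf: "sets f = sets borel" and int: "integrable f norm"
  shows "\<exists>X. mf_solution K f X \<and> (\<forall>z. X 0 z = z) \<and> continuous_on UNIV (\<lambda>(t, z). X t z)"
proof -
  interpret prob_space f by fact
  note [measurable_cong] = sf
  have [simp]: "space f = UNIV" using sets_eq_imp_space_eq[OF sf] by simp
  have [simp]: "prob UNIV = 1" using prob_space by simp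
  define M where "M = (\<integral>z. norm z \<partial>f)"
  have M0: "0 \<le> M" by (simp add: M_def)
  \<comment> \<open>In the weighted norm the velocity has Lipschitz constant L (2 + M), where 2 +
    |z| + M is bounded by (2 + M) (1 + |z|). Integrating exp(l |s|) in time gains 1/l, so this
    \<open>l\<close> gives contraction by 1/2. The summand 1 keeps \<open>l\<close> positive when
    \<open>L\<close> is 0.\<close>
  define l where "l = 2 * L * (2 + M) + 1"
  have l: "0 < l" "2 * (L * (2 + M)) \<le> l" using L_nonneg M0 by (auto simp: l_def add_nonneg_pos)
  define wt where "wt p = exp (l * \<bar>fst p\<bar>) * (1 + norm (snd p))" for p :: "real \<times> 'v"
  have wt: "0 < wt p" for p by (simp add: wt_def add_pos_nonneg)
  have wt_cont: "continuous_on S wt" for S unfolding wt_def by (intro continuous_intros)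
  define \<zeta> where "\<zeta> u p = wt p *\<^sub>R apply_bcontfun u p" for u :: "(real \<times> 'v) \<Rightarrow>\<^sub>C 'v" and p
  have \<zeta>_cont: "continuous_on S (\<zeta> u)" for S u
    unfolding \<zeta>_def by (intro continuous_intros wt_cont continuous_on_apply_bcontfun)
  have \<zeta>_isCont: "isCont (\<zeta> u) p" for u p
    using \<zeta>_cont[of UNIV u] continuous_on_eq_continuous_at[OF open_UNIV] by blast
  have \<zeta>_meas[measurable]: "(\<lambda>z. \<zeta> u (s, z)) \<in> borel_measurable borel" for u s
    by (intro borel_measurable_continuous_onI continuous_on_compose2[OF \<zeta>_cont[of UNIV]] continuous_intros) auto
  have \<zeta>_diff: "norm (\<zeta> u p - \<zeta> v p) \<le> dist u v * wt p" for u v p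
  proof -
    have "norm (\<zeta> u p - \<zeta> v p) = wt p * dist (apply_bcontfun u p) (apply_bcontfun v p)"
      using wt[of p] by (simp add: \<zeta>_def dist_norm flip: scaleR_diff_right)
    also have "\<dots> \<le> wt p * dist u v" using wt[of p] dist_bounded[of u p v] by (intro mult_left_mono) auto
    finally show ?thesis by (simp add: mult.commute)
  qed
  have \<zeta>_0: "\<zeta> 0 p = 0" for p by (simp add: \<zeta>_def)
  have \<zeta>_le: "norm (\<zeta> u p) \<le> norm u * wt p" for u p using \<zeta>_diff[of u p 0] by (simp add: \<zeta>_0)
  have wt_int: "integrable f (\<lambda>z. wt (s, z))" for s unfolding wt_def using int by auto
  have \<zeta>_int: "integrable f (\<lambda>z. \<zeta> u (s, z))" for u s
    by (rule Bochner_Integration.integrable_bound[of _ "\<lambda>z. norm u * wt (s, z)"])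
       (use wt_int \<zeta>_le in \<open>auto intro!: AE_I2 intro: order_trans[OF _ abs_ge_self]\<close>)
  have K_int: "integrable f (\<lambda>z. K a (\<zeta> u (s, z)))" for a u s
    by (rule integrable_K[OF finite_measure_axioms \<zeta>_int]) auto
  \<comment> \<open>The mean field velocity that the candidate \<open>\<zeta> u\<close> would
    produce, with \<zeta> restoring the weight.\<close>
  define G where "G u p = (\<integral>z'. K (\<zeta> u p) (\<zeta> u (fst p, z')) \<partial>f)" for u p
  have G_diff: "norm (G u p - G v p) \<le> (L * (2 + M) * dist u v) * wt p" for u v p
  proof -
    obtain s z where p: "p = (s, z)" by fastforce
    have "G u p - G v p = (\<integral>z'. K (\<zeta> u p) (\<zeta> u (s, z')) - K (\<zeta> v p) (\<zeta> v (s, z')) \<partial>f)"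
      unfolding G_def using K_int by (simp add: p)
    also have "norm \<dots> \<le> (\<integral>z'. norm (K (\<zeta> u p) (\<zeta> u (s, z')) - K (\<zeta> v p) (\<zeta> v (s, z'))) \<partial>f)"
      by (rule integral_norm_bound)
    also have "\<dots> \<le> (\<integral>z'. L * (dist u v * wt p) + L * dist u v * wt (s, z') \<partial>f)"
    proof (rule integral_mono)
      fix z'
      have "norm (K (\<zeta> u p) (\<zeta> u (s, z')) - K (\<zeta> v p) (\<zeta> v (s, z')))
          \<le> L * (norm (\<zeta> u p - \<zeta> v p) + norm (\<zeta> u (s, z') - \<zeta> v (s, z')))" by (rule K_lip)
      also have "\<dots> \<le> L * (dist u v * wt p + dist u v * wt (s, z'))"
        by (intro mult_left_mono add_mono \<zeta>_diff L_nonneg)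
      finally show "norm (K (\<zeta> u p) (\<zeta> u (s, z')) - K (\<zeta> v p) (\<zeta> v (s, z')))
          \<le> L * (dist u v * wt p) + L * dist u v * wt (s, z')" by (simp add: algebra_simps)
    qed (use K_int wt_int in auto)
    also have "\<dots> = L * dist u v * (wt p + (\<integral>z'. wt (s, z') \<partial>f))"
      using wt_int by (simp add: prob_space algebra_simps)
    also have "(\<integral>z'. wt (s, z') \<partial>f) = exp (l * \<bar>s\<bar>) * (1 + M)"
      unfolding wt_def M_def using int by (simp add: prob_space)
    also have "L * dist u v * (wt p + exp (l * \<bar>s\<bar>) * (1 + M)) \<le> L * dist u v * ((2 + M) * wt p)"
    proof (rule mult_left_mono)
      have "wt p + exp (l * \<bar>s\<bar>) * (1 + M) = exp (l * \<bar>s\<bar>) * (2 + norm z + M)"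
        by (simp add: wt_def p algebra_simps)
      also have "\<dots> \<le> exp (l * \<bar>s\<bar>) * ((2 + M) * (1 + norm z))"
        using M0 by (intro mult_left_mono) (auto simp: algebra_simps)
      finally show "wt p + exp (l * \<bar>s\<bar>) * (1 + M) \<le> (2 + M) * wt p" by (simp add: wt_def p algebra_simps)
    qed (use L_nonneg in auto)
    finally show ?thesis by (simp add: algebra_simps)
  qed
  have G_0: "G 0 p = 0" for p by (simp add: G_def \<zeta>_0)
  have G_cont: "continuous_on UNIV (G u)" for u
  proof (rule continuous_on_sequentiallyI)
    fix q :: "nat \<Rightarrow> real \<times> 'v" and p assume q: "q \<longlonglongrightarrow> p"
    \<comment> \<open>A convergent sequence stays in a bounded set, on which the weight has one
      integrable majorant in z'.\<close>
    have "bounded (range q)" using convergent_imp_bounded[OF q] .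
    then obtain B where B: "\<And>n. norm (q n) \<le> B" unfolding bounded_iff by auto
    have "0 \<le> B" using B[of 0] norm_ge_zero order_trans by blast
    have fs: "\<bar>fst (q n)\<bar> \<le> B" "norm (snd (q n)) \<le> B" for n
      using order_trans[OF norm_fst_le[of "fst (q n)" "snd (q n)"]] order_trans[OF norm_snd_le[of "snd (q n)" "fst (q n)"]]
        B[of n] by simp_all
    have wB: "wt (fst (q n), z') \<le> exp (l * B) * (1 + norm z')" for n z'
      unfolding wt_def fst_conv snd_conv using fs(1)[of n] l by (intro mult_right_mono) auto
    show "(\<lambda>n. G u (q n)) \<longlonglongrightarrow> G u p"
      unfolding G_def
    proof (rule integral_dominated_convergence[where w="\<lambda>z'. L * norm u * (exp (l * B) * (1 + B) + exp (l * B) * (1 + norm z'))"])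
      show "AE z' in f. (\<lambda>n. K (\<zeta> u (q n)) (\<zeta> u (fst (q n), z'))) \<longlonglongrightarrow> K (\<zeta> u p) (\<zeta> u (fst p, z'))"
      proof (rule AE_I2)
        fix z'
        have 1: "(\<lambda>n. \<zeta> u (q n)) \<longlonglongrightarrow> \<zeta> u p"
          by (rule isCont_tendsto_compose[OF \<zeta>_isCont q])
        have 2: "(\<lambda>n. \<zeta> u (fst (q n), z')) \<longlonglongrightarrow> \<zeta> u (fst p, z')"
          by (intro isCont_tendsto_compose[OF \<zeta>_isCont] tendsto_intros q)
        have "isCont (\<lambda>(a, b). K a b) (\<zeta> u p, \<zeta> u (fst p, z'))"
          using K_cont continuous_on_eq_continuous_at[OF open_UNIV] by blast
        from isCont_tendsto_compose[OF this tendsto_Pair[OF 1 2]]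
        show "(\<lambda>n. K (\<zeta> u (q n)) (\<zeta> u (fst (q n), z'))) \<longlonglongrightarrow> K (\<zeta> u p) (\<zeta> u (fst p, z'))" by simp
      qed
      show "AE z' in f. norm (K (\<zeta> u (q n)) (\<zeta> u (fst (q n), z'))) \<le> L * norm u * (exp (l * B) * (1 + B) + exp (l * B) * (1 + norm z'))" for n
      proof (rule AE_I2)
        fix z'
        have "norm (K (\<zeta> u (q n)) (\<zeta> u (fst (q n), z'))) \<le> L * (norm (\<zeta> u (q n)) + norm (\<zeta> u (fst (q n), z')))"
          by (rule K_bound)
        also have "\<dots> \<le> L * (norm u * (exp (l * B) * (1 + B)) + norm u * (exp (l * B) * (1 + norm z')))"
        proof (intro mult_left_mono add_mono L_nonneg)
          have "wt (q n) \<le> exp (l * B) * (1 + B)"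
            using wB[of n "snd (q n)"] fs(2)[of n] by (auto intro: order_trans)
          then show "norm (\<zeta> u (q n)) \<le> norm u * (exp (l * B) * (1 + B))"
            by (intro order_trans[OF \<zeta>_le] mult_left_mono) auto
          show "norm (\<zeta> u (fst (q n), z')) \<le> norm u * (exp (l * B) * (1 + norm z'))"
            by (intro order_trans[OF \<zeta>_le] mult_left_mono wB) auto
        qed
        finally show "norm (K (\<zeta> u (q n)) (\<zeta> u (fst (q n), z'))) \<le> L * norm u * (exp (l * B) * (1 + B) + exp (l * B) * (1 + norm z'))"
          by (simp add: algebra_simps)
      qed
    qed (use int in auto)
  qed
  have GI_cont: "continuous_on UNIV (\<lambda>p. integral {0..1} (\<lambda>\<sigma>. G u (fst p * \<sigma>, snd p)))" for u
  proof -
    have "continuous_on (UNIV \<times> cbox 0 1) (\<lambda>(p, \<sigma>). G u (fst p * \<sigma>, snd p))"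
      unfolding case_prod_unfold
      by (intro continuous_on_compose2[OF G_cont] continuous_intros) auto
    from integral_continuous_on_param[OF this] show ?thesis by simp
  qed
  have Gl_cont: "continuous_on S (\<lambda>\<sigma>. G u (t * \<sigma>, z))" for u t z S
    by (intro continuous_on_compose2[OF G_cont] continuous_intros) auto
  define J where "J u p = fst p *\<^sub>R integral {0..1} (\<lambda>\<sigma>. G u (fst p * \<sigma>, snd p))" for u p
  have J_diff: "norm (J u p - J v p) \<le> dist u v / 2 * wt p" for u v p
  proof -
    obtain t z where p: "p = (t, z)" by fastforce
    define C where "C = L * (2 + M) * dist u v"
    have C0: "0 \<le> C" using L_nonneg M0 by (simp add: C_def)
    have "((\<lambda>\<sigma>. exp (l * \<bar>t\<bar> * \<sigma>) / l) has_vector_derivative (\<bar>t\<bar> * exp (l * \<bar>t\<bar> * \<sigma>))) (at \<sigma> within {0..1})" for \<sigma>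
      unfolding has_real_derivative_iff_has_vector_derivative[symmetric]
      using l by (auto intro!: derivative_eq_intros)
    then have I: "((\<lambda>\<sigma>. \<bar>t\<bar> * exp (l * \<bar>t\<bar> * \<sigma>)) has_integral (exp (l * \<bar>t\<bar> * 1) / l - exp (l * \<bar>t\<bar> * 0) / l)) {0..1}"
      by (intro fundamental_theorem_of_calculus) auto
    have I2: "((\<lambda>\<sigma>. C * (1 + norm z) * (\<bar>t\<bar> * exp (l * \<bar>t\<bar> * \<sigma>))) has_integral
        (C * (1 + norm z) * (exp (l * \<bar>t\<bar> * 1) / l - exp (l * \<bar>t\<bar> * 0) / l))) {0..1}"
      using has_integral_mult_right[OF I] by simp
    have ii: "(\<lambda>\<sigma>. G w (t * \<sigma>, z)) integrable_on {0..1}" for w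
      by (intro integrable_continuous_interval Gl_cont)
    have "J u p - J v p = integral {0..1} (\<lambda>\<sigma>. t *\<^sub>R (G u (t * \<sigma>, z) - G v (t * \<sigma>, z)))"
      using integral_diff[OF ii[of u] ii[of v]] unfolding integral_cmul by (simp add: J_def p scaleR_diff_right del: integral_diff)
    also have "norm \<dots> \<le> integral {0..1} (\<lambda>\<sigma>. C * (1 + norm z) * (\<bar>t\<bar> * exp (l * \<bar>t\<bar> * \<sigma>)))"
    proof (rule integral_norm_bound_integral)
      show "(\<lambda>\<sigma>. t *\<^sub>R (G u (t * \<sigma>, z) - G v (t * \<sigma>, z))) integrable_on {0..1}"
        by (intro integrable_continuous_interval continuous_intros Gl_cont)
      fix \<sigma> :: real assume \<sigma>: "\<sigma> \<in> {0..1}"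
      have "norm (t *\<^sub>R (G u (t * \<sigma>, z) - G v (t * \<sigma>, z))) \<le> \<bar>t\<bar> * (C * wt (t * \<sigma>, z))"
        using G_diff[of u "(t * \<sigma>, z)" v] by (auto simp: C_def intro!: mult_left_mono)
      also have "\<bar>t\<bar> * (C * wt (t * \<sigma>, z)) = C * (1 + norm z) * (\<bar>t\<bar> * exp (l * \<bar>t\<bar> * \<sigma>))"
        using \<sigma> by (simp add: wt_def abs_mult algebra_simps)
      finally show "norm (t *\<^sub>R (G u (t * \<sigma>, z) - G v (t * \<sigma>, z))) \<le> C * (1 + norm z) * (\<bar>t\<bar> * exp (l * \<bar>t\<bar> * \<sigma>))" .
    qed (use I2 in auto)
    also have "\<dots> = C * (1 + norm z) * ((exp (l * \<bar>t\<bar>) - 1) / l)"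
      using integral_unique[OF I2] by (simp add: diff_divide_distrib)
    also have "\<dots> \<le> C * (1 + norm z) * (exp (l * \<bar>t\<bar>) / l)"
      using C0 l by (intro mult_left_mono divide_right_mono) auto
    also have "\<dots> = C / l * wt p" by (simp add: wt_def p)
    also have "\<dots> \<le> dist u v / 2 * wt p"
    proof (intro mult_right_mono)
      have "2 * C \<le> dist u v * l" unfolding C_def using mult_left_mono[OF l(2) zero_le_dist[of u v]] by (simp add: algebra_simps)
      then show "C / l \<le> dist u v / 2" using l by (simp add: field_simps)
    qed (use wt[of p] in auto)
    finally show ?thesis .
  qed
  have J_0: "J 0 p = 0" for p by (simp add: J_def G_0)
  define \<Phi> where "\<Phi> u p = (1 / wt p) *\<^sub>R (snd p + J u p)" for u p
  have \<Phi>_in: "\<Phi> u \<in> bcontfun" for u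
  proof (rule bcontfun_normI)
    have "wt p \<noteq> 0" for p using wt[of p] by simp
    then show "continuous_on UNIV (\<Phi> u)" unfolding \<Phi>_def J_def
      by (intro continuous_intros wt_cont GI_cont) auto
    fix p
    have "norm (snd p + J u p) \<le> wt p + norm u / 2 * wt p"
    proof (rule order_trans[OF norm_triangle_ineq add_mono])
      have "1 * (1 + norm (snd p)) \<le> wt p" unfolding wt_def using l by (intro mult_right_mono) auto
      then show "norm (snd p) \<le> wt p" by simp
      show "norm (J u p) \<le> norm u / 2 * wt p" using J_diff[of u p 0] by (simp add: J_0)
    qed
    then show "norm (\<Phi> u p) \<le> 1 + norm u / 2"
      using wt[of p] by (simp add: \<Phi>_def divide_simps) (simp add: algebra_simps)
  qed
  have "\<exists>!u. Bcontfun (\<Phi> u) = u"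
  proof (rule banach_fix_type[of "1/2"])
    show "\<forall>u v. dist (Bcontfun (\<Phi> u)) (Bcontfun (\<Phi> v)) \<le> 1 / 2 * dist u v"
    proof (intro allI dist_bound)
      fix u v p
      have "dist (\<Phi> u p) (\<Phi> v p) = norm (J u p - J v p) / wt p"
        using wt[of p] by (simp add: \<Phi>_def dist_norm flip: scaleR_diff_right)
      also have "\<dots> \<le> 1 / 2 * dist u v" using J_diff[of u p v] wt[of p] by (simp add: divide_simps)
      finally show "dist (apply_bcontfun (Bcontfun (\<Phi> u)) p) (apply_bcontfun (Bcontfun (\<Phi> v)) p) \<le> 1 / 2 * dist u v"
        by (simp add: Bcontfun_inverse[OF \<Phi>_in])
    qed
  qed auto
  then obtain u where "Bcontfun (\<Phi> u) = u" by blast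
  then have "\<Phi> u = apply_bcontfun u" using Bcontfun_inverse[OF \<Phi>_in[of u]] by simp
  then have fix_eq: "\<zeta> u p = snd p + J u p" for p
    using wt[of p] unfolding \<zeta>_def \<open>\<Phi> u = apply_bcontfun u\<close>[symmetric] by (simp add: \<Phi>_def)
  define X where "X t z = \<zeta> u (t, z)" for t z
  have X_eq: "X t z = z + t *\<^sub>R integral {0..1} (\<lambda>\<sigma>. G u (t * \<sigma>, z))" for t z
    by (simp add: X_def fix_eq J_def)
  have "mf_solution K f X"
    unfolding mf_solution_def
  proof (intro conjI allI ballI)
    show "X t \<in> borel_measurable f" for t unfolding X_def by measurable
    show "\<exists>h. integrable f h \<and> (\<forall>t z. \<bar>t\<bar> \<le> T \<longrightarrow> z \<in> space f \<longrightarrow> norm (X t z) \<le> h z)" for T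
    proof (intro exI[of _ "\<lambda>z. norm u * (exp (l * T) * (1 + norm z))"] conjI allI impI)
      fix t z assume t: "\<bar>t\<bar> \<le> T"
      show "norm (X t z) \<le> norm u * (exp (l * T) * (1 + norm z))"
        unfolding X_def by (rule order_trans[OF \<zeta>_le]) (use t l in \<open>auto simp: wt_def intro!: mult_left_mono mult_right_mono\<close>)
    qed (use int in auto)
    fix t z
    have "((\<lambda>t. z + t *\<^sub>R integral {0..1} (\<lambda>\<sigma>. G u (t * \<sigma>, z))) has_vector_derivative (0 + G u (t, z))) (at t)"
      by (intro has_vector_derivative_add has_vector_derivative_const has_vector_derivative_scaled_integral[of "\<lambda>t. G u (t, z)"]
          continuous_on_compose2[OF G_cont] continuous_intros) auto
    moreover have "G u (t, z) = (\<integral>z'. K (X t z) (X t z') \<partial>f)" by (simp add: G_def X_def)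
    moreover have "(\<lambda>s. X s z) = (\<lambda>t. z + t *\<^sub>R integral {0..1} (\<lambda>\<sigma>. G u (t * \<sigma>, z)))"
      by (rule ext) (rule X_eq)
    ultimately show "((\<lambda>s. X s z) has_vector_derivative (\<integral>z'. K (X t z) (X t z') \<partial>f)) (at t)"
      by simp
  qed
  moreover have "X 0 z = z" for z by (simp add: X_def fix_eq J_def)
  moreover have "continuous_on UNIV (\<lambda>(t, z). X t z)" using \<zeta>_cont[of UNIV u] by (simp add: X_def)
  ultimately show ?thesis by blast
qed

end

section \<open>Probability measures and empirical measures on Euclidean space\<close>

lemma euclidean_pointed: "pointed_separable_metric UNIV dist (0 :: 'v::euclidean_space)"
proof
  obtain D :: "'v set" where D: "countable D" "\<And>X. open X \<Longrightarrow> X \<noteq> {} \<Longrightarrow> \<exists>d\<in>D. d \<in> X"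
    using countable_dense_setE by metis
  have "\<exists>a\<in>D. dist x a < e" if "e > 0" for x :: 'v and e
    using D(2)[of "ball x e"] that by auto
  with D(1) show "\<exists>D. countable D \<and> D \<subseteq> (UNIV :: 'v set) \<and> (\<forall>x\<in>UNIV. \<forall>e>0. \<exists>a\<in>D. dist x a < e)"
    by auto
qed (auto simp: dist_commute dist_triangle)

interpretation euc: pointed_separable_metric "UNIV :: (real^'d) set" dist 0
  rewrites "Metric_space.mtopology (UNIV :: (real^'d) set) dist = euclidean"
    and "borel_of (euclidean :: (real^'d) topology) = borel"
    and "pointed_separable_metric.fin (UNIV :: (real^'d) set) dist 0 = P1"
    and "pointed_separable_metric.W (UNIV :: (real^'d) set) dist = dist_MK"
proof -
  interpret E: pointed_separable_metric "UNIV :: (real^'d) set" dist 0 by (rule euclidean_pointed)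
  show "pointed_separable_metric (UNIV :: (real^'d) set) dist 0" by (rule euclidean_pointed)
  show t: "Metric_space.mtopology (UNIV :: (real^'d) set) dist = euclidean" by simp
  show b: "borel_of (euclidean :: (real^'d) topology) = borel" by (rule borel_of_euclidean)
  show "E.fin = P1" by (simp add: E.fin_def P1_def t b dist_norm)
  show "E.W = dist_MK" by (simp add: E.W_def dist_MK_def t)
qed

lemma P1_iff:
  "\<mu> \<in> P1 \<longleftrightarrow> prob_space \<mu> \<and> sets \<mu> = sets borel \<and> integrable \<mu> norm"
  by (auto simp: P1_def integrable_iff_bounded cong: measurable_cong_sets)

lemma P1D:
  assumes "\<mu> \<in> P1"
  shows "prob_space \<mu>" "sets \<mu> = sets borel" "integrable \<mu> norm" "space \<mu> = UNIV"
  using assms sets_eq_imp_space_eq[of \<mu> borel] by (auto simp: P1_iff)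

lemma distr_P1:
  fixes f :: "'w \<Rightarrow> real^'d"
  assumes "prob_space \<Omega>" "integrable \<Omega> f"
  shows "distr \<Omega> borel f \<in> P1"
  unfolding P1_iff using assms
  by (auto simp: integrable_distr_eq intro!: prob_space.prob_space_distr)

lemma dist_MK_distr_le:
  fixes f g :: "'w \<Rightarrow> real^'d"
  assumes "prob_space \<Omega>" "integrable \<Omega> f" "integrable \<Omega> g"
  shows "dist_MK (distr \<Omega> borel f) (distr \<Omega> borel g) \<le> (\<integral>\<omega>. dist (f \<omega>) (g \<omega>) \<partial>\<Omega>)"
proof (rule euc.W_distr_le)
  show "(\<integral>\<^sup>+ \<omega>. ennreal (dist (f \<omega>) (g \<omega>)) \<partial>\<Omega>) \<le> ennreal (\<integral>\<omega>. dist (f \<omega>) (g \<omega>) \<partial>\<Omega>)"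
    using assms by (subst nn_integral_eq_integral) (auto simp: dist_norm)
qed (use assms in auto)

lemma sets_PiM_borel:
  assumes "sets \<mu> = sets borel"
  shows "sets (PiM I (\<lambda>_. \<mu>)) = sets (PiM I (\<lambda>_. borel))"
  by (rule sets_PiM_cong) (auto simp: assms)

lemma prob_space_uniform_count: "N \<ge> 1 \<Longrightarrow> prob_space (uniform_count_measure {..<N::nat})"
  by (intro prob_spaceI) (auto simp: space_uniform_count_measure emeasure_uniform_count_measure)

lemma measurable_uniform_count [simp]: "f \<in> uniform_count_measure A \<rightarrow>\<^sub>M N \<longleftrightarrow> f \<in> A \<rightarrow> space N"
  by (simp add: measurable_cong_sets[OF sets_uniform_count_measure_count_space refl])

lemma integrable_uniform_count:
  fixes f :: "nat \<Rightarrow> 'b::{banach, second_countable_topology}"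
  shows "integrable (uniform_count_measure {..<N}) f"
  unfolding uniform_count_measure_def by (intro integrable_point_measure_finite) auto

text \<open>A configuration becomes a random variable on the space of indices, so statements about
  laws of random variables apply to particles.\<close>

lemma empirical_eq:
  assumes "N \<ge> 1"
  shows "empirical N Z = distr (uniform_count_measure {..<N}) borel Z"
proof -
  let ?D = "distr (uniform_count_measure {..<N}) borel Z"
  have em: "emeasure ?D A = ennreal (1 / real N) * (\<Sum>k<N. emeasure (return borel (Z k)) A)"
    if A: "A \<in> sets borel" for A
  proof -
    have "emeasure ?D A = emeasure (uniform_count_measure {..<N}) {k\<in>{..<N}. Z k \<in> A}"
      using A by (subst emeasure_distr) (auto simp: space_uniform_count_measure intro!: arg_cong[where f="emeasure _"])
    also have "\<dots> = ennreal (1 / real N * (\<Sum>k<N. indicator A (Z k)))"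
      by (subst emeasure_uniform_count_measure) (auto simp: sum.If_cases indicator_def Int_def)
    also have "\<dots> = ennreal (1 / real N) * (\<Sum>k<N. ennreal (indicator A (Z k)))"
      by (subst sum_ennreal, simp, subst ennreal_mult[symmetric]) (auto simp: sum_nonneg)
    finally show ?thesis using A by (simp add: ennreal_indicator)
  qed
  have "measure_of (space ?D) (sets ?D) (emeasure ?D) = empirical N Z"
    unfolding empirical_def by (simp, rule measure_of_eq) (auto simp: em sigma_algebra.sigma_sets_eq[OF sets.sigma_algebra_axioms[of borel, simplified]])
  then show ?thesis unfolding measure_of_of_measure by (rule sym)
qed

lemma empirical_P1: "N \<ge> 1 \<Longrightarrow> empirical N Z \<in> P1"
  by (simp add: empirical_eq distr_P1 prob_space_uniform_count integrable_uniform_count)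

lemma dist_MK_empirical_le:
  assumes "N \<ge> 1"
  shows "dist_MK (empirical N Z) (empirical N Z') \<le> (\<Sum>k<N. dist (Z k) (Z' k)) / N"
  using dist_MK_distr_le[OF prob_space_uniform_count[OF assms] integrable_uniform_count integrable_uniform_count, of Z Z']
  by (simp add: empirical_eq[OF assms] integral_uniform_count_measure)

subsection \<open>The law of large numbers in transport distance\<close>

text \<open>The quantile coupling replaces the maximal coupling, which would need the common part of the two
  laws; the price is the factor \<open>r\<close> below.\<close>

lemma quantile_representation:
  fixes I :: "'w \<Rightarrow> nat"
  assumes "prob_space \<Omega>" and I [measurable]: "I \<in> \<Omega> \<rightarrow>\<^sub>M count_space UNIV"
    and r: "\<forall>\<omega>\<in>space \<Omega>. I \<omega> < r"
  defines "c \<equiv> \<lambda>k. measure \<Omega> {\<omega> \<in> space \<Omega>. I \<omega> < k}"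
  defines "J \<equiv> \<lambda>u. LEAST j. u < c (Suc j)"
  shows "J \<in> borel \<rightarrow>\<^sub>M count_space UNIV"
    and "\<And>u a. u \<in> {0..<1} \<Longrightarrow> J u = a \<longleftrightarrow> c a \<le> u \<and> u < c (Suc a)"
    and "distr (uniform_measure lborel {0..<1}) (count_space UNIV) J = distr \<Omega> (count_space UNIV) I"
    and "c (Suc k) = c k + measure \<Omega> {\<omega> \<in> space \<Omega>. I \<omega> = k}"
    and "c 0 = 0" and "\<And>u. u \<in> {0..<1} \<Longrightarrow> J u < r"
proof -
  interpret prob_space \<Omega> by fact
  show J [measurable]: "J \<in> borel \<rightarrow>\<^sub>M count_space UNIV" unfolding J_def by measurable
  have mono: "c i \<le> c j" if "i \<le> j" for i j
    unfolding c_def using that by (intro finite_measure_mono) auto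
  have c0: "c 0 = 0" by (simp add: c_def)
  then show "c 0 = 0" .
  have cS: "c (Suc k) = c k + measure \<Omega> {\<omega> \<in> space \<Omega>. I \<omega> = k}" for k
  proof -
    have "{\<omega> \<in> space \<Omega>. I \<omega> < Suc k} = {\<omega> \<in> space \<Omega>. I \<omega> < k} \<union> {\<omega> \<in> space \<Omega>. I \<omega> = k}" by auto
    then show ?thesis unfolding c_def by (simp add: finite_measure_Union disjoint_iff)
  qed
  then show "c (Suc k) = c k + measure \<Omega> {\<omega> \<in> space \<Omega>. I \<omega> = k}" .
  have cr: "c r = 1"
  proof -
    have "{\<omega> \<in> space \<Omega>. I \<omega> < r} = space \<Omega>" using r by auto
    then show ?thesis by (simp add: c_def prob_space)
  qed
  obtain s where s: "r = Suc s" using r not_empty by (cases r) auto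
  \<comment> \<open>\<open>c k\<close> counts the values strictly below \<open>k\<close>. So the
    value \<open>a\<close> owns the half-open interval from \<open>c a\<close> to
    \<open>c (Suc a)\<close>, whose length is its probability, and \<open>J\<close> is the quantile
    function of \<open>I\<close>.\<close>
  have J_iff: "J u = a \<longleftrightarrow> c a \<le> u \<and> u < c (Suc a)" if u: "u \<in> {0..<1}" for u a
  proof
    assume Ja: "J u = a"
    have "\<exists>j. u < c (Suc j)" using cr u s by (intro exI[of _ s]) simp
    then have 1: "u < c (Suc a)" using LeastI_ex[of "\<lambda>j. u < c (Suc j)"] Ja by (simp add: J_def)
    have "c a \<le> u"
    proof (cases a)
      case 0 then show ?thesis using c0 u by simp
    next
      case (Suc b)
      then have "\<not> u < c (Suc b)" using not_less_Least[of b "\<lambda>j. u < c (Suc j)"] Ja by (simp add: J_def)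
      then show ?thesis using Suc by simp
    qed
    with 1 show "c a \<le> u \<and> u < c (Suc a)" by simp
  next
    assume a: "c a \<le> u \<and> u < c (Suc a)"
    show "J u = a" unfolding J_def
    proof (rule Least_equality)
      show "a \<le> y" if "u < c (Suc y)" for y
      proof (rule ccontr)
        assume "\<not> a \<le> y"
        then have "c (Suc y) \<le> c a" by (intro mono) simp
        then show False using that a by linarith
      qed
    qed (use a in simp)
  qed
  then show "\<And>u a. u \<in> {0..<1} \<Longrightarrow> J u = a \<longleftrightarrow> c a \<le> u \<and> u < c (Suc a)" .
  show "J u < r" if u: "u \<in> {0..<1}" for u
  proof (rule ccontr)
    assume "\<not> J u < r"
    then have "c r \<le> c (J u)" by (intro mono) simp
    then show False using J_iff[OF u, of "J u"] cr u by auto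
  qed
  show "distr (uniform_measure lborel {0..<1}) (count_space UNIV) J = distr \<Omega> (count_space UNIV) I"
  proof (rule measure_eqI_countable[where A=UNIV])
    fix a
    have c1: "c k \<le> 1" for k unfolding c_def by simp
    have "{0..<1} \<inter> J -` {a} = {c a..<c (Suc a)}"
    proof (rule set_eqI)
      fix u
      have "0 \<le> c a" by (simp add: c_def)
      then show "u \<in> {0..<1} \<inter> J -` {a} \<longleftrightarrow> u \<in> {c a..<c (Suc a)}"
        using J_iff[of u a] c1[of "Suc a"] by auto
    qed
    then have "emeasure (distr (uniform_measure lborel {0..<1}) (count_space UNIV) J) {a} = ennreal (c (Suc a) - c a)"
      using mono[of a "Suc a"] measurable_sets[OF J, of "{a}"]
      by (simp add: emeasure_distr emeasure_uniform_measure divide_ennreal_def)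
    also have "\<dots> = emeasure (distr \<Omega> (count_space UNIV) I) {a}"
      by (auto simp: emeasure_distr cS emeasure_eq_measure intro!: arg_cong[where f="measure \<Omega>"])
    finally show "emeasure (distr (uniform_measure lborel {0..<1}) (count_space UNIV) J) {a}
        = emeasure (distr \<Omega> (count_space UNIV) I) {a}" .
  qed auto
qed

text \<open>Both indices are driven by one uniform variable. They differ only when it falls between
  the two distribution functions at one of the \<open>r\<close> thresholds. Each such gap has length
  at most the sum of the differences of the point masses, and a mismatch costs at most
  \<open>D\<close>.\<close>

lemma dist_MK_index_le:
  fixes e :: "nat \<Rightarrow> real^'d"
  assumes \<Omega>: "prob_space \<Omega>" "prob_space \<Omega>'"
    and [measurable]: "I \<in> \<Omega> \<rightarrow>\<^sub>M count_space UNIV" "I' \<in> \<Omega>' \<rightarrow>\<^sub>M count_space UNIV"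
    and r: "\<forall>\<omega>\<in>space \<Omega>. I \<omega> < r" "\<forall>\<omega>\<in>space \<Omega>'. I' \<omega> < r"
    and D: "\<And>i j. i < r \<Longrightarrow> j < r \<Longrightarrow> dist (e i) (e j) \<le> D"
  shows "dist_MK (distr \<Omega> borel (\<lambda>\<omega>. e (I \<omega>))) (distr \<Omega>' borel (\<lambda>\<omega>. e (I' \<omega>)))
    \<le> D * real r * (\<Sum>j<r. \<bar>measure \<Omega> {\<omega> \<in> space \<Omega>. I \<omega> = j} - measure \<Omega>' {\<omega> \<in> space \<Omega>'. I' \<omega> = j}\<bar>)"
    (is "_ \<le> D * real r * ?\<Delta>")
proof -
  interpret O: prob_space \<Omega> by fact
  interpret O': prob_space \<Omega>' by fact
  define c where "c k = measure \<Omega> {\<omega> \<in> space \<Omega>. I \<omega> < k}" for k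
  define c' where "c' k = measure \<Omega>' {\<omega> \<in> space \<Omega>'. I' \<omega> < k}" for k
  define J where "J u = (LEAST j. u < c (Suc j))" for u
  define J' where "J' u = (LEAST j. u < c' (Suc j))" for u
  note Q = quantile_representation[OF \<Omega>(1) assms(3) r(1), folded c_def, folded J_def]
  note Q' = quantile_representation[OF \<Omega>(2) assms(4) r(2), folded c'_def, folded J'_def]
  note [measurable] = Q(1) Q'(1)
  let ?U = "uniform_measure lborel {0..<1::real}"
  have U: "prob_space ?U" by (rule prob_space_uniform_measure) auto
  interpret U: prob_space ?U by fact
  have "r > 0" using r(1) O.not_empty by fastforce
  then have D0: "0 \<le> D" using D[of 0 0] by simp
  have e1: "distr \<Omega> borel (\<lambda>\<omega>. e (I \<omega>)) = distr ?U borel (\<lambda>u. e (J u))"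
    using arg_cong[OF Q(3), of "\<lambda>m. distr m borel e"] by (simp add: distr_distr comp_def)
  have e2: "distr \<Omega>' borel (\<lambda>\<omega>. e (I' \<omega>)) = distr ?U borel (\<lambda>u. e (J' u))"
    using arg_cong[OF Q'(3), of "\<lambda>m. distr m borel e"] by (simp add: distr_distr comp_def)
  have cc: "\<bar>c k - c' k\<bar> \<le> ?\<Delta>" if "k \<le> r" for k
  proof -
    have "\<bar>c k - c' k\<bar> \<le> (\<Sum>j<k. \<bar>measure \<Omega> {\<omega> \<in> space \<Omega>. I \<omega> = j} - measure \<Omega>' {\<omega> \<in> space \<Omega>'. I' \<omega> = j}\<bar>)"
      by (induction k) (auto simp: Q(4,5) Q'(4,5))
    also have "\<dots> \<le> ?\<Delta>" using that by (intro sum_mono2) auto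
    finally show ?thesis .
  qed
  have \<Delta>0: "0 \<le> ?\<Delta>" by (intro sum_nonneg) auto
  \<comment> \<open>The gaps between the distribution functions. If the indices differ, the smaller
    of the two names a threshold whose gap contains \<open>u\<close>.\<close>
  let ?S = "\<Union>k<r. {min (c (Suc k)) (c' (Suc k))..<max (c (Suc k)) (c' (Suc k))}"
  have sub: "u \<in> ?S" if u: "u \<in> {0..<1}" and ne: "J u \<noteq> J' u" for u
  proof (cases "J u < J' u")
    case True
    have "c' (Suc (J u)) \<le> u"
    proof (rule ccontr)
      assume "\<not> ?thesis"
      then have "J' u \<le> J u" unfolding J'_def by (intro Least_le) simp
      then show False using True by simp
    qed
    moreover have "u < c (Suc (J u))" using Q(2)[OF u, of "J u"] by simp
    ultimately show ?thesis using Q(6)[OF u] by (intro UN_I[of "J u"]) auto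
  next
    case False
    then have lt: "J' u < J u" using ne by simp
    have "c (Suc (J' u)) \<le> u"
    proof (rule ccontr)
      assume "\<not> ?thesis"
      then have "J u \<le> J' u" unfolding J_def by (intro Least_le) simp
      then show False using lt by simp
    qed
    moreover have "u < c' (Suc (J' u))" using Q'(2)[OF u, of "J' u"] by simp
    ultimately show ?thesis using Q'(6)[OF u] by (intro UN_I[of "J' u"]) auto
  qed
  have AEU: "AE u in ?U. u \<in> {0..<1}" by (rule AE_uniform_measureI) auto
  have emS: "emeasure ?U ?S \<le> ennreal (real r * ?\<Delta>)"
  proof -
    have "emeasure ?U ?S \<le> (\<Sum>k<r. emeasure ?U {min (c (Suc k)) (c' (Suc k))..<max (c (Suc k)) (c' (Suc k))})"
      by (rule emeasure_subadditive_finite) auto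
    also have "\<dots> \<le> (\<Sum>k<r. ennreal ?\<Delta>)"
    proof (rule sum_mono)
      fix k assume "k \<in> {..<r}"
      have "emeasure ?U {min (c (Suc k)) (c' (Suc k))..<max (c (Suc k)) (c' (Suc k))}
          \<le> emeasure lborel {min (c (Suc k)) (c' (Suc k))..<max (c (Suc k)) (c' (Suc k))}"
        using emeasure_mono[OF Int_lower2, of "{min (c (Suc k)) (c' (Suc k))..<max (c (Suc k)) (c' (Suc k))}" lborel "{0..<1}"]
        by (subst emeasure_uniform_measure) (simp_all add: divide_ennreal_def del: Int_atLeastLessThan)
      also have "\<dots> = ennreal \<bar>c (Suc k) - c' (Suc k)\<bar>"
        by (subst emeasure_lborel_Ico) (auto simp: max_def min_def)
      also have "\<dots> \<le> ennreal ?\<Delta>" using cc[of "Suc k"] \<open>k \<in> {..<r}\<close> by (intro ennreal_leI) auto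
      finally show "emeasure ?U {min (c (Suc k)) (c' (Suc k))..<max (c (Suc k)) (c' (Suc k))} \<le> ennreal ?\<Delta>" .
    qed
    also have "\<dots> = ennreal (real r * ?\<Delta>)"
      using \<Delta>0 by (simp add: ennreal_mult ennreal_of_nat_eq_real_of_nat)
    finally show ?thesis .
  qed
  have S_sets: "?S \<in> sets ?U" by auto
  show ?thesis unfolding e1 e2
  proof (rule euc.W_distr_le[OF U])
    have "(\<integral>\<^sup>+u. ennreal (dist (e (J u)) (e (J' u))) \<partial>?U) \<le> (\<integral>\<^sup>+u. ennreal D * indicator ?S u \<partial>?U)"
    proof (rule nn_integral_mono_AE, use AEU in eventually_elim)
      fix u :: real assume u: "u \<in> {0..<1}"
      show "ennreal (dist (e (J u)) (e (J' u))) \<le> ennreal D * indicator ?S u"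
      proof (cases "J u = J' u")
        case False
        then have "u \<in> ?S" using sub[OF u] by blast
        then show ?thesis using D[OF Q(6)[OF u] Q'(6)[OF u]] by (simp add: ennreal_leI)
      qed simp
    qed
    also have "\<dots> = ennreal D * emeasure ?U ?S"
      by (rule nn_integral_cmult_indicator[OF S_sets])
    also have "\<dots> \<le> ennreal D * ennreal (real r * ?\<Delta>)" by (intro mult_left_mono emS) auto
    also have "\<dots> = ennreal (D * real r * ?\<Delta>)"
      using D0 \<Delta>0 by (simp add: mult.assoc ennreal_mult[symmetric])
    finally show "(\<integral>\<^sup>+u. ennreal (dist (e (J u)) (e (J' u))) \<partial>?U) \<le> ennreal (D * real r * ?\<Delta>)" .
    show "0 \<le> D * real r * ?\<Delta>" using D0 \<Delta>0 by simp
  qed auto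
qed

lemma integral_PiM_pair:
  fixes Y :: "'w \<Rightarrow> real" and N k l :: nat
  assumes "prob_space \<mu>" and Y: "integrable \<mu> Y" "k < N" "l < N" "k \<noteq> l"
  shows "(\<integral>Z. Y (Z k) * Y (Z l) \<partial>PiM {..<N} (\<lambda>_. \<mu>)) = (\<integral>x. Y x \<partial>\<mu>)\<^sup>2"
proof -
  interpret prob_space \<mu> by fact
  have mass: "measure \<mu> (space \<mu>) = 1" by (rule prob_space)
  interpret product_prob_space "\<lambda>_. \<mu>" "{..<N}" by standard
  \<comment> \<open>Padding with the constant 1 in all other coordinates turns the product of two
    factors into a product over all coordinates, which integrates factor by factor.\<close>
  let ?f = "\<lambda>i. if i \<in> {k, l} then Y else (\<lambda>_. 1)"
  have prod_eq: "(\<Prod>i<N. g i) = g k * g l" if "\<And>i :: nat. i \<notin> {k, l} \<Longrightarrow> g i = 1" for g :: "nat \<Rightarrow> real"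
  proof -
    have "(\<Prod>i<N. g i) = (\<Prod>i\<in>{k, l}. g i)"
      using that Y by (intro prod.mono_neutral_right) auto
    then show ?thesis using Y by simp
  qed
  have "(\<integral>Z. Y (Z k) * Y (Z l) \<partial>PiM {..<N} (\<lambda>_. \<mu>)) = (\<integral>Z. (\<Prod>i<N. ?f i (Z i)) \<partial>PiM {..<N} (\<lambda>_. \<mu>))"
    by (intro Bochner_Integration.integral_cong refl, subst prod_eq) (use Y in auto)
  also have "\<dots> = (\<Prod>i<N. \<integral>x. ?f i x \<partial>\<mu>)"
    by (rule product_integral_prod) (use Y in auto)
  also have "\<dots> = (\<integral>x. Y x \<partial>\<mu>)\<^sup>2"
    by (subst prod_eq) (use Y in \<open>auto simp: mass power2_eq_square\<close>)
  finally show ?thesis .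
qed

lemma integral_PiM_component:
  fixes Y :: "'w \<Rightarrow> 'b::{banach, second_countable_topology}" and N k :: nat
  assumes "prob_space \<mu>" "Y \<in> borel_measurable \<mu>" "k < N"
  shows "(\<integral>Z. Y (Z k) \<partial>PiM {..<N} (\<lambda>_. \<mu>)) = (\<integral>x. Y x \<partial>\<mu>)"
    and "integrable (PiM {..<N} (\<lambda>_. \<mu>)) (\<lambda>Z. Y (Z k)) \<longleftrightarrow> integrable \<mu> Y"
proof -
  interpret prob_space \<mu> by fact
  interpret product_prob_space "\<lambda>_. \<mu>" "{..<N}" by standard
  have c: "distr (PiM {..<N} (\<lambda>_. \<mu>)) \<mu> (\<lambda>Z. Z k) = \<mu>"
    using PiM_component[of k] assms(3) by simp
  show "(\<integral>Z. Y (Z k) \<partial>PiM {..<N} (\<lambda>_. \<mu>)) = (\<integral>x. Y x \<partial>\<mu>)"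
    by (subst (2) c[symmetric], subst integral_distr) (use assms in auto)
  show "integrable (PiM {..<N} (\<lambda>_. \<mu>)) (\<lambda>Z. Y (Z k)) \<longleftrightarrow> integrable \<mu> Y"
    by (subst (2) c[symmetric], subst integrable_distr_eq) (use assms in auto)
qed

lemma nn_integral_PiM_component:
  fixes N k :: nat
  assumes "prob_space \<mu>" "Y \<in> borel_measurable \<mu>" "k < N"
  shows "(\<integral>\<^sup>+Z. Y (Z k) \<partial>PiM {..<N} (\<lambda>_. \<mu>)) = (\<integral>\<^sup>+x. Y x \<partial>\<mu>)"
proof -
  interpret prob_space \<mu> by fact
  interpret product_prob_space "\<lambda>_. \<mu>" "{..<N}" by standard
  have c: "distr (PiM {..<N} (\<lambda>_. \<mu>)) \<mu> (\<lambda>Z. Z k) = \<mu>"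
    using PiM_component[of k] assms(3) by simp
  show ?thesis
    by (subst (2) c[symmetric], subst nn_integral_distr) (use assms in auto)
qed

text \<open>The sum \<open>S\<close> of the centred indicators has second moment at most
  \<open>N\<close>: products of different coordinates have mean zero and squares are at most 1.
  Hence |S| has mean at most sqrt N.\<close>

lemma expectation_frequency_deviation:
  assumes "prob_space \<mu>" and A: "A \<in> sets \<mu>" and N: "1 \<le> N"
  shows "(\<integral>Z. \<bar>measure \<mu> A - (\<Sum>k<N. indicator A (Z k)) / real N\<bar> \<partial>PiM {..<N} (\<lambda>_. \<mu>)) \<le> 1 / sqrt N"
    and "integrable (PiM {..<N} (\<lambda>_. \<mu>)) (\<lambda>Z. \<bar>measure \<mu> A - (\<Sum>k<N. indicator A (Z k)) / real N\<bar>)"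
proof -
  interpret prob_space \<mu> by fact
  let ?P = "PiM {..<N} (\<lambda>_. \<mu>)"
  interpret P: prob_space ?P by (rule prob_space_PiM) (rule prob_space_axioms)
  define Y where "Y x = indicator A x - measure \<mu> A" for x
  have [measurable]: "Y \<in> borel_measurable \<mu>" unfolding Y_def using A by measurable
  have Y1: "\<bar>Y x\<bar> \<le> 1" for x
    using prob_le_1[of A] measure_nonneg[of \<mu> A] by (auto simp: Y_def indicator_def)
  have Yi: "integrable \<mu> Y" by (rule integrable_const_bound[of _ 1]) (use Y1 in auto)
  have Y0: "(\<integral>x. Y x \<partial>\<mu>) = 0"
    unfolding Y_def using A by (subst Bochner_Integration.integral_diff) (auto simp: prob_space less_top[symmetric] intro!: integrable_real_indicator)
  have Ym: "(\<lambda>Z. Y (Z k)) \<in> borel_measurable ?P" if "k < N" for k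
    by (rule measurable_compose[OF measurable_component_singleton]) (use that in auto)
  have ii: "integrable ?P (\<lambda>Z. Y (Z k) * Y (Z l))" if "k < N" "l < N" for k l
  proof (rule P.integrable_const_bound[of _ 1])
    show "AE Z in ?P. norm (Y (Z k) * Y (Z l)) \<le> 1"
      using Y1 by (auto simp: abs_mult intro!: mult_le_one)
  qed (use Ym that in measurable)
  define S where "S Z = (\<Sum>k<N. Y (Z k))" for Z
  have Sm[measurable]: "S \<in> borel_measurable ?P" unfolding S_def using Ym by (intro borel_measurable_sum) auto
  have Sq: "(S Z)\<^sup>2 = (\<Sum>k<N. \<Sum>l<N. Y (Z k) * Y (Z l))" for Z
    by (simp add: S_def power2_eq_square sum_product)
  have Sqi: "integrable ?P (\<lambda>Z. (S Z)\<^sup>2)" unfolding Sq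
    by (intro Bochner_Integration.integrable_sum ii) auto
  have Si: "integrable ?P S"
    unfolding S_def
  proof (intro Bochner_Integration.integrable_sum)
    fix k assume "k \<in> {..<N}"
    then show "integrable ?P (\<lambda>Z. Y (Z k))"
      using integral_PiM_component(2)[OF assms(1), of Y k N] Yi by simp
  qed
  have "(\<integral>Z. (S Z)\<^sup>2 \<partial>?P) = (\<Sum>k<N. \<integral>Z. (\<Sum>l<N. Y (Z k) * Y (Z l)) \<partial>?P)"
    unfolding Sq by (intro Bochner_Integration.integral_sum Bochner_Integration.integrable_sum ii) auto
  also have "\<dots> = (\<Sum>k<N. \<Sum>l<N. \<integral>Z. Y (Z k) * Y (Z l) \<partial>?P)"
    by (intro sum.cong refl Bochner_Integration.integral_sum ii) auto
  also have "\<dots> \<le> (\<Sum>k<N. \<Sum>l<N. if k = l then 1 else 0)"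
  proof (intro sum_mono)
    fix k l assume kl: "k \<in> {..<N}" "l \<in> {..<N}"
    show "(\<integral>Z. Y (Z k) * Y (Z l) \<partial>?P) \<le> (if k = l then 1 else 0)"
    proof (cases "k = l")
      case True
      have "(\<integral>Z. Y (Z k) * Y (Z l) \<partial>?P) \<le> (\<integral>Z. 1 \<partial>?P)"
      proof (intro integral_mono ii)
        fix Z show "Y (Z k) * Y (Z l) \<le> 1"
          using Y1[of "Z k"] True abs_le_square_iff[of "Y (Z k)" 1] by (simp add: power2_eq_square)
      qed (use kl in auto)
      then show ?thesis using True by (simp add: P.prob_space)
    next
      case False
      then show ?thesis using integral_PiM_pair[OF assms(1) Yi, of k N l] kl Y0 by simp
    qed
  qed
  also have "\<dots> = real N" by simp
  finally have var: "(\<integral>Z. (S Z)\<^sup>2 \<partial>?P) \<le> real N" .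
  have eq: "\<bar>measure \<mu> A - (\<Sum>k<N. indicator A (Z k)) / real N\<bar> = \<bar>S Z\<bar> / real N" for Z
  proof -
    have "measure \<mu> A - (\<Sum>k<N. indicator A (Z k)) / real N = - (S Z / real N)"
      using N by (simp add: S_def Y_def sum_subtractf field_simps)
    then show ?thesis by simp
  qed
  show "integrable ?P (\<lambda>Z. \<bar>measure \<mu> A - (\<Sum>k<N. indicator A (Z k)) / real N\<bar>)"
    unfolding eq using Si by auto
  have sN: "0 < sqrt N" using N by simp
  \<comment> \<open>The inequality of the two means with weight sqrt N passes from the second to the
    first moment; this weight makes both terms at most (sqrt N) / 2.\<close>
  have "(\<integral>Z. \<bar>S Z\<bar> \<partial>?P) \<le> (\<integral>Z. sqrt N / 2 + (S Z)\<^sup>2 / (2 * sqrt N) \<partial>?P)"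
  proof (intro integral_mono)
    fix Z
    have "0 \<le> (sqrt N - \<bar>S Z\<bar>)\<^sup>2" by simp
    then have "2 * sqrt N * \<bar>S Z\<bar> \<le> (sqrt N)\<^sup>2 + (S Z)\<^sup>2" by (simp add: power2_diff)
    then show "\<bar>S Z\<bar> \<le> sqrt N / 2 + (S Z)\<^sup>2 / (2 * sqrt N)"
      using sN by (simp add: field_simps power2_eq_square)
  qed (use Si Sqi in auto)
  also have "\<dots> = sqrt N / 2 + (\<integral>Z. (S Z)\<^sup>2 \<partial>?P) / (2 * sqrt N)"
    using Sqi by (simp add: P.prob_space)
  also have "\<dots> \<le> sqrt N / 2 + real N / (2 * sqrt N)"
    using var sN by (intro add_left_mono divide_right_mono) auto
  also have "real N / (2 * sqrt N) = sqrt N / 2" using sN by (simp add: field_simps)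
  finally have "(\<integral>Z. \<bar>S Z\<bar> \<partial>?P) \<le> sqrt N" by simp
  then have "(\<integral>Z. \<bar>S Z\<bar> \<partial>?P) / real N \<le> sqrt N / real N" by (intro divide_right_mono) auto
  also have "sqrt N / real N = 1 / sqrt N" using sN by (simp add: field_simps)
  finally show "(\<integral>Z. \<bar>measure \<mu> A - (\<Sum>k<N. indicator A (Z k)) / real N\<bar> \<partial>?P) \<le> 1 / sqrt N"
    unfolding eq using Si by simp
qed

text \<open>Simple functions \<open>F i\<close> converge to the identity with |F i x| at most 2 |x|,
  so |F i x - x| is dominated by the integrable 3 |x|. Numbering the finitely many values gives
  \<open>I\<close> and \<open>e\<close>, and finiteness gives the diameter bound
  \<open>D\<close>.\<close>

lemma P1_discretisation:
  fixes \<mu> :: "(real^'d) measure"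
  assumes "\<mu> \<in> P1" "0 < \<epsilon>"
  obtains I :: "real^'d \<Rightarrow> nat" and e :: "nat \<Rightarrow> real^'d" and r D where
    "I \<in> borel \<rightarrow>\<^sub>M count_space UNIV" "\<And>x. I x < r"
    "\<And>i j. i < r \<Longrightarrow> j < r \<Longrightarrow> dist (e i) (e j) \<le> D"
    "(\<integral>x. dist (e (I x)) x \<partial>\<mu>) \<le> \<epsilon>" "integrable \<mu> (\<lambda>x. e (I x))"
proof -
  interpret prob_space \<mu> using P1D assms by blast
  note sets = P1D(2)[OF assms(1)] and int = P1D(3)[OF assms(1)]
  note [measurable_cong] = sets
  have sp: "space \<mu> = UNIV" by (rule P1D(4)[OF assms(1)])
  have "(\<lambda>x. x) \<in> borel_measurable \<mu>" by measurable
  then obtain F where F: "\<And>i. simple_function \<mu> (F i)" "\<And>x. (\<lambda>i. F i x) \<longlonglongrightarrow> x"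
    "\<And>i x. dist (F i x) 0 \<le> 2 * dist x (0::real^'d)"
    using borel_measurable_implies_sequence_metric[of "\<lambda>x. x" \<mu> 0] unfolding sp by auto
  have Fm[measurable]: "F i \<in> borel_measurable \<mu>" for i using F(1) by (rule borel_measurable_simple_function)
  have "(\<lambda>i. \<integral>x. dist (F i x) x \<partial>\<mu>) \<longlonglongrightarrow> (\<integral>x. 0 \<partial>\<mu>)"
  proof (rule integral_dominated_convergence[where w="\<lambda>x. 3 * norm x"])
    show "AE x in \<mu>. (\<lambda>i. dist (F i x) x) \<longlonglongrightarrow> 0"
      using F(2) by (intro AE_I2) (simp add: tendsto_dist_iff[symmetric])
    show "AE x in \<mu>. norm (dist (F i x) x) \<le> 3 * norm x" for i
    proof (rule AE_I2)
      fix x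
      show "norm (dist (F i x) x) \<le> 3 * norm x"
        using F(3)[of i x] norm_triangle_ineq4[of "F i x" x] by (simp add: dist_norm)
    qed
  qed (use int in \<open>auto simp: dist_norm\<close>)
  then have "\<forall>\<^sub>F i in sequentially. (\<integral>x. dist (F i x) x \<partial>\<mu>) < \<epsilon>"
    using order_tendstoD(2)[of _ 0 sequentially \<epsilon>] assms(2) by simp
  then obtain i where i: "(\<integral>x. dist (F i x) x \<partial>\<mu>) < \<epsilon>"
    by (auto simp: eventually_sequentially)
  define S where "S = range (F i)"
  have fin: "finite S" using simple_functionD(1)[OF F(1)[of i]] by (simp add: S_def sp)
  define I where "I x = to_nat_on S (F i x)" for x
  define e where "e = from_nat_into S"
  have cS: "countable S" using fin by (rule countable_finite)
  have eI: "e (I x) = F i x" for x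
    unfolding e_def I_def using cS by (intro from_nat_into_to_nat_on) (auto simp: S_def)
  have I1: "I x < card S" for x
    using to_nat_on_finite[OF fin] by (auto simp: I_def S_def bij_betw_def)
  have Im: "I \<in> borel \<rightarrow>\<^sub>M count_space UNIV"
  proof -
    have "simple_function \<mu> I" unfolding I_def using simple_function_compose1[OF F(1)] .
    from measurable_simple_function[OF this] show ?thesis using sets by (simp cong: measurable_cong_sets)
  qed
  have "bounded S" using fin by (rule finite_imp_bounded)
  then obtain D where D: "\<And>x y. x \<in> S \<Longrightarrow> y \<in> S \<Longrightarrow> dist x y \<le> D"
    using bounded_two_points by metis
  have "S \<noteq> {}" by (auto simp: S_def)
  show thesis
  proof (rule that[of I "card S" e D])
    show "dist (e i) (e j) \<le> D" for i j
      unfolding e_def by (intro D from_nat_into \<open>S \<noteq> {}\<close>)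
    show "integrable \<mu> (\<lambda>x. e (I x))"
      unfolding eI
    proof (rule Bochner_Integration.integrable_bound[of _ "\<lambda>x. 2 * norm x"])
      show "AE x in \<mu>. norm (F i x) \<le> norm (2 * norm x)" using F(3)[of i] by (intro AE_I2) simp
    qed (use int in auto)
  qed (use Im I1 i in \<open>auto simp: eI\<close>)
qed

text \<open>Sample and law are discretised by the same finite partition. Each discretisation costs
  at most \<epsilon> in the mean, and what remains is the deviation of finitely many cell
  frequencies, of order 1 / sqrt N. The total tends to 2 \<epsilon>, which explains the threshold 3
  \<epsilon>.\<close>

lemma wasserstein_law_of_large_numbers:
  fixes \<mu> :: "(real^'d) measure"
  assumes \<mu>: "\<mu> \<in> P1"
  shows "(\<lambda>N. \<integral>\<^sup>+Z. ennreal (dist_MK (empirical N Z) \<mu>) \<partial>PiM {..<N} (\<lambda>_. \<mu>)) \<longlonglongrightarrow> 0"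
proof (rule order_tendstoI)
  fix b :: ennreal assume "0 < b"
  then obtain \<epsilon> where \<epsilon>: "0 < \<epsilon>" "ennreal (3 * \<epsilon>) < b"
  proof -
    obtain c where c: "0 < c" "c < b" using dense[OF \<open>0 < b\<close>] by blast
    have "c < top" by (rule less_le_trans[OF c(2)]) simp
    then obtain c' where "c = ennreal c'" "0 \<le> c'" by (cases c) auto
    then show thesis using c by (intro that[of "c' / 3"]) auto
  qed
  interpret prob_space \<mu> using P1D \<mu> by blast
  note sets = P1D(2)[OF \<mu>] and int = P1D(3)[OF \<mu>]
  note [measurable_cong] = sets
  have sp: "space \<mu> = UNIV" by (rule P1D(4)[OF \<mu>])
  obtain I :: "real^'d \<Rightarrow> nat" and e :: "nat \<Rightarrow> real^'d" and r D where I: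
    "I \<in> borel \<rightarrow>\<^sub>M count_space UNIV" "\<And>x. I x < r"
    "\<And>i j. i < r \<Longrightarrow> j < r \<Longrightarrow> dist (e i) (e j) \<le> D"
    "(\<integral>x. dist (e (I x)) x \<partial>\<mu>) \<le> \<epsilon>" "integrable \<mu> (\<lambda>x. e (I x))"
    by (rule P1_discretisation[OF \<mu> \<epsilon>(1)]) (rule that)
  note [measurable] = I(1)
  have D0: "0 \<le> D" using I(2)[of 0] I(3)[of "I 0" "I 0"] by simp
  define A where "A j = I -` {j}" for j
  have A: "A j \<in> sets borel" for j
    using measurable_sets[OF I(1), of "{j}"] by (simp add: A_def)
  have idint: "integrable \<mu> (\<lambda>x. x)" using int by (subst integrable_norm_iff[symmetric]) auto
  have dint: "integrable \<mu> (\<lambda>x. dist (e (I x)) x)"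
    unfolding dist_norm using I(5) idint by auto
  have main: "(\<integral>\<^sup>+Z. ennreal (dist_MK (empirical N Z) \<mu>) \<partial>PiM {..<N} (\<lambda>_. \<mu>)) \<le> ennreal (2 * \<epsilon> + D * r * r / sqrt N)"
    if N: "1 \<le> N" for N
  proof -
    let ?P = "PiM {..<N} (\<lambda>_. \<mu>)"
    interpret P: prob_space ?P by (rule prob_space_PiM) (rule prob_space_axioms)
    define q where "q j Z = \<bar>measure \<mu> (A j) - (\<Sum>k<N. indicator (A j) (Z k)) / real N\<bar>" for j Z
    \<comment> \<open>The three terms bound, in this order, the discretisation of \<mu>, the
      distance of the two discretised measures, and the discretisation of the sample.\<close>
    define B where "B Z = \<epsilon> + D * r * (\<Sum>j<r. q j Z) + (\<Sum>k<N. dist (e (I (Z k))) (Z k)) / N" for Z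
    have qi: "integrable ?P (q j)" and q_le: "(\<integral>Z. q j Z \<partial>?P) \<le> 1 / sqrt N" for j
      using expectation_frequency_deviation[OF prob_space_axioms _ N, of "A j"] A unfolding q_def sets by auto
    have di: "integrable ?P (\<lambda>Z. dist (e (I (Z k))) (Z k))"
      and di_le: "(\<integral>Z. dist (e (I (Z k))) (Z k) \<partial>?P) \<le> \<epsilon>" if "k < N" for k
      using integral_PiM_component[OF prob_space_axioms, of "\<lambda>x. dist (e (I x)) x" k N] that dint I(4) by auto
    have bound: "dist_MK (empirical N Z) \<mu> \<le> B Z" for Z
    proof -
      let ?U = "uniform_count_measure {..<N}"
      let ?\<nu> = "distr \<mu> borel (\<lambda>x. e (I x))" and ?\<nu>' = "distr ?U borel (\<lambda>k. e (I (Z k)))"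
      have U: "prob_space ?U" by (rule prob_space_uniform_count[OF N])
      have mem: "?\<nu> \<in> P1" "?\<nu>' \<in> P1" "empirical N Z \<in> P1"
        by (auto intro!: distr_P1 I U integrable_uniform_count empirical_P1 N prob_space_axioms)
      have 1: "dist_MK ?\<nu> \<mu> \<le> \<epsilon>"
      proof -
        have "dist_MK (distr \<mu> borel (\<lambda>x. e (I x))) (distr \<mu> borel (\<lambda>x. x)) \<le> (\<integral>x. dist (e (I x)) x \<partial>\<mu>)"
          by (intro dist_MK_distr_le prob_space_axioms I idint)
        moreover have "distr \<mu> borel (\<lambda>x. x) = \<mu>" by (rule distr_id2) (simp add: sets)
        ultimately show ?thesis using I(4) by simp
      qed
      have 2: "dist_MK (empirical N Z) ?\<nu>' \<le> (\<Sum>k<N. dist (e (I (Z k))) (Z k)) / N"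
        using dist_MK_empirical_le[OF N, of Z "\<lambda>k. e (I (Z k))"]
        by (simp add: empirical_eq[OF N] dist_commute)
      have 3: "dist_MK ?\<nu> ?\<nu>' \<le> D * r * (\<Sum>j<r. q j Z)"
      proof -
        have "measure ?U {k \<in> space ?U. I (Z k) = j} = (\<Sum>k<N. indicator (A j) (Z k)) / real N" for j
        proof -
          have "(\<Sum>k<N. indicator (A j) (Z k)) = real (card {k \<in> {..<N}. I (Z k) = j})"
            by (auto simp: indicator_def A_def sum.If_cases Int_def intro!: arg_cong[where f=card])
          then show ?thesis
            by (subst space_uniform_count_measure, subst measure_uniform_count_measure) auto
        qed
        moreover have "{x \<in> space \<mu>. I x = j} = A j" for j by (auto simp: A_def sp)
        ultimately show ?thesis
          using dist_MK_index_le[OF prob_space_axioms U, of I "\<lambda>k. I (Z k)" r e D] I(2,3)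
          by (simp add: q_def)
      qed
      have "dist_MK (empirical N Z) \<mu> \<le> dist_MK (empirical N Z) ?\<nu>' + (dist_MK ?\<nu>' ?\<nu> + dist_MK ?\<nu> \<mu>)"
        using euc.W.triangle[of "empirical N Z" ?\<nu>' \<mu>] euc.W.triangle[of ?\<nu>' ?\<nu> \<mu>] mem \<mu> by linarith
      then show ?thesis using 1 2 3 unfolding B_def euc.W.commute[of ?\<nu>' ?\<nu>] by linarith
    qed
    have i1: "integrable ?P (\<lambda>Z. \<Sum>j<r. q j Z)"
      by (intro Bochner_Integration.integrable_sum qi)
    have i2: "integrable ?P (\<lambda>Z. \<Sum>k<N. dist (e (I (Z k))) (Z k))"
      by (intro Bochner_Integration.integrable_sum di) simp
    have Bi: "integrable ?P B" unfolding B_def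
      by (intro Bochner_Integration.integrable_add Bochner_Integration.integrable_sum integrable_mult_right
          integrable_divide_zero P.integrable_const qi di) simp
    have "(\<integral>\<^sup>+Z. ennreal (dist_MK (empirical N Z) \<mu>) \<partial>?P) \<le> (\<integral>\<^sup>+Z. ennreal (B Z) \<partial>?P)"
      by (intro nn_integral_mono ennreal_leI bound)
    also have "\<dots> = ennreal (\<integral>Z. B Z \<partial>?P)"
      using bound by (intro nn_integral_eq_integral Bi AE_I2) (auto intro: order_trans[OF euc.W_nonneg])
    also have "(\<integral>Z. B Z \<partial>?P) \<le> 2 * \<epsilon> + D * r * r / sqrt N"
    proof -
      have "(\<integral>Z. B Z \<partial>?P) = \<epsilon> + D * r * (\<Sum>j<r. \<integral>Z. q j Z \<partial>?P) + (\<Sum>k<N. \<integral>Z. dist (e (I (Z k))) (Z k) \<partial>?P) / N"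
      proof -
        have "(\<integral>Z. B Z \<partial>?P) = \<epsilon> + D * r * (\<integral>Z. (\<Sum>j<r. q j Z) \<partial>?P) + (\<integral>Z. (\<Sum>k<N. dist (e (I (Z k))) (Z k)) \<partial>?P) / N"
          unfolding B_def
          by (subst Bochner_Integration.integral_add, rule Bochner_Integration.integrable_add, simp,
              rule integrable_mult_right[OF i1], rule integrable_divide_zero[OF i2],
              subst Bochner_Integration.integral_add, simp, rule integrable_mult_right[OF i1])
            (simp add: P.prob_space)
        also have "(\<integral>Z. (\<Sum>j<r. q j Z) \<partial>?P) = (\<Sum>j<r. \<integral>Z. q j Z \<partial>?P)"
          by (intro Bochner_Integration.integral_sum qi)
        also have "(\<integral>Z. (\<Sum>k<N. dist (e (I (Z k))) (Z k)) \<partial>?P) = (\<Sum>k<N. \<integral>Z. dist (e (I (Z k))) (Z k) \<partial>?P)"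
          by (intro Bochner_Integration.integral_sum di) simp
        finally show ?thesis .
      qed
      also have "\<dots> \<le> \<epsilon> + D * r * (\<Sum>j<r. 1 / sqrt N) + (\<Sum>k<N. \<epsilon>) / N"
        using D0 q_le di_le by (intro add_mono mult_left_mono divide_right_mono sum_mono) auto
      also have "\<dots> = 2 * \<epsilon> + D * r * r / sqrt N" using N by simp
      finally show ?thesis .
    qed
    finally show ?thesis by (simp add: ennreal_leI)
  qed
  have "(\<lambda>N. 2 * \<epsilon> + D * r * r / sqrt (real N)) \<longlonglongrightarrow> 2 * \<epsilon> + 0"
    by (intro tendsto_intros tendsto_divide_0[OF tendsto_const] filterlim_at_top_imp_at_infinity
        filterlim_compose[OF sqrt_at_top] filterlim_real_sequentially)
  then have "\<forall>\<^sub>F N in sequentially. 2 * \<epsilon> + D * r * r / sqrt (real N) < 3 * \<epsilon>"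
    by (rule order_tendstoD) (use \<epsilon> in simp)
  then show "\<forall>\<^sub>F N in sequentially. (\<integral>\<^sup>+Z. ennreal (dist_MK (empirical N Z) \<mu>) \<partial>PiM {..<N} (\<lambda>_. \<mu>)) < b"
    using eventually_ge_at_top[of 1]
  proof eventually_elim
    fix N :: nat assume N: "2 * \<epsilon> + D * r * r / sqrt (real N) < 3 * \<epsilon>" "1 \<le> N"
    then have "ennreal (2 * \<epsilon> + D * r * r / sqrt N) \<le> ennreal (3 * \<epsilon>)" by (intro ennreal_leI) simp
    then show "(\<integral>\<^sup>+Z. ennreal (dist_MK (empirical N Z) \<mu>) \<partial>PiM {..<N} (\<lambda>_. \<mu>)) < b"
      using le_less_trans[OF order_trans[OF main[OF N(2)]] \<epsilon>(2)] by simp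
  qed
qed simp

text \<open>If every configuration were at distance at least \<epsilon>, the mean distance could not
  fall below \<epsilon>.\<close>

lemma empirical_dense:
  fixes \<mu> :: "(real^'d) measure"
  assumes "\<mu> \<in> P1" "0 < \<epsilon>"
  shows "\<exists>N\<ge>1. \<exists>Z. dist_MK (empirical N Z) \<mu> < \<epsilon>"
proof -
  have "\<forall>\<^sub>F N in sequentially. (\<integral>\<^sup>+Z. ennreal (dist_MK (empirical N Z) \<mu>) \<partial>PiM {..<N} (\<lambda>_. \<mu>)) < ennreal \<epsilon>"
    using order_tendstoD(2)[OF wasserstein_law_of_large_numbers[OF assms(1)], of "ennreal \<epsilon>"] assms(2) by simp
  then have "\<forall>\<^sub>F N in sequentially. (\<integral>\<^sup>+Z. ennreal (dist_MK (empirical N Z) \<mu>) \<partial>PiM {..<N} (\<lambda>_. \<mu>)) < ennreal \<epsilon> \<and> 1 \<le> N"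
    using eventually_ge_at_top by (rule eventually_conj)
  then obtain N where N: "(\<integral>\<^sup>+Z. ennreal (dist_MK (empirical N Z) \<mu>) \<partial>PiM {..<N} (\<lambda>_. \<mu>)) < ennreal \<epsilon>" "1 \<le> N"
    by (auto simp: eventually_sequentially)
  interpret prob_space "PiM {..<N} (\<lambda>_. \<mu>)" by (rule prob_space_PiM) (use P1D[OF assms(1)] in auto)
  have "\<exists>Z. dist_MK (empirical N Z) \<mu> < \<epsilon>"
  proof (rule ccontr)
    assume "\<not> ?thesis"
    then have "(\<integral>\<^sup>+Z. ennreal \<epsilon> \<partial>PiM {..<N} (\<lambda>_. \<mu>)) \<le> (\<integral>\<^sup>+Z. ennreal (dist_MK (empirical N Z) \<mu>) \<partial>PiM {..<N} (\<lambda>_. \<mu>))"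
      by (intro nn_integral_mono ennreal_leI) (auto simp: not_less)
    then show False using N(1) by (simp add: emeasure_space_1)
  qed
  with N(2) show ?thesis by blast
qed

section \<open>The space of measures as a separable metric space, and measurable maps into
  it\<close>

lemma return_0_P1: "return borel (0::real^'d) \<in> P1"
  by (auto simp: P1_def prob_space_return nn_integral_return)

text \<open>The countable dense set consists of the empirical measures whose points lie in a
  countable dense set of the Euclidean space. Approximating the measure by an arbitrary empirical
  measure costs \<epsilon>/2, and moving each point into the dense set costs at most \<epsilon>/2
  more.\<close>

lemma P1_pointed: "pointed_separable_metric P1 dist_MK (return borel (0::real^'d))"
proof (intro pointed_separable_metric.intro separable_metric.intro pointed_separable_metric_axioms.intro
    separable_metric_axioms.intro euc.W.Metric_space_axioms return_0_P1)
  obtain D :: "(real^'d) set" where D: "countable D" "\<And>X. open X \<Longrightarrow> X \<noteq> {} \<Longrightarrow> \<exists>d\<in>D. d \<in> X"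
    using countable_dense_setE by metis
  let ?D = "\<Union>N\<in>{1..}. empirical N ` ({..<N} \<rightarrow>\<^sub>E D)"
  have "countable ?D"
    using D(1) by (intro countable_UN countable_image countable_PiE) auto
  moreover have "?D \<subseteq> P1" by (intro UN_least image_subsetI empirical_P1) simp
  moreover have "\<exists>\<nu>\<in>?D. dist_MK \<mu> \<nu> < \<epsilon>" if mu: "\<mu> \<in> P1" and eps: "0 < \<epsilon>" for \<mu> \<epsilon>
  proof -
    obtain N Z where NZ: "1 \<le> N" "dist_MK (empirical N Z) \<mu> < \<epsilon> / 2"
      using empirical_dense[OF mu, of "\<epsilon> / 2"] eps by auto
    have "\<exists>d\<in>D. dist (Z k) d < \<epsilon> / 2" for k
      using D(2)[of "ball (Z k) (\<epsilon> / 2)"] eps by auto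
    then obtain d where d: "\<And>k. d k \<in> D" "\<And>k. dist (Z k) (d k) < \<epsilon> / 2" by metis
    let ?Z = "restrict d {..<N}"
    have "dist_MK (empirical N Z) (empirical N ?Z) \<le> (\<Sum>k<N. dist (Z k) (?Z k)) / N"
      by (rule dist_MK_empirical_le[OF NZ(1)])
    also have "\<dots> \<le> (\<Sum>k<N. \<epsilon> / 2) / N"
      using d(2) by (intro divide_right_mono sum_mono) (auto intro: less_imp_le)
    also have "\<dots> = \<epsilon> / 2" using NZ(1) by simp
    finally have "dist_MK \<mu> (empirical N ?Z) < \<epsilon>"
      using euc.W.triangle[OF mu empirical_P1[OF NZ(1), of Z] empirical_P1[OF NZ(1), of ?Z]] NZ(2)
        euc.W.commute[of \<mu> "empirical N Z"] by linarith
    moreover have "empirical N ?Z \<in> ?D" using NZ(1) d(1) by (intro UN_I[of N] imageI restrict_PiE_iff[THEN iffD2]) auto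
    ultimately show ?thesis by blast
  qed
  ultimately show "\<exists>D. countable D \<and> D \<subseteq> P1 \<and> (\<forall>x\<in>P1. \<forall>e>0. \<exists>a\<in>D. dist_MK x (a :: (real^'d) measure) < e)"
    by (intro exI[of _ ?D]) blast
qed

interpretation pp: pointed_separable_metric "P1 :: (real^'d) measure set" dist_MK "return borel 0"
  rewrites "Metric_space.mtopology (P1 :: (real^'d) measure set) dist_MK = P1_topology"
    and "pointed_separable_metric.fin (P1 :: (real^'d) measure set) dist_MK (return borel 0) = P1P1"
    and "pointed_separable_metric.W (P1 :: (real^'d) measure set) dist_MK = Dist_MK"
proof -
  interpret E: pointed_separable_metric "P1 :: (real^'d) measure set" dist_MK "return borel 0" by (rule P1_pointed)
  show "pointed_separable_metric (P1 :: (real^'d) measure set) dist_MK (return borel 0)" by (rule P1_pointed)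
  show t: "Metric_space.mtopology (P1 :: (real^'d) measure set) dist_MK = P1_topology" by (simp add: P1_topology_def)
  show "E.fin = P1P1" by (simp add: E.fin_def P1P1_def t)
  show "E.W = Dist_MK" by (simp add: E.W_def Dist_MK_def t)
qed

abbreviation P1_borel :: "(real^'d) measure measure" where
  "P1_borel \<equiv> borel_of P1_topology"

lemma space_P1_borel [simp]: "space P1_borel = P1"
  using euc.W.topspace_mtopology by (simp add: P1_topology_def)

lemma P1_borel_prob_algebra [measurable]: "(\<lambda>\<mu>. \<mu>) \<in> P1_borel \<rightarrow>\<^sub>M prob_algebra borel"
  using euc.id_measurable_prob_algebra by (simp add: P1_topology_def)

text \<open>Rectangles are an intersection-stable generator, and the mass of a rectangle is a finite
  product of evaluations of the factor measure.\<close>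

lemma measurable_PiM_prob_algebra:
  "(\<lambda>f. PiM {..<m::nat} (\<lambda>_. f)) \<in> prob_algebra M \<rightarrow>\<^sub>M prob_algebra (PiM {..<m} (\<lambda>_. M))"
proof (rule measurable_prob_algebra_generated[where \<Omega>="{..<m} \<rightarrow>\<^sub>E space M" and G="prod_algebra {..<m} (\<lambda>_. M)"])
  show "sets (PiM {..<m} (\<lambda>_. M)) = sigma_sets ({..<m} \<rightarrow>\<^sub>E space M) (prod_algebra {..<m} (\<lambda>_. M))"
    by (simp add: sets_PiM)
  show "Int_stable (prod_algebra {..<m} (\<lambda>_. M))" by (rule Int_stable_prod_algebra)
  show "prod_algebra {..<m} (\<lambda>_. M) \<subseteq> Pow ({..<m} \<rightarrow>\<^sub>E space M)" by (rule prod_algebra_sets_into_space)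
  show "prob_space (PiM {..<m} (\<lambda>_. f))" "sets (PiM {..<m} (\<lambda>_. f)) = sets (PiM {..<m} (\<lambda>_. M))"
    if "f \<in> space (prob_algebra M)" for f
    using that by (auto simp: space_prob_algebra intro!: prob_space_PiM sets_PiM_cong)
  fix A assume "A \<in> prod_algebra {..<m} (\<lambda>_. M)"
  then obtain X where A: "A = (\<Pi>\<^sub>E i\<in>{..<m}. X i)" and X: "\<And>i. i < m \<Longrightarrow> X i \<in> sets M"
    by (auto simp: prod_algebra_eq_finite)
  have eq: "emeasure (PiM {..<m} (\<lambda>_. f)) A = (\<Prod>i<m. emeasure f (X i))" if "f \<in> space (prob_algebra M)" for f
  proof -
    have f: "prob_space f" "sets f = sets M" using that by (auto simp: space_prob_algebra)
    interpret prob_space f by fact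
    interpret product_prob_space "\<lambda>_. f" "{..<m}" by standard
    show ?thesis unfolding A by (rule emeasure_PiM) (use X f in auto)
  qed
  have "(\<lambda>f. \<Prod>i<m. emeasure f (X i)) \<in> borel_measurable (prob_algebra M)"
  proof (rule borel_measurable_prod_ennreal)
    fix i assume "i \<in> {..<m}"
    have "(\<lambda>f. f) \<in> prob_algebra M \<rightarrow>\<^sub>M subprob_algebra M" by (rule measurable_prob_algebraD) simp
    from measurable_compose[OF this measurable_emeasure_subprob_algebra[OF X]] \<open>i \<in> {..<m}\<close>
    show "(\<lambda>f. emeasure f (X i)) \<in> borel_measurable (prob_algebra M)" by simp
  qed
  then show "(\<lambda>f. emeasure (PiM {..<m} (\<lambda>_. f)) A) \<in> borel_measurable (prob_algebra M)"
    by (subst measurable_cong[OF eq])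
qed

lemma P1_borel_PiM [measurable]:
  "(\<lambda>f. PiM {..<m::nat} (\<lambda>_. f)) \<in> P1_borel \<rightarrow>\<^sub>M prob_algebra (config_algebra m)"
  by (rule measurable_compose[OF P1_borel_prob_algebra measurable_PiM_prob_algebra])

lemma continuous_map_P1I:
  fixes F :: "'x::topological_space \<Rightarrow> (real^'d) measure"
  assumes "\<And>x. F x \<in> P1" and "\<And>x. continuous_on UNIV (g x)" and "\<And>x. g x x \<le> 0"
    and "\<And>x y. dist_MK (F x) (F y) \<le> g x y"
  shows "continuous_map euclidean P1_topology F"
  unfolding P1_topology_def euc.W.continuous_map_to_metric
proof (intro ballI allI impI)
  fix x and \<epsilon> :: real assume "0 < \<epsilon>"
  show "\<exists>U. openin euclidean U \<and> x \<in> U \<and> (\<forall>y\<in>U. F y \<in> euc.W.mball (F x) \<epsilon>)"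
  proof (intro exI[of _ "{y. g x y < \<epsilon>}"] conjI ballI)
    show "openin euclidean {y. g x y < \<epsilon>}"
      using assms(2) by (auto intro!: open_Collect_less continuous_intros)
    show "x \<in> {y. g x y < \<epsilon>}" using assms(3)[of x] \<open>0 < \<epsilon>\<close> by simp
    fix y assume "y \<in> {y. g x y < \<epsilon>}"
    then have "dist_MK (F x) (F y) < \<epsilon>" using assms(4)[of x y] by simp
    then show "F y \<in> euc.W.mball (F x) \<epsilon>" using assms(1) by simp
  qed
qed

text \<open>Borel sets here belong to the product topology over all natural numbers. On
  configurations the coordinates from \<open>N\<close> on are the constant \<open>undefined\<close>,
  hence measurable, so functions continuous on the full product may be composed with
  configurations.\<close>

lemma measurable_config_borel: "(\<lambda>Z. Z) \<in> config_algebra N \<rightarrow>\<^sub>M (borel :: (nat \<Rightarrow> real^'d) measure)"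
proof -
  have comp: "(\<lambda>Z. Z i) \<in> borel_measurable (config_algebra N :: (nat \<Rightarrow> real^'d) measure)" for i
  proof (cases "i < N")
    case True
    then show ?thesis by (intro measurable_component_singleton) simp
  next
    case False
    then have "Z i = undefined" if "Z \<in> space (config_algebra N :: (nat \<Rightarrow> real^'d) measure)" for Z
      using that by (auto simp: space_PiM intro: PiE_arb)
    then show ?thesis
      by (subst measurable_cong[where g="\<lambda>_. undefined"]) simp_all
  qed
  have "(\<lambda>Z i. Z i) \<in> config_algebra N \<rightarrow>\<^sub>M PiM UNIV (\<lambda>_::nat. borel :: (real^'d) measure)"
    by (rule measurable_PiM_single'[where f="\<lambda>i Z. Z i"]) (use comp in \<open>simp_all add: Pi_iff\<close>)
  then show ?thesis unfolding measurable_cong_sets[OF refl sets_PiM_equal_borel] .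
qed

lemma measurable_empirical [measurable]: "N \<ge> 1 \<Longrightarrow> empirical N \<in> config_algebra N \<rightarrow>\<^sub>M P1_borel"
proof -
  assume N: "N \<ge> 1"
  have "continuous_map euclidean P1_topology (empirical N)"
  proof (rule continuous_map_P1I[where g="\<lambda>Z Z'. (\<Sum>k<N. dist (Z k) (Z' k)) / N"])
    show "continuous_on UNIV (\<lambda>Z'. (\<Sum>k<N. dist (Z k) (Z' k)) / N)" for Z :: "nat \<Rightarrow> real^'d"
      using N by (intro continuous_intros continuous_on_product_coordinates) auto
  qed (use N in \<open>auto intro: empirical_P1 dist_MK_empirical_le\<close>)
  from measurable_borel_of[OF this] have "empirical N \<in> borel \<rightarrow>\<^sub>M P1_borel"
    by (simp add: borel_of_euclidean)
  from measurable_compose[OF measurable_config_borel this] show "empirical N \<in> config_algebra N \<rightarrow>\<^sub>M P1_borel" .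
qed

subsection \<open>The mean field flow\<close>

lemma dist_MK_obtain:
  fixes f g :: "(real^'d) measure"
  assumes f: "f \<in> P1" and g: "g \<in> P1" and e: "0 < e"
  obtains \<pi> where "\<pi> \<in> couplings euclidean f g" "prob_space \<pi>" "space \<pi> = UNIV"
    "(\<integral>p. dist (fst p) (snd p) \<partial>\<pi>) \<le> dist_MK f g + e"
proof -
  obtain \<pi> where \<pi>: "\<pi> \<in> couplings euclidean f g"
    "(\<integral>\<^sup>+p. ennreal (dist (fst p) (snd p)) \<partial>\<pi>) \<le> ennreal (dist_MK f g + e)"
    using euc.W_obtain[OF f g e] by auto
  have s[measurable_cong]: "sets \<pi> = sets (borel \<Otimes>\<^sub>M borel)" and p: "prob_space \<pi>"
    using \<pi>(1) by (auto simp: euc.couplings_iff)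
  have "(\<integral>p. dist (fst p) (snd p) \<partial>\<pi>) = enn2real (\<integral>\<^sup>+p. ennreal (dist (fst p) (snd p)) \<partial>\<pi>)"
    by (rule integral_eq_nn_integral) auto
  also have "\<dots> \<le> dist_MK f g + e"
    using \<pi>(2) e euc.W_nonneg[of f g] by (intro enn2real_leI) auto
  finally show thesis
    using that[OF \<pi>(1) p] sets_eq_imp_space_eq[OF s] by (simp add: space_pair_measure)
qed

locale mean_field = lipschitz_interaction K L
  for K :: "real^'d \<Rightarrow> real^'d \<Rightarrow> real^'d" and L
begin

text \<open>The choice is harmless: \<open>mf_solution_eq_flow\<close> shows that a solution is
  determined by its initial values.\<close>

definition flow :: "(real^'d) measure \<Rightarrow> real \<Rightarrow> real^'d \<Rightarrow> real^'d" where
  "flow f = (SOME X. mf_solution K f X \<and> (\<forall>z. X 0 z = z) \<and> continuous_on UNIV (\<lambda>(t, z). X t z))"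

lemma flow:
  assumes "f \<in> P1"
  shows "mf_solution K f (flow f)" and flow_0: "flow f 0 z = z"
    and flow_continuous: "continuous_on UNIV (\<lambda>(t, z). flow f t z)"
  using someI_ex[OF mf_flow_exists[OF P1D(1,2,3)[OF assms]]] unfolding flow_def by auto

lemma flow_measurable [measurable]: "f \<in> P1 \<Longrightarrow> flow f t \<in> borel_measurable borel"
  using mf_solution_measurable[OF flow(1)] P1D(2) by (metis measurable_cong_sets)

definition push :: "real \<Rightarrow> (real^'d) measure \<Rightarrow> (real^'d) measure" where
  "push t f = distr f borel (flow f t)"

lemma push_P1: "f \<in> P1 \<Longrightarrow> push t f \<in> P1"
  unfolding push_def by (intro distr_P1 mf_solution_integrable[OF flow(1)] P1D(1))

lemma push_0: "f \<in> P1 \<Longrightarrow> push 0 f = f"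
proof -
  assume f: "f \<in> P1"
  have "flow f 0 = (\<lambda>z. z)" using flow_0[OF f] by auto
  then show ?thesis by (simp add: push_def distr_id2 P1D(2)[OF f])
qed

text \<open>A solution \<open>X\<close> and the flow of the law of \<open>X 0\<close>, composed with
  \<open>X 0\<close>, are two solutions on the same space with equal initial values, so stability
  makes them equal. The group property, the stationarity of the Dirac mass at 0 and the
  identification of the particle system are instances.\<close>

lemma mf_solution_eq_flow:
  assumes \<Omega>: "prob_space \<Omega>" and X: "mf_solution K \<Omega> X"
  defines "f \<equiv> distr \<Omega> borel (X 0)"
  shows "f \<in> P1" "\<omega> \<in> space \<Omega> \<Longrightarrow> X t \<omega> = flow f t (X 0 \<omega>)" "distr \<Omega> borel (X t) = push t f"
proof -
  note [measurable] = mf_solution_measurable[OF X]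
  show f: "f \<in> P1" unfolding f_def by (intro distr_P1 \<Omega> mf_solution_integrable[OF X])
  have d: "distr \<Omega> f (X 0) = f"
    unfolding f_def by (rule distr_cong) auto
  have g: "X 0 \<in> \<Omega> \<rightarrow>\<^sub>M f" unfolding f_def by simp
  have Y: "mf_solution K \<Omega> (\<lambda>t \<omega>. flow f t (X 0 \<omega>))"
    by (rule mf_solution_comp[OF flow(1)[OF f] g d])
  show eq: "X t \<omega> = flow f t (X 0 \<omega>)" if "\<omega> \<in> space \<Omega>" for \<omega>
    using stability(2)[OF \<Omega> X Y that, of t] by (simp add: flow_0[OF f])
  have "distr \<Omega> borel (X t) = distr \<Omega> borel (\<lambda>\<omega>. flow f t (X 0 \<omega>))"
    by (rule distr_cong) (auto simp: eq)
  also have "\<dots> = distr (distr \<Omega> borel (X 0)) borel (flow f t)"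
    using f by (subst distr_distr) (auto simp: comp_def)
  finally show "distr \<Omega> borel (X t) = push t f" by (simp add: push_def f_def)
qed

text \<open>The flow restarted at time \<open>s\<close> is a solution on the original space whose
  initial law is \<open>push s f\<close>; it must therefore be the flow of that law.\<close>

lemma flow_add:
  assumes "f \<in> P1"
  shows "flow f (t + s) z = flow (push s f) t (flow f s z)" "push (t + s) f = push t (push s f)"
proof -
  have X: "mf_solution K f (\<lambda>t. flow f (t + s))" by (rule mf_solution_shift[OF flow(1)[OF assms]])
  note * = mf_solution_eq_flow[OF P1D(1)[OF assms] X]
  show "flow f (t + s) z = flow (push s f) t (flow f s z)"
    using *(2)[of z t] by (simp add: push_def P1D(4)[OF assms])
  show "push (t + s) f = push t (push s f)"
    using *(3)[of t] by (simp add: push_def)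
qed

lemma push_return_0: "push t (return borel 0) = return borel 0"
proof -
  have p: "prob_space (return borel (0::real^'d))" by (rule prob_space_return) simp
  have "mf_solution K (return borel (0::real^'d)) (\<lambda>t \<omega>. 0)"
    using p by (intro mf_solution_zero) (simp add: prob_space_def)
  from mf_solution_eq_flow(3)[OF p this, of t]
  show ?thesis by (simp add: distr_return)
qed

lemma coupling_solutions:
  assumes f: "f \<in> P1" and g: "g \<in> P1" and \<pi>: "\<pi> \<in> couplings euclidean f g"
  shows "mf_solution K \<pi> (\<lambda>t p. flow f t (fst p))" "mf_solution K \<pi> (\<lambda>t p. flow g t (snd p))"
    and "push t f = distr \<pi> borel (\<lambda>p. flow f t (fst p))" "push t g = distr \<pi> borel (\<lambda>p. flow g t (snd p))"
proof -
  have s[measurable_cong]: "sets \<pi> = sets (borel \<Otimes>\<^sub>M borel)"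
    and m: "distr \<pi> borel fst = f" "distr \<pi> borel snd = g"
    using \<pi> by (auto simp: euc.couplings_iff)
  have "distr \<pi> f fst = distr \<pi> borel fst" "distr \<pi> g snd = distr \<pi> borel snd"
    using P1D(2)[OF f] P1D(2)[OF g] by (auto intro: distr_cong)
  then have m': "distr \<pi> f fst = f" "distr \<pi> g snd = g" using m by auto
  have gm: "fst \<in> \<pi> \<rightarrow>\<^sub>M f" "snd \<in> \<pi> \<rightarrow>\<^sub>M g"
    using P1D(2)[OF f] P1D(2)[OF g] by (auto cong: measurable_cong_sets)
  show "mf_solution K \<pi> (\<lambda>t p. flow f t (fst p))" by (rule mf_solution_comp[OF flow(1)[OF f] gm(1) m'(1)])
  show "mf_solution K \<pi> (\<lambda>t p. flow g t (snd p))" by (rule mf_solution_comp[OF flow(1)[OF g] gm(2) m'(2)])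
  note [measurable] = flow_measurable[OF f] flow_measurable[OF g]
  show "push t f = distr \<pi> borel (\<lambda>p. flow f t (fst p))"
    unfolding push_def by (subst (1) m(1)[symmetric], subst distr_distr) (auto simp: comp_def)
  show "push t g = distr \<pi> borel (\<lambda>p. flow g t (snd p))"
    unfolding push_def by (subst (1) m(2)[symmetric], subst distr_distr) (auto simp: comp_def)
qed

lemma push_lipschitz:
  assumes f: "f \<in> P1" and g: "g \<in> P1"
  shows "dist_MK (push t f) (push t g) \<le> exp (2 * L * \<bar>t\<bar>) * dist_MK f g"
    and flow_measure_lipschitz: "dist (flow f t z) (flow g t z) \<le> exp (2 * L * \<bar>t\<bar>) * dist_MK f g"
proof -
  define c where "c = exp (2 * L * \<bar>t\<bar>)"
  have c: "0 < c" by (simp add: c_def)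
  have le: "dist_MK (push t f) (push t g) \<le> c * dist_MK f g + e \<and> dist (flow f t z) (flow g t z) \<le> c * dist_MK f g + e"
    if "0 < e" for e
  proof -
    \<comment> \<open>The slack e/c becomes \<open>e\<close> after multiplication by the Lipschitz
      constant \<open>c\<close>.\<close>
    obtain \<pi> where \<pi>: "\<pi> \<in> couplings euclidean f g" "prob_space \<pi>" "space \<pi> = UNIV"
      "(\<integral>p. dist (fst p) (snd p) \<partial>\<pi>) \<le> dist_MK f g + e / c"
      using dist_MK_obtain[OF f g, of "e / c"] \<open>0 < e\<close> c by auto
    note S = coupling_solutions[OF f g \<pi>(1)]
    have cost: "c * (\<integral>p. dist (fst p) (snd p) \<partial>\<pi>) \<le> c * dist_MK f g + e"
    proof -
      have "c * (dist_MK f g + e / c) = c * dist_MK f g + e" using c by (simp add: field_simps)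
      then show ?thesis using mult_left_mono[OF \<pi>(4), of c] c by simp
    qed
    have "dist_MK (push t f) (push t g) \<le> (\<integral>p. dist (flow f t (fst p)) (flow g t (snd p)) \<partial>\<pi>)"
      unfolding S(3,4) by (intro dist_MK_distr_le \<pi> mf_solution_integrable[OF S(1)] mf_solution_integrable[OF S(2)])
    also have "\<dots> \<le> c * (\<integral>p. dist (fst p) (snd p) \<partial>\<pi>)"
      using stability(1)[OF \<pi>(2) S(1,2), of t] by (simp add: flow_0[OF f] flow_0[OF g] dist_norm c_def)
    \<comment> \<open>The estimate for single paths is used at the diagonal point (z, z), where the
      initial distance vanishes and only the cost of the coupling remains. The point may be null for
      the coupling, so a bound valid everywhere is essential.\<close>
    moreover have "dist (flow f t z) (flow g t z) \<le> c * (\<integral>p. dist (fst p) (snd p) \<partial>\<pi>)"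
      using stability(2)[OF \<pi>(2) S(1,2), of "(z, z)" t] \<pi>(3)
      by (simp add: flow_0[OF f] flow_0[OF g] dist_norm c_def)
    ultimately show ?thesis using cost by auto
  qed
  show "dist_MK (push t f) (push t g) \<le> exp (2 * L * \<bar>t\<bar>) * dist_MK f g"
    unfolding c_def[symmetric] by (rule field_le_epsilon) (rule le[THEN conjunct1])
  show "dist (flow f t z) (flow g t z) \<le> exp (2 * L * \<bar>t\<bar>) * dist_MK f g"
    unfolding c_def[symmetric] by (rule field_le_epsilon) (rule le[THEN conjunct2])
qed

lemma push_continuous: "continuous_map P1_topology P1_topology (push t)"
  unfolding P1_topology_def euc.W.continuous_map_to_metric euc.W.topspace_mtopology
proof (intro ballI allI impI)
  fix f :: "(real^'d) measure" and e :: real assume f: "f \<in> P1" and e: "0 < e"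
  define c where "c = exp (2 * L * \<bar>t\<bar>)"
  have c: "0 < c" by (simp add: c_def)
  show "\<exists>U. openin euc.W.mtopology U \<and> f \<in> U \<and> (\<forall>g\<in>U. push t g \<in> euc.W.mball (push t f) e)"
  proof (intro exI[of _ "euc.W.mball f (e / c)"] conjI ballI)
    show "f \<in> euc.W.mball f (e / c)" using f e c by simp
    fix g assume g: "g \<in> euc.W.mball f (e / c)"
    then have g': "g \<in> P1" "dist_MK f g < e / c" by auto
    have "dist_MK (push t f) (push t g) \<le> c * dist_MK f g"
      using push_lipschitz[OF f g'(1)] by (simp add: c_def)
    also have "\<dots> < e" using g'(2) c by (simp add: field_simps)
    finally show "push t g \<in> euc.W.mball (push t f) e" using f g'(1) push_P1 by simp
  qed simp
qed

lemma push_measurable [measurable]: "push t \<in> P1_borel \<rightarrow>\<^sub>M P1_borel"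
  by (rule measurable_borel_of[OF push_continuous])

text \<open>Stability against the zero solution, which solves the equation for every measure because
  K(0,0) = 0.\<close>

lemma flow_bound:
  assumes f: "f \<in> P1"
  shows "norm (flow f t z) \<le> exp (2 * L * \<bar>t\<bar>) * (norm z + (\<integral>x. norm x \<partial>f))"
    and "(\<integral>x. norm (flow f t x) \<partial>f) \<le> exp (2 * L * \<bar>t\<bar>) * (\<integral>x. norm x \<partial>f)"
proof -
  have Z: "mf_solution K f (\<lambda>t \<omega>. 0)"
    using P1D(1)[OF f] by (intro mf_solution_zero) (simp add: prob_space_def)
  show "norm (flow f t z) \<le> exp (2 * L * \<bar>t\<bar>) * (norm z + (\<integral>x. norm x \<partial>f))"
    using stability(2)[OF P1D(1)[OF f] flow(1)[OF f] Z, of z t] by (simp add: P1D(4)[OF f] flow_0[OF f])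
  show "(\<integral>x. norm (flow f t x) \<partial>f) \<le> exp (2 * L * \<bar>t\<bar>) * (\<integral>x. norm x \<partial>f)"
    using stability(1)[OF P1D(1)[OF f] flow(1)[OF f] Z, of t] by (simp add: flow_0[OF f])
qed

lemma flow_velocity_bound:
  assumes f: "f \<in> P1" and t: "\<bar>t\<bar> \<le> R"
  shows "norm (\<integral>x. K (flow f t z) (flow f t x) \<partial>f) \<le> L * exp (2 * L * R) * (norm z + 2 * (\<integral>x. norm x \<partial>f))"
proof -
  interpret prob_space f by (rule P1D(1)[OF f])
  have i: "integrable f (flow f t)" by (rule mf_solution_integrable[OF flow(1)[OF f]])
  let ?M = "\<integral>x. norm x \<partial>f"
  have M0: "0 \<le> ?M" by simp
  have eR: "exp (2 * L * \<bar>t\<bar>) \<le> exp (2 * L * R)" using t L_nonneg by (auto intro: mult_left_mono)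
  have "norm (\<integral>x. K (flow f t z) (flow f t x) \<partial>f) \<le> (\<integral>x. norm (K (flow f t z) (flow f t x)) \<partial>f)"
    by (rule integral_norm_bound)
  also have "\<dots> \<le> (\<integral>x. L * (norm (flow f t z) + norm (flow f t x)) \<partial>f)"
  proof (rule integral_mono)
    show "integrable f (\<lambda>x. norm (K (flow f t z) (flow f t x)))"
      by (intro Bochner_Integration.integrable_norm integrable_K[OF finite_measure_axioms i])
         (use i in auto)
  qed (use i K_bound in auto)
  also have "\<dots> = L * (norm (flow f t z) + (\<integral>x. norm (flow f t x) \<partial>f))"
    using i by (simp add: prob_space)
  also have "\<dots> \<le> L * (exp (2 * L * R) * (norm z + ?M) + exp (2 * L * R) * ?M)"
  proof (intro mult_left_mono add_mono L_nonneg)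
    show "norm (flow f t z) \<le> exp (2 * L * R) * (norm z + ?M)"
      using flow_bound(1)[OF f, of t z] mult_right_mono[OF eR, of "norm z + ?M"] M0 by simp
    show "(\<integral>x. norm (flow f t x) \<partial>f) \<le> exp (2 * L * R) * ?M"
      using flow_bound(2)[OF f, of t] mult_right_mono[OF eR M0] by simp
  qed
  also have "\<dots> = L * exp (2 * L * R) * (norm z + 2 * ?M)" by (simp add: algebra_simps)
  finally show ?thesis .
qed

lemma flow_time_lipschitz:
  assumes f: "f \<in> P1" and t: "\<bar>t\<bar> \<le> R" "\<bar>s\<bar> \<le> R"
  shows "norm (flow f t z - flow f s z) \<le> L * exp (2 * L * R) * (norm z + 2 * (\<integral>x. norm x \<partial>f)) * \<bar>t - s\<bar>"
proof -
  let ?v = "\<lambda>r. \<integral>x. K (flow f r z) (flow f r x) \<partial>f"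
  let ?B = "L * exp (2 * L * R) * (norm z + 2 * (\<integral>x. norm x \<partial>f))"
  have "norm (flow f t z - flow f s z) \<le> ?B * norm (t - s)"
  proof (rule differentiable_bound[where S="{-R..R}" and f'="\<lambda>r h. h *\<^sub>R ?v r"])
    fix r assume r: "r \<in> {-R..R}"
    show "((\<lambda>r. flow f r z) has_derivative (\<lambda>h. h *\<^sub>R ?v r)) (at r within {-R..R})"
      using has_vector_derivative_at_within[OF mf_solution_deriv[OF flow(1)[OF f]], of z r] P1D(4)[OF f]
      by (simp add: has_vector_derivative_def)
    show "onorm (\<lambda>h. h *\<^sub>R ?v r) \<le> ?B"
    proof (rule onorm_le)
      fix h :: real
      have "\<bar>h\<bar> * norm (?v r) \<le> \<bar>h\<bar> * ?B"
        using r by (intro mult_left_mono flow_velocity_bound[OF f]) auto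
      then show "norm (h *\<^sub>R ?v r) \<le> ?B * norm h" by (simp add: mult.commute)
    qed
  qed (use t in auto)
  then show ?thesis by simp
qed

lemma push_time_lipschitz:
  assumes f: "f \<in> P1" and t: "\<bar>t\<bar> \<le> R" "\<bar>s\<bar> \<le> R"
  shows "dist_MK (push t f) (push s f) \<le> 3 * L * exp (2 * L * R) * \<bar>t - s\<bar> * (\<integral>x. norm x \<partial>f)"
proof -
  interpret prob_space f by (rule P1D(1)[OF f])
  let ?M = "\<integral>x. norm x \<partial>f"
  note i = mf_solution_integrable[OF flow(1)[OF f]]
  have "dist_MK (push t f) (push s f) \<le> (\<integral>z. dist (flow f t z) (flow f s z) \<partial>f)"
    unfolding push_def by (intro dist_MK_distr_le prob_space_axioms i)
  also have "\<dots> \<le> (\<integral>z. L * exp (2 * L * R) * (norm z + 2 * ?M) * \<bar>t - s\<bar> \<partial>f)"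
    using i P1D(3)[OF f] flow_time_lipschitz[OF f t] by (intro integral_mono) (auto simp: dist_norm)
  \<comment> \<open>Averaging |z| + 2 M over \<open>f\<close> gives 3 M, where M is the first
    moment.\<close>
  also have "\<dots> = 3 * L * exp (2 * L * R) * \<bar>t - s\<bar> * ?M"
    using P1D(3)[OF f] by (simp add: prob_space)
  finally show ?thesis .
qed

subsection \<open>The particle system\<close>

lemma integral_uniform_count:
  fixes g :: "nat \<Rightarrow> real^'d"
  shows "(\<integral>k. g k \<partial>uniform_count_measure {..<N}) = (1 / real N) *\<^sub>R (\<Sum>k<N. g k)"
  unfolding uniform_count_measure_def
  by (subst lebesgue_integral_point_measure_finite) (auto simp: scaleR_sum_right)

text \<open>Stated for an arbitrary solution of the differential equations, so that uniqueness of
  the particle system follows from that of mean field solutions. With finitely many paths, their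
  maxima over a compact time interval form the integrable bound.\<close>

lemma particle_solution_mf:
  assumes z: "particle_solution K N Z0 z"
  shows "mf_solution K (uniform_count_measure {..<N}) z"
  unfolding mf_solution_def
proof (intro conjI allI ballI)
  show "z t \<in> borel_measurable (uniform_count_measure {..<N})" for t by simp
  have d: "((\<lambda>s. z s k) has_vector_derivative (1 / real N) *\<^sub>R (\<Sum>l<N. K (z t k) (z t l))) (at t)" if "k < N" for t k
    using z that by (auto simp: particle_solution_def)
  have "\<exists>B. \<forall>t. \<bar>t\<bar> \<le> T \<longrightarrow> norm (z t k) \<le> B" if k: "k < N" for T k
  proof -
    have "continuous_on {-T..T} (\<lambda>t. z t k)"
      by (intro continuous_at_imp_continuous_on ballI has_vector_derivative_continuous[OF d[OF k]])
    then have "compact ((\<lambda>t. z t k) ` {-T..T})" by (intro compact_continuous_image) auto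
    then obtain B where "\<forall>x\<in>(\<lambda>t. z t k) ` {-T..T}. norm x \<le> B"
      using compact_imp_bounded bounded_iff by metis
    then show ?thesis by (intro exI[of _ B]) (auto simp: abs_le_iff)
  qed
  then have ex: "\<forall>k\<in>{..<N}. \<exists>B. \<forall>t. \<bar>t\<bar> \<le> T \<longrightarrow> norm (z t k) \<le> B" for T by simp
  show "\<exists>h. integrable (uniform_count_measure {..<N}) h \<and>
      (\<forall>t \<omega>. \<bar>t\<bar> \<le> T \<longrightarrow> \<omega> \<in> space (uniform_count_measure {..<N}) \<longrightarrow> norm (z t \<omega>) \<le> h \<omega>)" for T
  proof -
    obtain h where "\<forall>k\<in>{..<N}. \<forall>t. \<bar>t\<bar> \<le> T \<longrightarrow> norm (z t k) \<le> h k"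
      using bchoice[OF ex[of T]] by blast
    then show ?thesis
      by (intro exI[of _ h]) (simp add: integrable_uniform_count space_uniform_count_measure)
  qed
  show "((\<lambda>s. z s k) has_vector_derivative (\<integral>l. K (z t k) (z t l) \<partial>uniform_count_measure {..<N})) (at t)"
    if "k \<in> space (uniform_count_measure {..<N})" for t k
    using d[of k t] that by (simp add: integral_uniform_count space_uniform_count_measure)
qed

lemma particles_mf:
  assumes N: "1 \<le> N"
  shows "mf_solution K (uniform_count_measure {..<N}) (\<lambda>t k. flow (empirical N Z) t (Z k))"
proof (rule mf_solution_comp[OF flow(1)[OF empirical_P1[OF N]]])
  show "Z \<in> uniform_count_measure {..<N} \<rightarrow>\<^sub>M empirical N Z"
    using P1D(4)[OF empirical_P1[OF N, of Z]] by simp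
  show "distr (uniform_count_measure {..<N}) (empirical N Z) Z = empirical N Z"
    using P1D(2)[OF empirical_P1[OF N, of Z]]
    by (subst (2) empirical_eq[OF N]) (auto intro: distr_cong)
qed

text \<open>Evaluates the definite description in \<open>particle_flow\<close>: the flow of the
  empirical measure solves the system, and every other solution agrees with it on the indices below
  \<open>N\<close> by uniqueness and elsewhere because configurations are extensional.\<close>

lemma particle_flow_eq:
  assumes N: "1 \<le> N" and Z: "Z \<in> config N"
  shows "particle_flow K N t Z = (\<lambda>k\<in>{..<N}. flow (empirical N Z) t (Z k))"
proof -
  define z where "z t = (\<lambda>k\<in>{..<N}. flow (empirical N Z) t (Z k))" for t
  note e = empirical_P1[OF N, of Z]
  have "particle_solution K N Z z"
    unfolding particle_solution_def
  proof (intro conjI allI impI)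
    show "z t \<in> config N" for t by (simp add: z_def)
    show "z 0 = Z" using Z by (auto simp: z_def flow_0[OF e] fun_eq_iff PiE_def extensional_def)
    fix t k assume k: "k < N"
    then show "((\<lambda>s. z s k) has_vector_derivative (1 / real N) *\<^sub>R (\<Sum>l<N. K (z t k) (z t l))) (at t)"
      using mf_solution_deriv[OF particles_mf[OF N, of Z], of k t]
      by (simp add: space_uniform_count_measure integral_uniform_count z_def)
  qed
  moreover have "y = z" if y: "particle_solution K N Z y" for y
  proof (intro ext)
    fix t k
    show "y t k = z t k"
    proof (cases "k < N")
      case True
      have "y 0 = Z" using y by (simp add: particle_solution_def)
      then show ?thesis
        using mf_solution_eq_flow(2)[OF prob_space_uniform_count[OF N] particle_solution_mf[OF y], of k t] True
        by (simp add: z_def empirical_eq[OF N] space_uniform_count_measure)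
    next
      case False
      moreover have "y t \<in> config N" using y by (simp add: particle_solution_def)
      ultimately show ?thesis by (auto simp: z_def PiE_def extensional_def)
    qed
  qed
  ultimately have "(THE z. particle_solution K N Z z) = z" by (rule the_equality)
  then show ?thesis by (simp add: particle_flow_def z_def)
qed

lemma empirical_particle_flow:
  assumes N: "1 \<le> N" and Z: "Z \<in> config N"
  shows "empirical N (particle_flow K N t Z) = push t (empirical N Z)"
proof -
  note * = mf_solution_eq_flow(3)[OF prob_space_uniform_count[OF N] particles_mf[OF N, of Z], of t]
  have "empirical N (particle_flow K N t Z) = distr (uniform_count_measure {..<N}) borel (\<lambda>k. flow (empirical N Z) t (Z k))"
    unfolding particle_flow_eq[OF N Z] empirical_eq[OF N, of "\<lambda>k\<in>{..<N}. flow (empirical N Z) t (Z k)"]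
    by (rule distr_cong) (auto simp: space_uniform_count_measure)
  also have "\<dots> = push t (empirical N Z)"
    unfolding * flow_0[OF empirical_P1[OF N]] by (simp add: empirical_eq[OF N])
  finally show ?thesis .
qed

text \<open>Particles started from two configurations are two solutions on the same space of
  indices, although they are flows of different empirical measures. Stability thus bounds the
  distance of particles by that of the configurations and gives continuity.\<close>

lemma particle_flow_measurable:
  assumes N: "1 \<le> N"
  shows "particle_flow K N t \<in> config_algebra N \<rightarrow>\<^sub>M config_algebra N"
proof -
  have "(\<lambda>Z. flow (empirical N Z) t (Z k)) \<in> borel_measurable (config_algebra N)" if k: "k < N" for k
  proof (rule measurable_compose[OF measurable_config_borel borel_measurable_continuous_onI])
    let ?F = "\<lambda>Z. flow (empirical N Z) t (Z k)"
    have le: "dist (?F Z') (?F Z) \<le> exp (2 * L * \<bar>t\<bar>) * (dist (Z' k) (Z k) + (\<Sum>l<N. dist (Z' l) (Z l)) / N)" for Z Z'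
      using stability(2)[OF prob_space_uniform_count[OF N] particles_mf[OF N, of Z'] particles_mf[OF N, of Z], of k t] k
      by (simp add: flow_0[OF empirical_P1[OF N]] dist_norm space_uniform_count_measure integral_uniform_count_measure)
    show "continuous_on UNIV ?F"
      unfolding continuous_on_def
    proof
      fix Z :: "nat \<Rightarrow> real^'d"
      define g where "g Z' = exp (2 * L * \<bar>t\<bar>) * (dist (Z' k) (Z k) + (\<Sum>l<N. dist (Z' l) (Z l)) / N)" for Z'
      have "continuous_on UNIV g"
        unfolding g_def using N by (intro continuous_intros continuous_on_product_coordinates) auto
      then have "(g \<longlongrightarrow> g Z) (at Z)" by (simp add: continuous_on_def)
      then have "(g \<longlongrightarrow> 0) (at Z)" by (simp add: g_def)
      then have "((\<lambda>Z'. dist (?F Z') (?F Z)) \<longlongrightarrow> 0) (at Z)"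
        by (rule tendsto_sandwich[OF always_eventually always_eventually tendsto_const, rotated 2]) (use le in \<open>auto simp: g_def\<close>)
      then show "(?F \<longlongrightarrow> ?F Z) (at Z)" by (rule tendsto_dist_iff[THEN iffD2])
    qed
  qed
  then have "(\<lambda>Z. \<lambda>k\<in>{..<N}. flow (empirical N Z) t (Z k)) \<in> config_algebra N \<rightarrow>\<^sub>M config_algebra N"
    by (intro measurable_restrict) auto
  then show ?thesis
    by (subst measurable_cong[OF particle_flow_eq[OF N]]) (auto simp: space_PiM)
qed

end

subsection \<open>Evolution of random measures\<close>

lemma topspace_P1_topology [simp]: "topspace P1_topology = P1"
  using space_P1_borel by simp

lemma empirical_zero: "1 \<le> N \<Longrightarrow> empirical N (\<lambda>_. 0) = return borel (0 :: real^'d)"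
  by (simp add: empirical_eq prob_space.distr_const[OF prob_space_uniform_count])

text \<open>In a coupling with the Dirac mass at 0 the second coordinate is almost surely 0, so the
  cost of any such coupling is the first moment.\<close>

lemma first_moment_le_dist_MK:
  fixes f :: "(real^'d) measure"
  assumes f: "f \<in> P1"
  shows "(\<integral>x. norm x \<partial>f) \<le> dist_MK f (return borel 0)"
proof (rule field_le_epsilon)
  fix e :: real assume e: "0 < e"
  obtain \<pi> where \<pi>: "\<pi> \<in> couplings euclidean f (return borel (0::real^'d))"
    "(\<integral>\<^sup>+p. ennreal (dist (fst p) (snd p)) \<partial>\<pi>) \<le> ennreal (dist_MK f (return borel 0) + e)"
    using euc.W_obtain[OF f return_0_P1 e] by auto
  have s[measurable_cong]: "sets \<pi> = sets (borel \<Otimes>\<^sub>M borel)"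
    and m: "distr \<pi> borel fst = f" "distr \<pi> borel snd = return borel (0::real^'d)"
    using \<pi>(1) by (auto simp: euc.couplings_iff)
  have "AE y in distr \<pi> borel snd. y = (0::real^'d)" unfolding m by (simp add: AE_return)
  then have z: "AE p in \<pi>. snd p = 0" by (rule AE_distrD[rotated]) measurable
  have "ennreal (\<integral>x. norm x \<partial>f) = (\<integral>\<^sup>+x. ennreal (norm x) \<partial>f)"
    using P1D(3)[OF f] by (subst nn_integral_eq_integral) auto
  also have "\<dots> = (\<integral>\<^sup>+p. ennreal (norm (fst p)) \<partial>\<pi>)"
    unfolding m(1)[symmetric] by (subst nn_integral_distr) auto
  also have "\<dots> = (\<integral>\<^sup>+p. ennreal (dist (fst p) (snd p)) \<partial>\<pi>)"
    using z by (intro nn_integral_cong_AE) auto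
  also have "\<dots> \<le> ennreal (dist_MK f (return borel 0) + e)" by (rule \<pi>(2))
  finally show "(\<integral>x. norm x \<partial>f) \<le> dist_MK f (return borel 0) + e"
    using e euc.W_nonneg[of f "return borel 0"] by (subst (asm) ennreal_le_iff) auto
qed

lemma P1P1D:
  assumes "P \<in> P1P1"
  shows "prob_space P" "sets P = sets P1_borel" "(\<integral>\<^sup>+\<mu>. ennreal (dist_MK \<mu> (return borel 0)) \<partial>P) < \<infinity>"
    "space P = P1" "P \<in> space (prob_algebra P1_borel)"
  using assms sets_eq_imp_space_eq[of P P1_borel] by (auto simp: P1P1_def space_prob_algebra)

text \<open>Jensen's inequality for the power \<open>p\<close>. If the mean is 0 or the right-hand
  side is infinite, there is nothing to show.\<close>

lemma moment_power_le:
  fixes X :: "'w \<Rightarrow> real"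
  assumes "prob_space M" and X: "integrable M X" "\<And>x. 0 \<le> X x" and p: "1 \<le> p"
  shows "ennreal ((\<integral>x. X x \<partial>M) ^ p) \<le> (\<integral>\<^sup>+x. ennreal (X x ^ p) \<partial>M)"
proof (cases "(\<integral>\<^sup>+x. ennreal (X x ^ p) \<partial>M) < \<infinity> \<and> (\<integral>x. X x \<partial>M) > 0")
  case False
  have "0 \<le> (\<integral>x. X x \<partial>M)" using X by simp
  with False p show ?thesis
    by (cases "(\<integral>x. X x \<partial>M) = 0") (auto simp: top_unique not_less power_0_left)
next
  case True
  interpret prob_space M by fact
  define m where "m = (\<integral>x. X x \<partial>M)"
  have m: "0 < m" using True by (simp add: m_def)
  have i: "integrable M (\<lambda>x. X x ^ p)"
    using True X by (intro integrableI_bounded) auto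
  \<comment> \<open>The integrand is the tangent to the power function at the mean \<open>m\<close>.
    Its linear part integrates to 0, and Bernoulli's inequality puts it below the power.\<close>
  have "m ^ p = (\<integral>x. m ^ p * (1 + real p * (X x / m - 1)) \<partial>M)"
    using X m by (simp add: prob_space m_def[symmetric])
  also have "\<dots> \<le> (\<integral>x. X x ^ p \<partial>M)"
  proof (rule integral_mono)
    fix x
    have "1 + real p * (X x / m - 1) \<le> (1 + (X x / m - 1)) ^ p"
      using X(2)[of x] m by (intro Bernoulli_inequality) simp
    then have "m ^ p * (1 + real p * (X x / m - 1)) \<le> m ^ p * (X x / m) ^ p"
      using m by (intro mult_left_mono) auto
    also have "\<dots> = X x ^ p" using m by (simp add: power_divide)
    finally show "m ^ p * (1 + real p * (X x / m - 1)) \<le> X x ^ p" .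
  qed (use X i in auto)
  finally have "ennreal (m ^ p) \<le> ennreal (\<integral>x. X x ^ p \<partial>M)" by (rule ennreal_leI)
  also have "\<dots> = (\<integral>\<^sup>+x. ennreal (X x ^ p) \<partial>M)"
    using i X by (subst nn_integral_eq_integral) auto
  finally show ?thesis by (simp add: m_def)
qed

lemma empirical_law_P1P1:
  fixes P :: "(nat \<Rightarrow> real^'d) measure"
  assumes N: "1 \<le> N" and P: "P \<in> P1_sym N"
  shows "empirical_law N P \<in> P1P1"
proof -
  have p: "prob_space P" and s[measurable_cong]: "sets P = sets (config_algebra N)"
    and m: "(\<integral>\<^sup>+ Z. ennreal (L2_set (\<lambda>k. norm (Z k)) {..<N}) \<partial>P) < \<infinity>"
    using P by (auto simp: P1_sym_def)
  note [measurable] = pp.dist_measurable' pp.x0_measurable measurable_empirical[OF N]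
  have "(\<integral>\<^sup>+\<mu>. ennreal (dist_MK \<mu> (return borel 0)) \<partial>empirical_law N P)
      = (\<integral>\<^sup>+Z. ennreal (dist_MK (empirical N Z) (return borel 0)) \<partial>P)"
    unfolding empirical_law_def by (subst nn_integral_distr) auto
  also have "\<dots> \<le> (\<integral>\<^sup>+ Z. ennreal (L2_set (\<lambda>k. norm (Z k)) {..<N}) \<partial>P)"
  proof (intro nn_integral_mono ennreal_leI)
    fix Z :: "nat \<Rightarrow> real^'d"
    have "dist_MK (empirical N Z) (return borel 0) \<le> (\<Sum>k<N. norm (Z k)) / N"
      using dist_MK_empirical_le[OF N, of Z "\<lambda>_. 0"] by (simp add: empirical_zero[OF N])
    also have "\<dots> \<le> (\<Sum>k<N. L2_set (\<lambda>k. norm (Z k)) {..<N}) / N"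
      by (intro divide_right_mono sum_mono member_le_L2_set) auto
    also have "\<dots> = L2_set (\<lambda>k. norm (Z k)) {..<N}" using N by simp
    finally show "dist_MK (empirical N Z) (return borel 0) \<le> L2_set (\<lambda>k. norm (Z k)) {..<N}" .
  qed
  finally have "(\<integral>\<^sup>+\<mu>. ennreal (dist_MK \<mu> (return borel 0)) \<partial>empirical_law N P) < \<infinity>" using m by simp
  moreover have "prob_space (empirical_law N P)"
    unfolding empirical_law_def by (rule prob_space.prob_space_distr[OF p]) measurable
  ultimately show ?thesis by (simp add: P1P1_def empirical_law_def)
qed

context mean_field begin

definition evolve :: "real \<Rightarrow> (real^'d) measure measure \<Rightarrow> (real^'d) measure measure" where
  "evolve t P = distr P P1_borel (push t)"

lemma push_dist_0: "f \<in> P1 \<Longrightarrow> dist_MK (push t f) (return borel 0) \<le> exp (2 * L * \<bar>t\<bar>) * dist_MK f (return borel 0)"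
  using push_lipschitz[of f "return borel 0" t] return_0_P1 by (simp add: push_return_0)

lemma evolve_P1P1:
  assumes P: "P \<in> P1P1"
  shows "evolve t P \<in> P1P1"
proof -
  note [measurable_cong] = P1P1D(2)[OF P]
  note [measurable] = pp.dist_measurable' pp.x0_measurable
  have "(\<integral>\<^sup>+\<mu>. ennreal (dist_MK \<mu> (return borel 0)) \<partial>evolve t P) = (\<integral>\<^sup>+\<mu>. ennreal (dist_MK (push t \<mu>) (return borel 0)) \<partial>P)"
    unfolding evolve_def by (subst nn_integral_distr) auto
  also have "\<dots> \<le> (\<integral>\<^sup>+\<mu>. ennreal (exp (2 * L * \<bar>t\<bar>)) * ennreal (dist_MK \<mu> (return borel 0)) \<partial>P)"
    using push_dist_0 by (intro nn_integral_mono) (auto simp: P1P1D(4)[OF P] ennreal_leI euc.W_nonneg simp flip: ennreal_mult)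
  also have "\<dots> = ennreal (exp (2 * L * \<bar>t\<bar>)) * (\<integral>\<^sup>+\<mu>. ennreal (dist_MK \<mu> (return borel 0)) \<partial>P)"
    by (rule nn_integral_cmult) measurable
  also have "\<dots> < \<infinity>" using P1P1D(3)[OF P] by (simp add: ennreal_mult_less_top)
  finally have "(\<integral>\<^sup>+\<mu>. ennreal (dist_MK \<mu> (return borel 0)) \<partial>evolve t P) < \<infinity>" .
  moreover have "prob_space (evolve t P)" unfolding evolve_def
    by (rule prob_space.prob_space_distr[OF P1P1D(1)[OF P]]) measurable
  ultimately show ?thesis by (simp add: P1P1_def evolve_def)
qed

lemma evolve_0:
  assumes P: "P \<in> P1P1" shows "evolve 0 P = P"
proof -
  have "evolve 0 P = distr P P1_borel (\<lambda>f. f)"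
    unfolding evolve_def by (rule distr_cong) (auto simp: push_0 P1P1D(4)[OF P])
  then show ?thesis by (simp add: distr_id2 P1P1D(2)[OF P])
qed

lemma evolve_add:
  assumes P: "P \<in> P1P1" shows "evolve (t + s) P = evolve t (evolve s P)"
proof -
  note [measurable_cong] = P1P1D(2)[OF P]
  have "evolve t (evolve s P) = distr P P1_borel (\<lambda>f. push t (push s f))"
    unfolding evolve_def by (subst distr_distr) (auto simp: comp_def)
  also have "\<dots> = evolve (t + s) P"
    unfolding evolve_def by (rule distr_cong) (auto simp: flow_add(2) P1P1D(4)[OF P])
  finally show ?thesis by simp
qed

text \<open>Applying \<open>push t\<close> to both coordinates of a coupling of P and Q couples the
  evolved laws, and each pair of measures separates by at most the constant of
  \<open>push_lipschitz\<close>.\<close>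

lemma evolve_lipschitz:
  assumes P: "P \<in> P1P1" and Q: "Q \<in> P1P1"
  shows "Dist_MK (evolve t P) (evolve t Q) \<le> exp (2 * L * \<bar>t\<bar>) * Dist_MK P Q"
proof (rule field_le_epsilon)
  fix e :: real assume "0 < e"
  define c where "c = exp (2 * L * \<bar>t\<bar>)"
  have c: "0 < c" by (simp add: c_def)
  obtain \<pi> where \<pi>: "\<pi> \<in> couplings P1_topology P Q"
    "(\<integral>\<^sup>+p. ennreal (dist_MK (fst p) (snd p)) \<partial>\<pi>) \<le> ennreal (Dist_MK P Q + e / c)"
    using pp.W_obtain[OF P Q, of "e / c"] \<open>0 < e\<close> c by auto
  have p: "prob_space \<pi>" and s[measurable_cong]: "sets \<pi> = sets (P1_borel \<Otimes>\<^sub>M P1_borel)"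
    and m: "distr \<pi> P1_borel fst = P" "distr \<pi> P1_borel snd = Q"
    using \<pi>(1) by (auto simp: pp.couplings_iff)
  have sp: "space \<pi> = P1 \<times> P1" using sets_eq_imp_space_eq[OF s] by (simp add: space_pair_measure)
  have e1: "evolve t P = distr \<pi> P1_borel (\<lambda>p. push t (fst p))"
    unfolding evolve_def by (subst m(1)[symmetric], subst distr_distr) (auto simp: comp_def)
  have e2: "evolve t Q = distr \<pi> P1_borel (\<lambda>p. push t (snd p))"
    unfolding evolve_def by (subst m(2)[symmetric], subst distr_distr) (auto simp: comp_def)
  have "Dist_MK (evolve t P) (evolve t Q) \<le> c * (Dist_MK P Q + e / c)"
    unfolding e1 e2
  proof (rule pp.W_distr_le[OF p])
    note [measurable] = pp.dist_measurable'
    have "(\<integral>\<^sup>+p. ennreal (dist_MK (push t (fst p)) (push t (snd p))) \<partial>\<pi>)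
        \<le> (\<integral>\<^sup>+p. ennreal c * ennreal (dist_MK (fst p) (snd p)) \<partial>\<pi>)"
      using push_lipschitz[of _ _ t] c
      by (intro nn_integral_mono) (auto simp: sp c_def[symmetric] ennreal_leI euc.W_nonneg simp flip: ennreal_mult)
    also have "\<dots> = ennreal c * (\<integral>\<^sup>+p. ennreal (dist_MK (fst p) (snd p)) \<partial>\<pi>)"
      by (rule nn_integral_cmult) measurable
    also have "\<dots> \<le> ennreal c * ennreal (Dist_MK P Q + e / c)" by (intro mult_left_mono \<pi>(2)) simp
    also have "\<dots> = ennreal (c * (Dist_MK P Q + e / c))"
      using c \<open>0 < e\<close> pp.W_nonneg[of P Q] by (subst ennreal_mult) auto
    finally show "(\<integral>\<^sup>+p. ennreal (dist_MK (push t (fst p)) (push t (snd p))) \<partial>\<pi>) \<le> ennreal (c * (Dist_MK P Q + e / c))" .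
    show "0 \<le> c * (Dist_MK P Q + e / c)" using c \<open>0 < e\<close> pp.W_nonneg[of P Q] by simp
  qed measurable
  also have "\<dots> = c * Dist_MK P Q + e" using c by (simp add: field_simps)
  finally show "Dist_MK (evolve t P) (evolve t Q) \<le> exp (2 * L * \<bar>t\<bar>) * Dist_MK P Q + e" by (simp add: c_def)
qed

lemma evolve_time_lipschitz:
  assumes P: "P \<in> P1P1"
  obtains C where "0 \<le> C" "\<And>R t s. \<bar>t\<bar> \<le> R \<Longrightarrow> \<bar>s\<bar> \<le> R \<Longrightarrow>
    Dist_MK (evolve t P) (evolve s P) \<le> C * exp (2 * L * R) * \<bar>t - s\<bar>"
proof -
  define I where "I = enn2real (\<integral>\<^sup>+\<mu>. ennreal (dist_MK \<mu> (return borel 0)) \<partial>P)"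
  have I: "ennreal I = (\<integral>\<^sup>+\<mu>. ennreal (dist_MK \<mu> (return borel 0)) \<partial>P)" "0 \<le> I"
    unfolding I_def using P1P1D(3)[OF P] by (auto simp: less_top)
  note [measurable_cong] = P1P1D(2)[OF P]
  note [measurable] = pp.dist_measurable' pp.x0_measurable
  have "Dist_MK (evolve t P) (evolve s P) \<le> 3 * L * I * exp (2 * L * R) * \<bar>t - s\<bar>"
    if t: "\<bar>t\<bar> \<le> R" "\<bar>s\<bar> \<le> R" for R t s
    unfolding evolve_def
  proof (rule pp.W_distr_le[OF P1P1D(1)[OF P]])
    define c where "c = 3 * L * exp (2 * L * R) * \<bar>t - s\<bar>"
    have c: "0 \<le> c" using L_nonneg by (simp add: c_def)
    have "(\<integral>\<^sup>+f. ennreal (dist_MK (push t f) (push s f)) \<partial>P) \<le> (\<integral>\<^sup>+f. ennreal c * ennreal (dist_MK f (return borel 0)) \<partial>P)"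
    proof (rule nn_integral_mono)
      fix f assume "f \<in> space P"
      then have f: "f \<in> P1" by (simp add: P1P1D(4)[OF P])
      have "dist_MK (push t f) (push s f) \<le> c * (\<integral>x. norm x \<partial>f)"
        using push_time_lipschitz[OF f t] by (simp add: c_def)
      also have "\<dots> \<le> c * dist_MK f (return borel 0)"
        by (intro mult_left_mono first_moment_le_dist_MK f c)
      finally show "ennreal (dist_MK (push t f) (push s f)) \<le> ennreal c * ennreal (dist_MK f (return borel 0))"
        using c by (simp add: ennreal_leI euc.W_nonneg flip: ennreal_mult)
    qed
    also have "\<dots> = ennreal c * ennreal I" unfolding I(1) by (rule nn_integral_cmult) measurable
    also have "\<dots> = ennreal (3 * L * I * exp (2 * L * R) * \<bar>t - s\<bar>)"
      using c I(2) by (simp add: c_def ac_simps flip: ennreal_mult)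
    finally show "(\<integral>\<^sup>+f. ennreal (dist_MK (push t f) (push s f)) \<partial>P) \<le> ennreal (3 * L * I * exp (2 * L * R) * \<bar>t - s\<bar>)" .
  qed (use L_nonneg I(2) in \<open>auto cong: measurable_cong_sets\<close>)
  \<comment> \<open>\<open>I\<close> is the mean distance of the random measure to the Dirac mass at
    0. The constant does not depend on the time window; the window enters only through exp(2 L
    R).\<close>
  then show thesis using that[of "3 * L * I"] L_nonneg I(2) by simp
qed

lemma evolve_continuous:
  assumes P: "P \<in> P1P1"
  shows "continuous_map euclidean (Metric_space.mtopology P1P1 Dist_MK) (\<lambda>t. evolve t P)"
  unfolding pp.W.continuous_map_to_metric
proof (intro ballI allI impI)
  fix t e :: real assume e: "0 < e"
  obtain C where C: "0 \<le> C" "\<And>R t s. \<bar>t\<bar> \<le> R \<Longrightarrow> \<bar>s\<bar> \<le> R \<Longrightarrow>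
    Dist_MK (evolve t P) (evolve s P) \<le> C * exp (2 * L * R) * \<bar>t - s\<bar>"
    by (rule evolve_time_lipschitz[OF P]) (rule that)
  define R where "R = \<bar>t\<bar> + 1"
  define c where "c = C * exp (2 * L * R) + 1"
  have c: "0 < c" using C(1) by (simp add: c_def add_nonneg_pos)
  show "\<exists>U. openin euclidean U \<and> t \<in> U \<and> (\<forall>s\<in>U. evolve s P \<in> pp.W.mball (evolve t P) e)"
  proof (intro exI[of _ "ball t (min 1 (e / c))"] conjI ballI)
    show "t \<in> ball t (min 1 (e / c))" using e c by simp
    fix s assume "s \<in> ball t (min 1 (e / c))"
    then have s: "\<bar>t - s\<bar> < 1" "\<bar>t - s\<bar> < e / c" by (auto simp: dist_real_def)
    have "Dist_MK (evolve t P) (evolve s P) \<le> C * exp (2 * L * R) * \<bar>t - s\<bar>"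
      using s(1) by (intro C(2)) (auto simp: R_def)
    also have "\<dots> \<le> c * \<bar>t - s\<bar>" by (intro mult_right_mono) (auto simp: c_def)
    also have "\<dots> < e" using s(2) c by (simp add: field_simps)
    finally show "evolve s P \<in> pp.W.mball (evolve t P) e" using evolve_P1P1[OF P] by simp
  qed simp
qed

text \<open>The flow is bounded by E (|z| + M) with M the first moment of the measure. After taking
  the power \<open>p\<close>, the term with M is absorbed by the moment of order \<open>p\<close> of
  the same measure through \<open>moment_power_le\<close>.\<close>

lemma evolve_moment_class:
  assumes P: "P \<in> moment_class" shows "evolve t P \<in> moment_class"
proof -
  have PP: "P \<in> P1P1" using P by (simp add: moment_class_def)
  note [measurable_cong] = P1P1D(2)[OF PP]
  define p where "p = CARD('d) + 5"
  have mom: "(\<lambda>f. \<integral>\<^sup>+z. ennreal (norm z ^ p) \<partial>f) \<in> borel_measurable P1_borel"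
    by (rule measurable_compose[OF measurable_prob_algebraD[OF P1_borel_prob_algebra] nn_integral_measurable_subprob_algebra]) measurable
  define E where "E = exp (2 * L * \<bar>t\<bar>)"
  \<comment> \<open>The power of a sum of two terms is at most the power of twice their maximum.
    This gives the factor 2 to the power \<open>p\<close>; the further factor 2 below comes from
    absorbing the first moment.\<close>
  define c where "c = E ^ p * 2 ^ p"
  have E: "0 < E" and c: "0 < c" by (auto simp: E_def c_def)
  have "(\<integral>\<^sup>+f. (\<integral>\<^sup>+z. ennreal (norm z ^ p) \<partial>f) \<partial>evolve t P) = (\<integral>\<^sup>+f. (\<integral>\<^sup>+z. ennreal (norm z ^ p) \<partial>push t f) \<partial>P)"
    unfolding evolve_def using mom by (subst nn_integral_distr) auto
  also have "\<dots> \<le> (\<integral>\<^sup>+f. ennreal (2 * c) * (\<integral>\<^sup>+z. ennreal (norm z ^ p) \<partial>f) \<partial>P)"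
  proof (rule nn_integral_mono)
    fix f assume "f \<in> space P"
    then have f: "f \<in> P1" by (simp add: P1P1D(4)[OF PP])
    interpret prob_space f by (rule P1D(1)[OF f])
    note [measurable_cong] = P1D(2)[OF f]
    define M where "M = (\<integral>x. norm x \<partial>f)"
    have M: "0 \<le> M" by (simp add: M_def)
    note [measurable] = flow_measurable[OF f]
    have "(\<integral>\<^sup>+z. ennreal (norm z ^ p) \<partial>push t f) = (\<integral>\<^sup>+z. ennreal (norm (flow f t z) ^ p) \<partial>f)"
      unfolding push_def by (subst nn_integral_distr) auto
    also have "\<dots> \<le> (\<integral>\<^sup>+z. ennreal c * ennreal (norm z ^ p) + ennreal c * ennreal (M ^ p) \<partial>f)"
    proof (rule nn_integral_mono)
      fix z
      have "norm (flow f t z) ^ p \<le> (E * (norm z + M)) ^ p"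
        using flow_bound(1)[OF f, of t z] by (intro power_mono) (auto simp: E_def M_def)
      also have "\<dots> \<le> (E * (2 * max (norm z) M)) ^ p" using E M by (intro power_mono mult_left_mono) auto
      also have "\<dots> = c * max (norm z) M ^ p" by (simp add: c_def power_mult_distrib)
      also have "\<dots> \<le> c * (norm z ^ p + M ^ p)" using c M by (intro mult_left_mono) (auto simp: max_def)
      finally show "ennreal (norm (flow f t z) ^ p) \<le> ennreal c * ennreal (norm z ^ p) + ennreal c * ennreal (M ^ p)"
        using c M by (simp add: ennreal_leI distrib_left flip: ennreal_mult ennreal_plus)
    qed
    also have "\<dots> = ennreal c * (\<integral>\<^sup>+z. ennreal (norm z ^ p) \<partial>f) + ennreal c * ennreal (M ^ p)"
      by (subst nn_integral_add, simp, simp, subst nn_integral_cmult) (auto simp: emeasure_space_1)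
    also have "\<dots> \<le> ennreal c * (\<integral>\<^sup>+z. ennreal (norm z ^ p) \<partial>f) + ennreal c * (\<integral>\<^sup>+z. ennreal (norm z ^ p) \<partial>f)"
      unfolding M_def using P1D(3)[OF f]
      by (intro add_left_mono mult_left_mono moment_power_le prob_space_axioms) (auto simp: p_def)
    also have "\<dots> = ennreal (2 * c) * (\<integral>\<^sup>+z. ennreal (norm z ^ p) \<partial>f)"
    proof -
      have "ennreal (2 * c) = ennreal c + ennreal c" using c by (simp flip: ennreal_plus)
      then show ?thesis by (simp only: distrib_right)
    qed
    finally show "(\<integral>\<^sup>+z. ennreal (norm z ^ p) \<partial>push t f) \<le> ennreal (2 * c) * (\<integral>\<^sup>+z. ennreal (norm z ^ p) \<partial>f)" .
  qed
  also have "\<dots> = ennreal (2 * c) * (\<integral>\<^sup>+f. (\<integral>\<^sup>+z. ennreal (norm z ^ p) \<partial>f) \<partial>P)"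
    by (rule nn_integral_cmult) (use mom in \<open>simp add: measurable_cong_sets[OF P1P1D(2)[OF PP] refl]\<close>)
  also have "\<dots> < \<infinity>" using P by (auto simp: moment_class_def p_def ennreal_mult_less_top)
  finally show ?thesis using evolve_P1P1[OF PP] by (simp add: moment_class_def p_def)
qed

lemma empirical_law_flow:
  assumes N: "1 \<le> N" and P: "P \<in> P1_sym N"
  shows "empirical_law N (flow_push K N t P) = evolve t (empirical_law N P)"
proof -
  have s[measurable_cong]: "sets P = sets (config_algebra N)" using P by (auto simp: P1_sym_def)
  have sp: "space P = config N" using sets_eq_imp_space_eq[OF s] by (simp add: space_PiM)
  note [measurable] = measurable_empirical[OF N] particle_flow_measurable[OF N]
  have "empirical_law N (flow_push K N t P) = distr P P1_borel (\<lambda>Z. empirical N (particle_flow K N t Z))"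
    unfolding empirical_law_def flow_push_def by (subst distr_distr) (auto simp: comp_def)
  also have "\<dots> = distr P P1_borel (\<lambda>Z. push t (empirical N Z))"
    by (rule distr_cong) (auto simp: sp empirical_particle_flow[OF N])
  also have "\<dots> = evolve t (empirical_law N P)"
    unfolding empirical_law_def evolve_def by (subst distr_distr) (auto simp: comp_def)
  finally show ?thesis .
qed

lemma mean_field_limit:
  assumes P: "P \<in> P1P1" and PN: "\<And>N. 1 \<le> N \<Longrightarrow> PN N \<in> P1_sym N"
    and lim: "(\<lambda>N. Dist_MK (empirical_law N (PN N)) P) \<longlonglongrightarrow> 0"
  shows "uniform_limit {-R..R} (\<lambda>N t. Dist_MK (empirical_law N (flow_push K N t (PN N))) (evolve t P)) (\<lambda>_. 0) sequentially"
proof (rule uniform_limitI)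
  fix e :: real assume e: "0 < e"
  define c where "c = exp (2 * L * R)"
  have c: "0 < c" by (simp add: c_def)
  have "\<forall>\<^sub>F N in sequentially. Dist_MK (empirical_law N (PN N)) P < e / c"
    using order_tendstoD(2)[OF lim, of "e / c"] e c by simp
  then show "\<forall>\<^sub>F N in sequentially. \<forall>t\<in>{-R..R}. dist (Dist_MK (empirical_law N (flow_push K N t (PN N))) (evolve t P)) 0 < e"
    using eventually_ge_at_top[of 1]
  proof eventually_elim
    fix N :: nat assume N: "Dist_MK (empirical_law N (PN N)) P < e / c" "1 \<le> N"
    show "\<forall>t\<in>{-R..R}. dist (Dist_MK (empirical_law N (flow_push K N t (PN N))) (evolve t P)) 0 < e"
    proof
      fix t assume t: "t \<in> {-R..R}"
      have "Dist_MK (empirical_law N (flow_push K N t (PN N))) (evolve t P) \<le> exp (2 * L * \<bar>t\<bar>) * Dist_MK (empirical_law N (PN N)) P"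
        unfolding empirical_law_flow[OF N(2) PN[OF N(2)]]
        by (intro evolve_lipschitz empirical_law_P1P1 N PN P)
      also have "\<dots> \<le> c * Dist_MK (empirical_law N (PN N)) P"
        unfolding c_def using t L_nonneg pp.W_nonneg by (intro mult_right_mono) (auto intro!: mult_left_mono)
      also have "\<dots> < e" using N(1) c by (simp add: field_simps)
      finally show "dist (Dist_MK (empirical_law N (flow_push K N t (PN N))) (evolve t P)) 0 < e"
        using pp.W_nonneg by simp
    qed
  qed
qed

end

subsection \<open>Mixtures of product measures\<close>

text \<open>Samples together with the random measure they were drawn from. Given the tag the samples
  are independent, and the velocities can be computed from the tag. Forgetting the tag leaves the
  mixture; forgetting the samples leaves P.\<close>

definition tagged_law ::
    "nat \<Rightarrow> (real^'d) measure measure \<Rightarrow> ((nat \<Rightarrow> real^'d) \<times> (real^'d) measure) measure" where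
  "tagged_law N P = P \<bind> (\<lambda>f. distr (PiM {..<N} (\<lambda>_. f)) (config_algebra N \<Otimes>\<^sub>M P1_borel) (\<lambda>Z. (Z, f)))"

lemma nn_integral_norm_P1: "f \<in> P1 \<Longrightarrow> (\<integral>\<^sup>+x. ennreal (norm x) \<partial>f) \<le> ennreal (dist_MK f (return borel (0::real^'d)))"
  using first_moment_le_dist_MK[of f] P1D(3)[of f] by (subst nn_integral_eq_integral) (auto simp: ennreal_leI)

lemma tagged_kernel:
  "(\<lambda>f. distr (PiM {..<N} (\<lambda>_. f)) (config_algebra N \<Otimes>\<^sub>M P1_borel) (\<lambda>Z. (Z, f)))
    \<in> P1_borel \<rightarrow>\<^sub>M prob_algebra (config_algebra N \<Otimes>\<^sub>M (P1_borel :: (real^'d) measure measure))"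
  by (rule measurable_distr_prob_space2[OF P1_borel_PiM]) (simp add: case_prod_unfold)

lemma tag_measurable:
  fixes f :: "(real^'d) measure"
  assumes f: "f \<in> P1"
  shows "(\<lambda>Z. (Z, f)) \<in> PiM {..<N} (\<lambda>_. f) \<rightarrow>\<^sub>M config_algebra N \<Otimes>\<^sub>M P1_borel"
  unfolding measurable_cong_sets[OF sets_PiM_borel[OF P1D(2)[OF f]] refl]
  using f by (intro measurable_Pair measurable_ident_sets measurable_const) auto

context
  fixes P :: "(real^'d) measure measure"
  assumes P: "P \<in> P1P1"
begin

lemma mixture_kernel: "(\<lambda>f. PiM {..<N::nat} (\<lambda>_. f)) \<in> P \<rightarrow>\<^sub>M prob_algebra (config_algebra N)"
  using P1_borel_PiM unfolding measurable_cong_sets[OF P1P1D(2)[OF P] refl] .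

lemma mixture_prob: "prob_space (mixture_power N P)"
  unfolding mixture_power_def by (rule prob_space_bind'[OF P1P1D(5)[OF P] P1_borel_PiM])

lemma mixture_sets: "sets (mixture_power N P) = sets (config_algebra N)"
  unfolding mixture_power_def by (rule sets_bind'[OF P1P1D(5)[OF P] P1_borel_PiM])

lemma nn_integral_mixture:
  assumes "F \<in> borel_measurable (config_algebra N)"
  shows "(\<integral>\<^sup>+Z. F Z \<partial>mixture_power N P) = (\<integral>\<^sup>+f. \<integral>\<^sup>+Z. F Z \<partial>PiM {..<N} (\<lambda>_. f) \<partial>P)"
  unfolding mixture_power_def
  by (rule nn_integral_bind[OF assms measurable_prob_algebraD[OF mixture_kernel]])

text \<open>Each product measure is invariant under permutation of coordinates, hence so is their
  mixture. The 2-norm is dominated by the sum of the norms, whose mean is at most \<open>N\<close>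
  times the mean distance of the random measure to the Dirac mass at 0.\<close>

lemma mixture_P1_sym: "mixture_power N P \<in> P1_sym N"
proof -
  have fin: "(\<integral>\<^sup>+ Z. ennreal (L2_set (\<lambda>k. norm (Z k)) {..<N}) \<partial>mixture_power N P) < \<infinity>"
  proof -
    have meas: "(\<lambda>Z. ennreal (norm (Z k))) \<in> borel_measurable (config_algebra N :: (nat \<Rightarrow> real^'d) measure)" if "k < N" for k
    proof -
      have [measurable]: "(\<lambda>Z. Z k) \<in> borel_measurable (config_algebra N :: (nat \<Rightarrow> real^'d) measure)"
        using that by (intro measurable_component_singleton) simp
      show ?thesis by measurable
    qed
    have "(\<integral>\<^sup>+ Z. ennreal (L2_set (\<lambda>k. norm (Z k)) {..<N}) \<partial>mixture_power N P)
        \<le> (\<integral>\<^sup>+ Z. (\<Sum>k<N. ennreal (norm (Z k))) \<partial>mixture_power N P)"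
    proof (rule nn_integral_mono)
      fix Z :: "nat \<Rightarrow> real^'d"
      have "L2_set (\<lambda>k. norm (Z k)) {..<N} \<le> (\<Sum>k<N. norm (Z k))" by (rule L2_set_le_sum) auto
      then show "ennreal (L2_set (\<lambda>k. norm (Z k)) {..<N}) \<le> (\<Sum>k<N. ennreal (norm (Z k)))"
        by (simp add: sum_ennreal ennreal_leI)
    qed
    also have "\<dots> = (\<integral>\<^sup>+f. \<integral>\<^sup>+Z. (\<Sum>k<N. ennreal (norm (Z k))) \<partial>PiM {..<N} (\<lambda>_. f) \<partial>P)"
      by (rule nn_integral_mixture) (intro borel_measurable_sum meas, simp)
    also have "\<dots> \<le> (\<integral>\<^sup>+f. of_nat N * ennreal (dist_MK f (return borel 0)) \<partial>P)"
    proof (rule nn_integral_mono)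
      fix f assume "f \<in> space P"
      then have f: "f \<in> P1" by (simp add: P1P1D(4)[OF P])
      have "(\<integral>\<^sup>+Z. (\<Sum>k<N. ennreal (norm (Z k))) \<partial>PiM {..<N} (\<lambda>_. f)) = (\<Sum>k<N. \<integral>\<^sup>+Z. ennreal (norm (Z k)) \<partial>PiM {..<N} (\<lambda>_. f))"
        using meas by (intro nn_integral_sum) (simp add: measurable_cong_sets[OF sets_PiM_borel[OF P1D(2)[OF f]] refl])
      also have "\<dots> = (\<Sum>k<N. \<integral>\<^sup>+x. ennreal (norm x) \<partial>f)"
        using P1D(2)[OF f]
        by (intro sum.cong refl nn_integral_PiM_component[OF P1D(1)[OF f], of "\<lambda>x. ennreal (norm x)"])
          (auto cong: measurable_cong_sets)
      also have "\<dots> \<le> (\<Sum>k<N. ennreal (dist_MK f (return borel 0)))" by (intro sum_mono nn_integral_norm_P1 f)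
      finally show "(\<integral>\<^sup>+Z. (\<Sum>k<N. ennreal (norm (Z k))) \<partial>PiM {..<N} (\<lambda>_. f)) \<le> of_nat N * ennreal (dist_MK f (return borel 0))"
        by simp
    qed
    also have "\<dots> = of_nat N * (\<integral>\<^sup>+f. ennreal (dist_MK f (return borel 0)) \<partial>P)"
    proof (rule nn_integral_cmult)
      note [measurable_cong] = P1P1D(2)[OF P]
      note [measurable] = pp.dist_measurable' pp.x0_measurable
      show "(\<lambda>f. ennreal (dist_MK f (return borel 0))) \<in> borel_measurable P" by measurable
    qed
    also have "\<dots> < \<infinity>" using P1P1D(3)[OF P] by (simp add: ennreal_mult_less_top of_nat_less_top)
    finally show ?thesis .
  qed
  have sym: "distr (mixture_power N P) (config_algebra N) (\<lambda>Z. \<lambda>k\<in>{..<N}. Z (\<sigma> k)) = mixture_power N P"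
    if \<sigma>: "\<sigma> permutes {..<N}" for \<sigma>
  proof -
    have "(\<lambda>Z. \<lambda>k\<in>{..<N}. Z (\<sigma> k)) \<in> config_algebra N \<rightarrow>\<^sub>M (config_algebra N :: (nat \<Rightarrow> real^'d) measure)"
      using permutes_in_image[OF \<sigma>] by (intro measurable_restrict measurable_component_singleton) auto
    then have "distr (mixture_power N P) (config_algebra N) (\<lambda>Z. \<lambda>k\<in>{..<N}. Z (\<sigma> k))
        = P \<bind> (\<lambda>f. distr (PiM {..<N} (\<lambda>_. f)) (config_algebra N) (\<lambda>Z. \<lambda>k\<in>{..<N}. Z (\<sigma> k)))"
      unfolding mixture_power_def
      by (intro distr_bind[OF measurable_prob_algebraD[OF mixture_kernel]] prob_space.not_empty P1P1D(1)[OF P])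
    also have "\<dots> = mixture_power N P"
      unfolding mixture_power_def
    proof (rule bind_cong[OF refl])
      fix f assume "f \<in> space P"
      then have f: "f \<in> P1" by (simp add: P1P1D(4)[OF P])
      have "distr (PiM {..<N} (\<lambda>_. f)) (config_algebra N) (\<lambda>Z. \<lambda>k\<in>{..<N}. Z (\<sigma> k))
          = distr (PiM {..<N} (\<lambda>_. f)) (PiM {..<N} (\<lambda>_. f)) (\<lambda>Z. \<lambda>k\<in>{..<N}. Z (\<sigma> k))"
        by (rule distr_cong) (auto simp: sets_PiM_borel[OF P1D(2)[OF f]])
      also have "\<dots> = PiM {..<N} (\<lambda>_. f)"
        using permutes_in_image[OF \<sigma>] permutes_inj_on[OF \<sigma>] P1D(1)[OF f]
        by (intro distr_PiM_reindex[of "{..<N}" "\<lambda>_. f" \<sigma> "{..<N}"]) auto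
      finally show "distr (PiM {..<N} (\<lambda>_. f)) (config_algebra N) (\<lambda>Z. \<lambda>k\<in>{..<N}. Z (\<sigma> k)) = PiM {..<N} (\<lambda>_. f)" .
    qed
    finally show ?thesis .
  qed
  show ?thesis unfolding P1_sym_def using fin sym mixture_prob mixture_sets by auto
qed

lemma tagged_kernel_P:
  "(\<lambda>f. distr (PiM {..<N} (\<lambda>_. f)) (config_algebra N \<Otimes>\<^sub>M P1_borel) (\<lambda>Z. (Z, f)))
    \<in> P \<rightarrow>\<^sub>M prob_algebra (config_algebra N \<Otimes>\<^sub>M P1_borel)"
  using tagged_kernel unfolding measurable_cong_sets[OF P1P1D(2)[OF P] refl] .

lemma prob_space_tagged: "prob_space (tagged_law N P)"
  unfolding tagged_law_def by (rule prob_space_bind'[OF P1P1D(5)[OF P] tagged_kernel])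

lemma sets_tagged: "sets (tagged_law N P) = sets (config_algebra N \<Otimes>\<^sub>M P1_borel)"
  unfolding tagged_law_def by (rule sets_bind'[OF P1P1D(5)[OF P] tagged_kernel])

lemma space_tagged: "space (tagged_law N P) = config N \<times> P1"
  using sets_eq_imp_space_eq[OF sets_tagged] by (simp add: space_pair_measure space_PiM)

lemma nn_integral_tagged:
  assumes F: "F \<in> borel_measurable (config_algebra N \<Otimes>\<^sub>M P1_borel)"
  shows "(\<integral>\<^sup>+w. F w \<partial>tagged_law N P) = (\<integral>\<^sup>+f. \<integral>\<^sup>+Z. F (Z, f) \<partial>PiM {..<N} (\<lambda>_. f) \<partial>P)"
proof -
  have "(\<integral>\<^sup>+w. F w \<partial>tagged_law N P)
      = (\<integral>\<^sup>+f. \<integral>\<^sup>+w. F w \<partial>distr (PiM {..<N} (\<lambda>_. f)) (config_algebra N \<Otimes>\<^sub>M P1_borel) (\<lambda>Z. (Z, f)) \<partial>P)"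
    unfolding tagged_law_def by (rule nn_integral_bind[OF F measurable_prob_algebraD[OF tagged_kernel_P]])
  also have "\<dots> = (\<integral>\<^sup>+f. \<integral>\<^sup>+Z. F (Z, f) \<partial>PiM {..<N} (\<lambda>_. f) \<partial>P)"
  proof (rule nn_integral_cong)
    fix f assume "f \<in> space P"
    then have f: "f \<in> P1" by (simp add: P1P1D(4)[OF P])
    show "(\<integral>\<^sup>+w. F w \<partial>distr (PiM {..<N} (\<lambda>_. f)) (config_algebra N \<Otimes>\<^sub>M P1_borel) (\<lambda>Z. (Z, f)))
        = (\<integral>\<^sup>+Z. F (Z, f) \<partial>PiM {..<N} (\<lambda>_. f))"
      by (rule nn_integral_distr[OF tag_measurable[OF f]]) (simp add: F)
  qed
  finally show ?thesis .
qed

lemma distr_tagged: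
  assumes F: "F \<in> config_algebra N \<Otimes>\<^sub>M P1_borel \<rightarrow>\<^sub>M R"
  shows "distr (tagged_law N P) R F = P \<bind> (\<lambda>f. distr (PiM {..<N} (\<lambda>_. f)) R (\<lambda>Z. F (Z, f)))"
proof -
  have "distr (tagged_law N P) R F
      = P \<bind> (\<lambda>f. distr (distr (PiM {..<N} (\<lambda>_. f)) (config_algebra N \<Otimes>\<^sub>M P1_borel) (\<lambda>Z. (Z, f))) R F)"
    unfolding tagged_law_def
    by (rule distr_bind[OF measurable_prob_algebraD[OF tagged_kernel_P] prob_space.not_empty[OF P1P1D(1)[OF P]] F])
  also have "\<dots> = P \<bind> (\<lambda>f. distr (PiM {..<N} (\<lambda>_. f)) R (\<lambda>Z. F (Z, f)))"
    by (intro bind_cong refl, subst distr_distr[OF F tag_measurable]) (simp_all add: P1P1D(4)[OF P] comp_def)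
  finally show ?thesis .
qed

lemma distr_tagged_fst: "distr (tagged_law N P) (config_algebra N) fst = mixture_power N P"
  unfolding distr_tagged[OF measurable_fst] mixture_power_def fst_conv
  by (intro bind_cong refl distr_id2) (simp add: P1P1D(4)[OF P] sets_PiM_borel[OF P1D(2)])

lemma distr_tagged_snd: "distr (tagged_law N P) P1_borel snd = P"
proof -
  have "distr (tagged_law N P) P1_borel snd = P \<bind> return P1_borel"
    unfolding distr_tagged[OF measurable_snd] snd_conv
    by (intro bind_cong refl prob_space.distr_const prob_space_PiM P1D(1)) (simp_all add: P1P1D(4)[OF P])
  then show ?thesis by (simp add: bind_return''[OF P1P1D(2)[OF P]])
qed

text \<open>The empirical measure of the samples and the tag live on the same space, with laws the
  empirical law of the mixture and P. The bound is the cost of this coupling.\<close>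

lemma Dist_MK_mixture_le:
  assumes N: "1 \<le> N"
  shows "ennreal (Dist_MK (empirical_law N (mixture_power N P)) P)
    \<le> (\<integral>\<^sup>+f. \<integral>\<^sup>+Z. ennreal (dist_MK (empirical N Z) f) \<partial>PiM {..<N} (\<lambda>_. f) \<partial>P)"
proof -
  note [measurable_cong] = sets_tagged
  note [measurable] = measurable_empirical[OF N] pp.dist_measurable'
  have e1: "empirical_law N (mixture_power N P) = distr (tagged_law N P) P1_borel (\<lambda>w. empirical N (fst w))"
    unfolding empirical_law_def distr_tagged_fst[symmetric] by (subst distr_distr) (auto simp: comp_def)
  have "pp.MKe (distr (tagged_law N P) P1_borel (\<lambda>w. empirical N (fst w))) (distr (tagged_law N P) P1_borel snd)
      \<le> (\<integral>\<^sup>+w. ennreal (dist_MK (empirical N (fst w)) (snd w)) \<partial>tagged_law N P)"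
    by (rule pp.MKe_distr_le[OF prob_space_tagged]) measurable
  also have "\<dots> = (\<integral>\<^sup>+f. \<integral>\<^sup>+Z. ennreal (dist_MK (empirical N Z) f) \<partial>PiM {..<N} (\<lambda>_. f) \<partial>P)"
    by (subst nn_integral_tagged) simp_all
  finally show ?thesis
    using empirical_law_P1P1[OF N mixture_P1_sym] P by (simp add: pp.ennreal_W e1[symmetric] distr_tagged_snd)
qed

text \<open>For a fixed tag the law of large numbers applies. Dominated convergence over the tags
  uses that the mean first moment of the empirical measure is that of the tag.\<close>

theorem mixture_approximates:
  "(\<lambda>N. Dist_MK (empirical_law N (mixture_power N P)) P) \<longlonglongrightarrow> 0"
proof -
  define G where "G N f = (\<integral>\<^sup>+Z. ennreal (dist_MK (empirical N Z) f) \<partial>PiM {..<N} (\<lambda>_. f))"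
    for N and f :: "(real^'d) measure"
  note [measurable_cong] = P1P1D(2)[OF P]
  note [measurable] = pp.dist_measurable' pp.x0_measurable
  \<comment> \<open>The index is \<open>Suc N\<close> because empirical measures are probability
    measures only for at least one particle. The shift is undone at the end.\<close>
  have Gm: "G (Suc N) \<in> borel_measurable P" for N
  proof -
    have [measurable]: "empirical (Suc N) \<in> config_algebra (Suc N) \<rightarrow>\<^sub>M (P1_borel :: (real^'d) measure measure)"
      by (rule measurable_empirical) simp
    have "(\<lambda>f. \<integral>\<^sup>+Z. ennreal (dist_MK (empirical (Suc N) Z) f) \<partial>PiM {..<Suc N} (\<lambda>_. f)) \<in> borel_measurable (P1_borel :: (real^'d) measure measure)"
      by (rule nn_integral_measurable_subprob_algebra2[OF _ measurable_prob_algebraD[OF P1_borel_PiM]])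
        (simp add: case_prod_unfold)
    then show ?thesis unfolding G_def measurable_cong_sets[OF P1P1D(2)[OF P] refl] .
  qed
  have bound: "G (Suc N) f \<le> 2 * ennreal (dist_MK f (return borel 0))" if f: "f \<in> P1" for N f
  proof -
    interpret prob_space "PiM {..<Suc N} (\<lambda>_. f)" by (rule prob_space_PiM) (rule P1D(1)[OF f])
    have comp: "(\<lambda>Z. ennreal (norm (Z k))) \<in> borel_measurable (PiM {..<Suc N} (\<lambda>_. f))" if "k < Suc N" for k
    proof -
      have [measurable]: "(\<lambda>Z. Z k) \<in> PiM {..<Suc N} (\<lambda>_. f) \<rightarrow>\<^sub>M f"
        using that by (intro measurable_component_singleton) simp
      have [measurable]: "(\<lambda>x. x) \<in> f \<rightarrow>\<^sub>M borel" by (rule measurable_ident_sets) (simp add: P1D(2)[OF f])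
      show ?thesis by measurable
    qed
    have "G (Suc N) f \<le> (\<integral>\<^sup>+Z. ennreal (1 / Suc N) * (\<Sum>k<Suc N. ennreal (norm (Z k))) + ennreal (dist_MK f (return borel 0)) \<partial>PiM {..<Suc N} (\<lambda>_. f))"
      unfolding G_def
    proof (rule nn_integral_mono)
      fix Z :: "nat \<Rightarrow> real^'d"
      have "dist_MK (empirical (Suc N) Z) f \<le> dist_MK (empirical (Suc N) Z) (return borel 0) + dist_MK (return borel 0) f"
        by (intro euc.W.triangle empirical_P1 return_0_P1 f) simp
      also have "dist_MK (empirical (Suc N) Z) (return borel 0) \<le> 1 / Suc N * (\<Sum>k<Suc N. norm (Z k))"
        using dist_MK_empirical_le[of "Suc N" Z "\<lambda>_. 0"] by (simp add: empirical_zero)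
      finally have "dist_MK (empirical (Suc N) Z) f \<le> 1 / Suc N * (\<Sum>k<Suc N. norm (Z k)) + dist_MK f (return borel 0)"
        by (simp add: euc.W.commute)
      then have "ennreal (dist_MK (empirical (Suc N) Z) f) \<le> ennreal (1 / Suc N * (\<Sum>k<Suc N. norm (Z k)) + dist_MK f (return borel 0))"
        by (rule ennreal_leI)
      also have "\<dots> = ennreal (1 / Suc N) * (\<Sum>k<Suc N. ennreal (norm (Z k))) + ennreal (dist_MK f (return borel 0))"
      proof -
        have nn: "0 \<le> (\<Sum>k<Suc N. norm (Z k))" "0 \<le> 1 / real (Suc N)" by (auto intro!: sum_nonneg simp del: sum.lessThan_Suc)
        then have "0 \<le> 1 / Suc N * (\<Sum>k<Suc N. norm (Z k))" by (rule mult_nonneg_nonneg[rotated])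
        then have "ennreal (1 / Suc N * (\<Sum>k<Suc N. norm (Z k)) + dist_MK f (return borel 0))
            = ennreal (1 / Suc N * (\<Sum>k<Suc N. norm (Z k))) + ennreal (dist_MK f (return borel 0))"
          using euc.W_nonneg by (rule ennreal_plus)
        also have "ennreal (1 / Suc N * (\<Sum>k<Suc N. norm (Z k))) = ennreal (1 / Suc N) * ennreal (\<Sum>k<Suc N. norm (Z k))"
          using nn(2,1) by (rule ennreal_mult)
        also have "ennreal (\<Sum>k<Suc N. norm (Z k)) = (\<Sum>k<Suc N. ennreal (norm (Z k)))"
          by (rule sum_ennreal[symmetric]) simp
        finally show ?thesis .
      qed
      finally show "ennreal (dist_MK (empirical (Suc N) Z) f)
          \<le> ennreal (1 / Suc N) * (\<Sum>k<Suc N. ennreal (norm (Z k))) + ennreal (dist_MK f (return borel 0))" .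
    qed
    also have "\<dots> = ennreal (1 / Suc N) * (\<Sum>k<Suc N. \<integral>\<^sup>+Z. ennreal (norm (Z k)) \<partial>PiM {..<Suc N} (\<lambda>_. f)) + ennreal (dist_MK f (return borel 0))"
    proof -
      have S: "(\<lambda>Z. \<Sum>k<Suc N. ennreal (norm (Z k))) \<in> borel_measurable (PiM {..<Suc N} (\<lambda>_. f))"
        by (intro borel_measurable_sum comp) simp
      have "(\<integral>\<^sup>+Z. (\<Sum>k<Suc N. ennreal (norm (Z k))) \<partial>PiM {..<Suc N} (\<lambda>_. f)) = (\<Sum>k<Suc N. \<integral>\<^sup>+Z. ennreal (norm (Z k)) \<partial>PiM {..<Suc N} (\<lambda>_. f))"
        by (intro nn_integral_sum comp) simp
      then show ?thesis
        using S by (subst nn_integral_add) (simp_all add: nn_integral_cmult emeasure_space_1 del: sum.lessThan_Suc)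
    qed
    also have "(\<Sum>k<Suc N. \<integral>\<^sup>+Z. ennreal (norm (Z k)) \<partial>PiM {..<Suc N} (\<lambda>_. f)) = (\<Sum>k<Suc N. \<integral>\<^sup>+x. ennreal (norm x) \<partial>f)"
      using P1D(2)[OF f]
      by (intro sum.cong refl nn_integral_PiM_component[OF P1D(1)[OF f], of "\<lambda>x. ennreal (norm x)"])
          (auto cong: measurable_cong_sets)
    also have "ennreal (1 / Suc N) * (\<Sum>k<Suc N. \<integral>\<^sup>+x. ennreal (norm x) \<partial>f) = (\<integral>\<^sup>+x. ennreal (norm x) \<partial>f)"
    proof -
      have "ennreal (1 / Suc N) * of_nat (Suc N) = 1"
        unfolding ennreal_of_nat_eq_real_of_nat by (subst ennreal_mult[symmetric]) (simp_all del: of_nat_Suc)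
      then show ?thesis by (simp add: mult.assoc[symmetric] del: sum.lessThan_Suc of_nat_Suc)
    qed
    also have "(\<integral>\<^sup>+x. ennreal (norm x) \<partial>f) + ennreal (dist_MK f (return borel 0)) \<le> 2 * ennreal (dist_MK f (return borel 0))"
      unfolding mult_2 by (intro add_right_mono nn_integral_norm_P1 f)
    finally show ?thesis .
  qed
  have "(\<lambda>N. \<integral>\<^sup>+f. G (Suc N) f \<partial>P) \<longlonglongrightarrow> (\<integral>\<^sup>+f. 0 \<partial>P)"
  proof (rule nn_integral_dominated_convergence[where w="\<lambda>f. 2 * ennreal (dist_MK f (return borel 0))"])
    show "AE f in P. G (Suc N) f \<le> 2 * ennreal (dist_MK f (return borel 0))" for N
      using bound by (intro AE_I2) (simp add: P1P1D(4)[OF P])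
    show "AE f in P. (\<lambda>N. G (Suc N) f) \<longlonglongrightarrow> 0"
    proof (rule AE_I2)
      fix f assume "f \<in> space P"
      then have f: "f \<in> P1" by (simp add: P1P1D(4)[OF P])
      show "(\<lambda>N. G (Suc N) f) \<longlonglongrightarrow> 0"
        unfolding G_def by (rule LIMSEQ_Suc[OF wasserstein_law_of_large_numbers[OF f]])
    qed
    show w: "(\<lambda>f. 2 * ennreal (dist_MK f (return borel 0))) \<in> borel_measurable P" by measurable
    have "(\<integral>\<^sup>+f. 2 * ennreal (dist_MK f (return borel 0)) \<partial>P) = 2 * (\<integral>\<^sup>+f. ennreal (dist_MK f (return borel 0)) \<partial>P)"
      by (rule nn_integral_cmult) measurable
    then show "(\<integral>\<^sup>+f. 2 * ennreal (dist_MK f (return borel 0)) \<partial>P) < \<infinity>"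
      using P1P1D(3)[OF P] by (simp add: ennreal_mult_less_top)
  qed (use Gm in auto)
  then have lim: "(\<lambda>N. \<integral>\<^sup>+f. G (Suc N) f \<partial>P) \<longlonglongrightarrow> 0" by simp
  have "(\<lambda>N. ennreal (Dist_MK (empirical_law (Suc N) (mixture_power (Suc N) P)) P)) \<longlonglongrightarrow> 0"
    by (rule tendsto_sandwich[OF always_eventually always_eventually tendsto_const lim])
      (use Dist_MK_mixture_le in \<open>auto simp: G_def\<close>)
  then have "(\<lambda>N. Dist_MK (empirical_law (Suc N) (mixture_power (Suc N) P)) P) \<longlonglongrightarrow> 0"
    by (subst (asm) ennreal_tendsto_0_iff) (auto simp: pp.W_nonneg)
  then show ?thesis by (rule LIMSEQ_imp_Suc)
qed

end

context mean_field begin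

text \<open>Limits in a metric space are unique. With the mixtures as approximating sequence,
  property (a) alone determines the evolution at every time.\<close>

theorem evolution_unique:
  fixes P Q Q' :: "(real^'d) measure measure"
  assumes P: "P \<in> P1P1" and Q: "Q \<in> P1P1" "Q' \<in> P1P1"
    and lim: "(\<lambda>N. Dist_MK (empirical_law N (flow_push K N t (mixture_power N P))) Q) \<longlonglongrightarrow> 0"
      "(\<lambda>N. Dist_MK (empirical_law N (flow_push K N t (mixture_power N P))) Q') \<longlonglongrightarrow> 0"
  shows "Q = Q'"
proof -
  let ?A = "\<lambda>N. empirical_law N (flow_push K N t (mixture_power N P))"
  have A: "?A N \<in> P1P1" if "1 \<le> N" for N
    unfolding empirical_law_flow[OF that mixture_P1_sym[OF P]]
    by (intro evolve_P1P1 empirical_law_P1P1 that mixture_P1_sym P)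
  have "(\<lambda>N. Dist_MK (?A N) Q + Dist_MK (?A N) Q') \<longlonglongrightarrow> 0 + 0" by (intro tendsto_intros lim)
  moreover have "\<forall>\<^sub>F N in sequentially. Dist_MK Q Q' \<le> Dist_MK (?A N) Q + Dist_MK (?A N) Q'"
    using eventually_ge_at_top[of 1]
  proof eventually_elim
    fix N :: nat assume "1 \<le> N"
    then show "Dist_MK Q Q' \<le> Dist_MK (?A N) Q + Dist_MK (?A N) Q'"
      using pp.W.triangle[OF Q(1) A[of N] Q(2)] by (simp add: pp.W.commute)
  qed
  ultimately have "Dist_MK Q Q' \<le> 0 + 0" by (intro tendsto_lowerbound) auto
  then show ?thesis using pp.W.zero[OF Q] pp.W_nonneg[of Q Q'] by simp
qed

end

subsection \<open>Test functions along curves\<close>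

lemma fst_shift [simp]: "fst (shift v p s) = fst p + s * fst v"
  and snd_shift [simp]: "snd (shift v p s) = (\<lambda>i. snd p i + s *\<^sub>R snd v i)"
  by (simp_all add: shift_def)

lemma shift_0 [simp]: "shift v p 0 = p"
  by (simp add: prod_eq_iff)

lemma shift_shift: "shift v (shift v p r) s = shift v p (r + s)"
  by (simp add: prod_eq_iff fun_eq_iff algebra_simps)

lemma coord_dirs_undefined: "v \<in> coord_dirs m \<Longrightarrow> \<not> i < m \<Longrightarrow> snd v i = 0"
  by (auto simp: coord_dirs_def time_dir_def space_dir_def)

lemma shift_spacetime: "v \<in> coord_dirs m \<Longrightarrow> p \<in> spacetime m \<Longrightarrow> shift v p s \<in> spacetime m"
  by (auto simp: mem_Times_iff PiE_def extensional_def coord_dirs_undefined)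

lemma continuous_shift: "continuous_on UNIV (\<lambda>(p, s). shift v p s)"
  unfolding case_prod_unfold shift_def
  by (intro continuous_intros continuous_on_coordinatewise_then_product continuous_on_compose2[OF continuous_on_product_coordinates]) auto

lemma tendsto_shift:
  assumes "(q \<longlongrightarrow> p) F" "(r \<longlongrightarrow> 0) F"
  shows "((\<lambda>h. shift v (q h) (r h)) \<longlongrightarrow> p) F"
proof -
  have "isCont (\<lambda>(p, s). shift v p s) (p, 0)"
    using continuous_shift continuous_on_eq_continuous_at[OF open_UNIV] by blast
  from isCont_tendsto_compose[OF this tendsto_Pair[OF assms]] show ?thesis by simp
qed

text \<open>The definition asks for differentiability at parameter 0 only. Restarting the line at
  \<open>shift v p s\<close> gives the derivative at every parameter \<open>s\<close>, as the mean
  value theorem needs.\<close>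

lemma times_cont_diff_SucD:
  assumes "times_cont_diff m (Suc n) \<phi>"
  shows "continuous_on (spacetime m) \<phi>"
    and "v \<in> coord_dirs m \<Longrightarrow> continuous_on (spacetime m) (dir_deriv v \<phi>)"
    and "v \<in> coord_dirs m \<Longrightarrow> p \<in> spacetime m \<Longrightarrow>
      ((\<lambda>s. \<phi> (shift v p s)) has_real_derivative dir_deriv v \<phi> (shift v p s)) (at s)"
proof -
  show "continuous_on (spacetime m) \<phi>" using assms by simp
  show "continuous_on (spacetime m) (dir_deriv v \<phi>)" if "v \<in> coord_dirs m"
    using assms that by (cases n) auto
  show "((\<lambda>s. \<phi> (shift v p s)) has_real_derivative dir_deriv v \<phi> (shift v p s)) (at s)"
    if v: "v \<in> coord_dirs m" and p: "p \<in> spacetime m"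
  proof -
    have "(\<lambda>r. \<phi> (shift v (shift v p s) r)) differentiable (at 0)"
      by (rule bspec[OF conjunct1[OF bspec[OF conjunct2[OF assms[unfolded times_cont_diff.simps]] v]] shift_spacetime[OF v p]])
    then have "((\<lambda>r. \<phi> (shift v p (s + r))) has_real_derivative dir_deriv v \<phi> (shift v p s)) (at 0)"
      unfolding dir_deriv_def by (simp add: DERIV_deriv_iff_real_differentiable shift_shift)
    then show ?thesis
      using DERIV_shift[of "\<lambda>s. \<phi> (shift v p s)" _ 0 s] by (simp add: add.commute[of s])
  qed
qed

text \<open>Derivatives are computed by moving one coordinate at a time, since the configuration space is
  not an instance of a normed space.\<close>

lemma directional_chain_rule:
  fixes p :: "real \<times> (nat \<Rightarrow> real^'d)" and v :: "'j \<Rightarrow> real \<times> (nat \<Rightarrow> real^'d)"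
  assumes \<phi>: "times_cont_diff m (Suc n) \<phi>" and p: "p \<in> spacetime m" and "finite J"
    and "\<And>j. j \<in> J \<Longrightarrow> v j \<in> coord_dirs m" "\<And>j. j \<in> J \<Longrightarrow> c j 0 = 0"
      "\<And>j. j \<in> J \<Longrightarrow> (c j has_real_derivative c' j) (at 0)"
  defines "move \<equiv> \<lambda>J s. (fst p + (\<Sum>j\<in>J. c j s * fst (v j)), \<lambda>i. snd p i + (\<Sum>j\<in>J. c j s *\<^sub>R snd (v j) i))"
  shows "((\<lambda>s. \<phi> (move J s)) has_real_derivative (\<Sum>j\<in>J. c' j * dir_deriv (v j) \<phi> p)) (at 0)
    \<and> (move J \<longlongrightarrow> p) (at 0) \<and> (\<forall>s. move J s \<in> spacetime m)"
  using assms(3-6)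
proof (induction J rule: finite_induct)
  case empty
  have "move {} = (\<lambda>s. p)" by (simp add: move_def)
  then show ?case using p by simp
next
  case (insert j J)
  have vj: "v j \<in> coord_dirs m" and cj0: "c j 0 = 0" and cj: "(c j has_real_derivative c' j) (at 0)"
    using insert.prems by auto
  have IH: "((\<lambda>s. \<phi> (move J s)) has_real_derivative (\<Sum>j\<in>J. c' j * dir_deriv (v j) \<phi> p)) (at 0)"
    "(move J \<longlongrightarrow> p) (at 0)" "\<And>s. move J s \<in> spacetime m"
    using insert by auto
  \<comment> \<open>One more coordinate is one more shift, from the point already reached.\<close>
  have mv: "move (insert j J) s = shift (v j) (move J s) (c j s)" for s
    using insert.hyps by (simp add: move_def prod_eq_iff fun_eq_iff algebra_simps)
  have m0: "move J 0 = p"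
    using insert.prems by (simp add: move_def prod_eq_iff)
  have c_lim: "(c j \<longlongrightarrow> 0) (at 0)"
    using DERIV_isCont[OF cj] cj0 by (simp add: isCont_def)
  \<comment> \<open>Mean value theorem for the last shift, with the intermediate parameter no larger
    than the increment. It thus tends to 0, and continuity of the partial derivative gives the limit
    of the difference quotient.\<close>
  have "\<exists>r. \<bar>r\<bar> \<le> \<bar>c j s\<bar> \<and> \<phi> (shift (v j) (move J s) (c j s)) - \<phi> (move J s) = c j s * dir_deriv (v j) \<phi> (shift (v j) (move J s) r)" for s
  proof -
    note D = times_cont_diff_SucD(3)[OF \<phi> vj IH(3)[of s]]
    consider "c j s = 0" | "0 < c j s" | "c j s < 0" by linarith
    then show ?thesis
    proof cases
      case 1 then show ?thesis by (intro exI[of _ 0]) simp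
    next
      case 2
      obtain r where "0 < r" "r < c j s"
        "\<phi> (shift (v j) (move J s) (c j s)) - \<phi> (shift (v j) (move J s) 0) = (c j s - 0) * dir_deriv (v j) \<phi> (shift (v j) (move J s) r)"
        using MVT2[OF 2, of "\<lambda>s'. \<phi> (shift (v j) (move J s) s')", OF D] by blast
      then show ?thesis by (intro exI[of _ r]) simp
    next
      case 3
      obtain r where "c j s < r" "r < 0"
        "\<phi> (shift (v j) (move J s) 0) - \<phi> (shift (v j) (move J s) (c j s)) = (0 - c j s) * dir_deriv (v j) \<phi> (shift (v j) (move J s) r)"
        using MVT2[OF 3, of "\<lambda>s'. \<phi> (shift (v j) (move J s) s')", OF D] by blast
      then show ?thesis by (intro exI[of _ r]) (simp add: algebra_simps)
    qed
  qed
  then obtain r where r: "\<And>s. \<bar>r s\<bar> \<le> \<bar>c j s\<bar>"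
    "\<And>s. \<phi> (shift (v j) (move J s) (c j s)) - \<phi> (move J s) = c j s * dir_deriv (v j) \<phi> (shift (v j) (move J s) (r s))"
    by metis
  have r_lim: "(r \<longlongrightarrow> 0) (at 0)"
    by (rule Lim_null_comparison[OF always_eventually tendsto_rabs_zero[OF c_lim]]) (use r(1) in simp)
  have g_lim: "((\<lambda>s. dir_deriv (v j) \<phi> (shift (v j) (move J s) (r s))) \<longlongrightarrow> dir_deriv (v j) \<phi> p) (at 0)"
    by (rule continuous_on_tendsto_compose[OF times_cont_diff_SucD(2)[OF \<phi> vj] tendsto_shift[OF IH(2) r_lim] p])
      (use shift_spacetime[OF vj IH(3)] in auto)
  have q_lim: "((\<lambda>s. c j s / s) \<longlongrightarrow> c' j) (at 0)"
    using cj cj0 by (simp add: DERIV_def)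
  have J_lim: "((\<lambda>s. (\<phi> (move J s) - \<phi> p) / s) \<longlongrightarrow> (\<Sum>j\<in>J. c' j * dir_deriv (v j) \<phi> p)) (at 0)"
    using IH(1) m0 by (simp add: DERIV_def)
  have "((\<lambda>s. c j s / s * dir_deriv (v j) \<phi> (shift (v j) (move J s) (r s)) + (\<phi> (move J s) - \<phi> p) / s)
      \<longlongrightarrow> c' j * dir_deriv (v j) \<phi> p + (\<Sum>j\<in>J. c' j * dir_deriv (v j) \<phi> p)) (at 0)"
    by (intro tendsto_intros q_lim g_lim J_lim)
  also have "(\<lambda>s. c j s / s * dir_deriv (v j) \<phi> (shift (v j) (move J s) (r s)) + (\<phi> (move J s) - \<phi> p) / s)
      = (\<lambda>s. (\<phi> (move (insert j J) s) - \<phi> p) / s)"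
  proof
    fix s
    have "c j s / s * dir_deriv (v j) \<phi> (shift (v j) (move J s) (r s)) = (\<phi> (move (insert j J) s) - \<phi> (move J s)) / s"
      unfolding mv r(2) by simp
    then show "c j s / s * dir_deriv (v j) \<phi> (shift (v j) (move J s) (r s)) + (\<phi> (move J s) - \<phi> p) / s
        = (\<phi> (move (insert j J) s) - \<phi> p) / s"
      by (simp add: diff_divide_distrib)
  qed
  finally have "((\<lambda>s. \<phi> (move (insert j J) s)) has_real_derivative (\<Sum>j\<in>insert j J. c' j * dir_deriv (v j) \<phi> p)) (at 0)"
    using insert.hyps by (simp add: DERIV_def mv m0 cj0)
  moreover have "(move (insert j J) \<longlongrightarrow> p) (at 0)"
    unfolding mv by (rule tendsto_shift[OF IH(2) c_lim])
  moreover have "move (insert j J) s \<in> spacetime m" for s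
    unfolding mv by (rule shift_spacetime[OF vj IH(3)])
  ultimately show ?case by blast
qed

text \<open>The increments of the curve in the single coordinates serve as the coefficients
  \<open>c\<close> of \<open>directional_chain_rule\<close>, so that the successive moves end
  exactly on the curve.\<close>

lemma curve_chain_rule:
  fixes y :: "real \<Rightarrow> nat \<Rightarrow> real^'d"
  assumes \<phi>: "times_cont_diff m (Suc n) \<phi>" and y: "\<And>s. y s \<in> config m"
    and y': "\<And>k. k < m \<Longrightarrow> ((\<lambda>s. y s k) has_vector_derivative y' k) (at t)"
  shows "((\<lambda>s. \<phi> (s, y s)) has_real_derivative
    dir_deriv time_dir \<phi> (t, y t) + (\<Sum>k<m. y' k \<bullet> grad k \<phi> (t, y t))) (at t)"
proof -
  define S where "S = {..<m} \<times> (Basis :: (real^'d) set)"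
  \<comment> \<open>\<open>None\<close> stands for the time direction and \<open>Some (k, b)\<close>
    for component \<open>b\<close> of point \<open>k\<close>.\<close>
  define J where "J = insert None (Some ` S)"
  define v where "v j = (case j of None \<Rightarrow> time_dir | Some (k, b) \<Rightarrow> space_dir k b)" for j :: "(nat \<times> (real^'d)) option"
  define c where "c j h = (case j of None \<Rightarrow> h | Some (k, b) \<Rightarrow> (y (t + h) k - y t k) \<bullet> b)" for j h
  define c' where "c' j = (case j of None \<Rightarrow> 1 | Some (k, b) \<Rightarrow> y' k \<bullet> b)" for j
  have fS: "finite S" by (simp add: S_def)
  have sumJ: "(\<Sum>j\<in>J. F j) = F None + (\<Sum>k<m. \<Sum>b\<in>Basis. F (Some (k, b)))"
    for F :: "(nat \<times> (real^'d)) option \<Rightarrow> 'b::comm_monoid_add"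
    unfolding J_def using fS by (subst sum.insert) (auto simp: sum.reindex S_def sum.cartesian_product)
  have fJ: "finite J" using fS by (simp add: J_def)
  have p: "(t, y t) \<in> spacetime m" using y by simp
  have vJ: "v j \<in> coord_dirs m" if "j \<in> J" for j
    using that by (auto simp: J_def S_def v_def coord_dirs_def)
  have c0: "c j 0 = 0" for j by (auto simp: c_def split: option.split)
  have cd: "(c j has_real_derivative c' j) (at 0)" if j: "j \<in> J" for j
  proof (cases j)
    case None
    then show ?thesis by (simp add: c_def[abs_def] c'_def)
  next
    case (Some kb)
    then obtain k b where kb: "j = Some (k, b)" "k < m" using j by (auto simp: J_def S_def)
    have "((+) t has_vector_derivative 1) (at 0)" by (auto intro!: derivative_eq_intros)
    from vector_diff_chain_at[OF this, of "\<lambda>s. y s k" "y' k"] y'[OF kb(2)]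
    have "((\<lambda>h. y (t + h) k) has_vector_derivative y' k) (at 0)" by (simp add: comp_def)
    then have "((\<lambda>h. (y (t + h) k - y t k) \<bullet> b) has_real_derivative y' k \<bullet> b) (at 0)"
      unfolding has_real_derivative_iff_has_vector_derivative
      by (auto simp: has_vector_derivative_def intro!: derivative_eq_intros)
    then show ?thesis using kb by (simp add: c_def[abs_def] c'_def)
  qed
  have move: "(fst (t, y t) + (\<Sum>j\<in>J. c j h * fst (v j)), \<lambda>i. snd (t, y t) i + (\<Sum>j\<in>J. c j h *\<^sub>R snd (v j) i)) = (t + h, y (t + h))" for h
  proof -
    have "y t i + (\<Sum>k<m. \<Sum>b\<in>Basis. ((y (t + h) k - y t k) \<bullet> b) *\<^sub>R snd (space_dir k b) i) = y (t + h) i" for i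
    proof (cases "i < m")
      case True
      have "(\<Sum>b\<in>Basis. ((y (t + h) k - y t k) \<bullet> b) *\<^sub>R snd (space_dir k b) i) = (if k = i then y (t + h) i - y t i else 0)" for k
        using euclidean_representation[of "y (t + h) i - y t i"] by (auto simp: space_dir_def)
      then show ?thesis using True by simp
    next
      case False
      then have "y t i = undefined" "y (t + h) i = undefined"
        using y[of t] y[of "t + h"] by (auto intro: PiE_arb)
      moreover have "snd (space_dir k b) i = (0 :: real^'d)" if "k < m" for k b
        using that False by (auto simp: space_dir_def)
      ultimately show ?thesis by simp
    qed
    moreover have "(\<Sum>k<m. \<Sum>b\<in>Basis. ((y (t + h) k - y t k) \<bullet> b) * fst (space_dir k (b :: real^'d))) = 0"
      by (simp add: space_dir_def)
    ultimately show ?thesis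
      by (simp add: sumJ c_def v_def time_dir_def)
  qed
  have "((\<lambda>h. \<phi> (t + h, y (t + h))) has_real_derivative (\<Sum>j\<in>J. c' j * dir_deriv (v j) \<phi> (t, y t))) (at 0)"
    by (rule directional_chain_rule[where v = v and c = c and c' = c', OF \<phi> p fJ, unfolded move, THEN conjunct1])
      (simp_all add: vJ c0 cd)
  also have "(\<Sum>j\<in>J. c' j * dir_deriv (v j) \<phi> (t, y t)) = dir_deriv time_dir \<phi> (t, y t) + (\<Sum>k<m. y' k \<bullet> grad k \<phi> (t, y t))"
    by (simp add: sumJ c'_def v_def grad_def inner_sum_right mult.commute)
  finally show ?thesis
    using DERIV_shift[of "\<lambda>s. \<phi> (s, y s)" _ 0 t] by (simp add: add.commute[of t])
qed

lemma test_function_dir_deriv: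
  fixes \<phi> :: "real \<times> (nat \<Rightarrow> real^'d) \<Rightarrow> real"
  assumes \<phi>: "\<phi> \<in> test_functions m"
  obtains R where "\<And>p. p \<in> spacetime m \<Longrightarrow> R < \<bar>fst p\<bar> \<Longrightarrow> \<phi> p = 0"
    "\<And>p v. v \<in> coord_dirs m \<Longrightarrow> p \<in> spacetime m \<Longrightarrow> R < \<bar>fst p\<bar> \<Longrightarrow> dir_deriv v \<phi> p = 0"
    "\<And>v. v \<in> coord_dirs m \<Longrightarrow> \<exists>B. \<forall>p\<in>spacetime m. \<bar>dir_deriv v \<phi> p\<bar> \<le> B"
proof -
  obtain C where C: "C \<subseteq> spacetime m" "compact C" "\<And>p. p \<in> spacetime m \<Longrightarrow> p \<notin> C \<Longrightarrow> \<phi> p = 0"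
    and tcd: "times_cont_diff m (Suc 0) \<phi>"
    using \<phi> unfolding test_functions_def by blast
  have dd0: "dir_deriv v \<phi> p = 0" if v: "v \<in> coord_dirs m" and p: "p \<in> spacetime m" "p \<notin> C" for v p
  proof -
    \<comment> \<open>Off the closed set \<open>C\<close> a short line in any direction stays off
      \<open>C\<close>, so the function vanishes along it and the derivative is 0.\<close>
    have "open (- C)" using compact_imp_closed[OF C(2)] by auto
    moreover have "((\<lambda>s. shift v p s) \<longlongrightarrow> p) (nhds 0)"
      using tendsto_shift[of "\<lambda>_. p" p "nhds 0" "\<lambda>s. s" v] by (simp add: filterlim_ident)
    ultimately have "\<forall>\<^sub>F s in nhds 0. shift v p s \<in> - C"
      using p(2) by (auto simp: tendsto_def)
    then have "\<forall>\<^sub>F s in nhds 0. \<phi> (shift v p s) = 0"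
      by eventually_elim (use C(3) shift_spacetime[OF v p(1)] in auto)
    then have "deriv (\<lambda>s. \<phi> (shift v p s)) 0 = deriv (\<lambda>s. 0) (0::real)"
      by (intro deriv_cong_ev) auto
    then show ?thesis by (simp add: dir_deriv_def)
  qed
  have "compact (fst ` C)" by (intro compact_continuous_image C(2) continuous_on_fst continuous_on_id)
  then obtain R where R: "\<And>p. p \<in> C \<Longrightarrow> \<bar>fst p\<bar> \<le> R"
    using compact_imp_bounded[of "fst ` C"] by (auto simp: bounded_iff)
  show thesis
  proof (rule that[of R])
    show "\<phi> p = 0" if "p \<in> spacetime m" "R < \<bar>fst p\<bar>" for p
      using C(3)[OF that(1)] R[of p] that(2) by auto
    show "dir_deriv v \<phi> p = 0" if "v \<in> coord_dirs m" "p \<in> spacetime m" "R < \<bar>fst p\<bar>" for v p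
      using dd0[OF that(1,2)] R[of p] that(3) by auto
    show "\<exists>B. \<forall>p\<in>spacetime m. \<bar>dir_deriv v \<phi> p\<bar> \<le> B" if v: "v \<in> coord_dirs m" for v
    proof -
      have "compact (dir_deriv v \<phi> ` C)"
        by (intro compact_continuous_image C(2) continuous_on_subset[OF times_cont_diff_SucD(2)[OF tcd v] C(1)])
      then obtain B where B: "\<And>p. p \<in> C \<Longrightarrow> \<bar>dir_deriv v \<phi> p\<bar> \<le> B"
        using compact_imp_bounded[of "dir_deriv v \<phi> ` C"] by (auto simp: bounded_iff)
      have "\<bar>dir_deriv v \<phi> p\<bar> \<le> max B 0" if "p \<in> spacetime m" for p
        using B[of p] dd0[OF v that] by (cases "p \<in> C") auto
      then show ?thesis by blast
    qed
  qed
qed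

text \<open>Continuity is known only on \<open>spacetime m\<close>. Composition with the retraction
  \<open>r\<close>, which resets the coordinates from \<open>m\<close> on to
  \<open>undefined\<close>, yields a function continuous everywhere with the same values on
  configurations.\<close>

lemma measurable_on_spacetime:
  fixes \<psi> :: "real \<times> (nat \<Rightarrow> real^'d) \<Rightarrow> real"
  assumes \<psi>: "continuous_on (spacetime m) \<psi>"
    and [measurable]: "g \<in> borel_measurable M" and Y: "Y \<in> M \<rightarrow>\<^sub>M config_algebra m"
  shows "(\<lambda>x. \<psi> (g x, Y x)) \<in> borel_measurable M"
proof -
  define r where "r p = (fst p, \<lambda>i. if i < m then snd p i else undefined)" for p :: "real \<times> (nat \<Rightarrow> real^'d)"
  have "continuous_on UNIV (\<lambda>p :: real \<times> (nat \<Rightarrow> real^'d). if i < m then snd p i else undefined)" for i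
  proof (cases "i < m")
    case True
    have "continuous_on UNIV (\<lambda>p :: real \<times> (nat \<Rightarrow> real^'d). snd p i)"
      by (rule continuous_on_compose2[of UNIV "\<lambda>f. f i" UNIV snd])
        (simp_all add: continuous_on_product_coordinates continuous_on_snd)
    then show ?thesis using True by simp
  qed simp
  then have "continuous_on UNIV r" unfolding r_def
    by (intro continuous_on_Pair continuous_intros continuous_on_coordinatewise_then_product) auto
  then have "continuous_on UNIV (\<lambda>p. \<psi> (r p))"
    by (rule continuous_on_compose2[OF \<psi>]) (auto simp: r_def split: if_splits)
  then have *: "(\<lambda>p. \<psi> (r p)) \<in> borel_measurable (borel \<Otimes>\<^sub>M borel)"
    unfolding borel_prod by (rule borel_measurable_continuous_onI)
  have "Y \<in> M \<rightarrow>\<^sub>M borel" using measurable_compose[OF Y measurable_config_borel] by simp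
  then have "(\<lambda>x. \<psi> (r (g x, Y x))) \<in> borel_measurable M"
    by (intro measurable_compose[OF _ *] measurable_Pair) auto
  also have "?this \<longleftrightarrow> ?thesis"
  proof (rule measurable_cong)
    fix x assume "x \<in> space M"
    then have "Y x \<in> config m" using measurable_space[OF Y] by (auto simp: space_PiM)
    then have "r (g x, Y x) = (g x, Y x)" by (auto simp: r_def fun_eq_iff intro: PiE_arb[symmetric])
    then show "\<psi> (r (g x, Y x)) = \<psi> (g x, Y x)" by simp
  qed
  finally show ?thesis .
qed

subsection \<open>The infinite hierarchy\<close>

text \<open>Integration against a mixture for integrable functions that may be unbounded, as the
  interaction term of the hierarchy is. Positive and negative parts are treated separately by the
  rule for nonnegative functions, and both are finite for almost every kernel value.\<close>

lemma integral_bind_real: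
  fixes F :: "'b \<Rightarrow> real"
  assumes N: "N \<in> M \<rightarrow>\<^sub>M subprob_algebra B" and ne: "space M \<noteq> {}" and F: "integrable (M \<bind> N) F"
  shows "integrable M (\<lambda>x. \<integral>y. F y \<partial>N x)"
    and "(\<integral>y. F y \<partial>(M \<bind> N)) = (\<integral>x. \<integral>y. F y \<partial>N x \<partial>M)"
proof -
  have sB: "sets (M \<bind> N) = sets B" by (rule sets_bind[OF sets_kernel[OF N] ne])
  have Fm[measurable]: "F \<in> borel_measurable B"
    using borel_measurable_integrable[OF F] unfolding measurable_cong_sets[OF sB refl] .
  have key: "integrable M (\<lambda>x. enn2real (\<integral>\<^sup>+y. ennreal (G y) \<partial>N x))"
    "(\<integral>x. enn2real (\<integral>\<^sup>+y. ennreal (G y) \<partial>N x) \<partial>M) = enn2real (\<integral>\<^sup>+y. ennreal (G y) \<partial>(M \<bind> N))"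
    "AE x in M. (\<integral>\<^sup>+y. ennreal (G y) \<partial>N x) < \<infinity>"
    if G: "integrable (M \<bind> N) G" for G
  proof -
    have Gm[measurable]: "G \<in> borel_measurable B"
      using borel_measurable_integrable[OF G] unfolding measurable_cong_sets[OF sB refl] .
    have eq: "(\<integral>\<^sup>+y. ennreal (G y) \<partial>(M \<bind> N)) = (\<integral>\<^sup>+x. \<integral>\<^sup>+y. ennreal (G y) \<partial>N x \<partial>M)"
      by (rule nn_integral_bind[OF _ N]) measurable
    have fin: "(\<integral>\<^sup>+x. \<integral>\<^sup>+y. ennreal (G y) \<partial>N x \<partial>M) < \<infinity>"
    proof -
      have "(\<integral>\<^sup>+y. ennreal (G y) \<partial>(M \<bind> N)) \<le> (\<integral>\<^sup>+y. ennreal (norm (G y)) \<partial>(M \<bind> N))"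
        by (intro nn_integral_mono ennreal_leI) simp
      also have "\<dots> < \<infinity>" using G by (simp add: integrable_iff_bounded)
      finally show ?thesis unfolding eq .
    qed
    have m[measurable]: "(\<lambda>x. \<integral>\<^sup>+y. ennreal (G y) \<partial>N x) \<in> borel_measurable M"
      by (rule measurable_compose[OF N nn_integral_measurable_subprob_algebra]) measurable
    show ae: "AE x in M. (\<integral>\<^sup>+y. ennreal (G y) \<partial>N x) < \<infinity>"
      using nn_integral_PInf_AE[OF m] fin by (auto simp: less_top)
    have e: "(\<integral>\<^sup>+x. ennreal (enn2real (\<integral>\<^sup>+y. ennreal (G y) \<partial>N x)) \<partial>M) = (\<integral>\<^sup>+x. \<integral>\<^sup>+y. ennreal (G y) \<partial>N x \<partial>M)"
      using ae by (intro nn_integral_cong_AE) (auto simp: less_top)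
    show "integrable M (\<lambda>x. enn2real (\<integral>\<^sup>+y. ennreal (G y) \<partial>N x))"
      using fin by (intro integrableI_nonneg) (auto simp: e)
    show "(\<integral>x. enn2real (\<integral>\<^sup>+y. ennreal (G y) \<partial>N x) \<partial>M) = enn2real (\<integral>\<^sup>+y. ennreal (G y) \<partial>(M \<bind> N))"
      unfolding eq e[symmetric] by (rule integral_eq_nn_integral) auto
  qed
  note k1 = key[OF F] and k2 = key[OF Bochner_Integration.integrable_minus[OF F]]
  have ae: "AE x in M. (\<integral>y. F y \<partial>N x) = enn2real (\<integral>\<^sup>+y. ennreal (F y) \<partial>N x) - enn2real (\<integral>\<^sup>+y. ennreal (- F y) \<partial>N x)"
    using k1(3) k2(3) AE_space
  proof eventually_elim
    fix x assume x: "(\<integral>\<^sup>+y. ennreal (F y) \<partial>N x) < \<infinity>" "(\<integral>\<^sup>+y. ennreal (- F y) \<partial>N x) < \<infinity>" "x \<in> space M"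
    have [measurable]: "F \<in> borel_measurable (N x)"
      using Fm unfolding measurable_cong_sets[OF sets_kernel[OF N x(3)] refl] .
    have "integrable (N x) F"
      using x by (subst real_integrable_def) auto
    then show "(\<integral>y. F y \<partial>N x) = enn2real (\<integral>\<^sup>+y. ennreal (F y) \<partial>N x) - enn2real (\<integral>\<^sup>+y. ennreal (- F y) \<partial>N x)"
      by (rule real_lebesgue_integral_def)
  qed
  have m: "(\<lambda>x. \<integral>y. F y \<partial>N x) \<in> borel_measurable M"
    by (rule measurable_compose[OF N integral_measurable_subprob_algebra[OF Fm]])
  have i: "integrable M (\<lambda>x. enn2real (\<integral>\<^sup>+y. ennreal (F y) \<partial>N x) - enn2real (\<integral>\<^sup>+y. ennreal (- F y) \<partial>N x))"
    by (intro Bochner_Integration.integrable_diff k1 k2)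
  show "integrable M (\<lambda>x. \<integral>y. F y \<partial>N x)"
    using integrable_cong_AE[OF m borel_measurable_integrable[OF i] ae] i by simp
  have "(\<integral>x. \<integral>y. F y \<partial>N x \<partial>M) = (\<integral>x. enn2real (\<integral>\<^sup>+y. ennreal (F y) \<partial>N x) - enn2real (\<integral>\<^sup>+y. ennreal (- F y) \<partial>N x) \<partial>M)"
    by (rule integral_cong_AE[OF m borel_measurable_integrable[OF i] ae])
  also have "\<dots> = (\<integral>y. F y \<partial>(M \<bind> N))"
    using k1 k2 by (simp add: real_lebesgue_integral_def[OF F])
  finally show "(\<integral>y. F y \<partial>(M \<bind> N)) = (\<integral>x. \<integral>y. F y \<partial>N x \<partial>M)" by simp
qed

text \<open>The hierarchy tested against a function, in abstract form. By Fubini the sum is the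
  expectation of the time integral of the derivative of \<Psi>, which vanishes because \<Psi> has
  compact support in time.\<close>

lemma time_integral_expectation_eq_0:
  fixes T :: "'j \<Rightarrow> real \<Rightarrow> 'w \<Rightarrow> real" and W :: "'w \<Rightarrow> real"
  assumes "prob_space M" and "finite J"
    and Tm: "\<And>j. j \<in> J \<Longrightarrow> (\<lambda>(t, \<omega>). T j t \<omega>) \<in> borel_measurable (borel \<Otimes>\<^sub>M M)"
    and W: "integrable M W"
    and bound: "\<And>j t \<omega>. j \<in> J \<Longrightarrow> \<omega> \<in> space M \<Longrightarrow> \<bar>T j t \<omega>\<bar> \<le> indicator {-R..R} t * W \<omega>"
    and deriv: "\<And>t \<omega>. \<omega> \<in> space M \<Longrightarrow> (\<Psi> \<omega> has_real_derivative (\<Sum>j\<in>J. T j t \<omega>)) (at t)"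
    and supp: "\<And>t \<omega>. \<omega> \<in> space M \<Longrightarrow> R < \<bar>t\<bar> \<Longrightarrow> \<Psi> \<omega> t = 0" and R: "0 \<le> R"
  shows "\<And>j. j \<in> J \<Longrightarrow> integrable lborel (\<lambda>t. \<integral>\<omega>. T j t \<omega> \<partial>M)"
    and "(\<Sum>j\<in>J. \<integral>t. (\<integral>\<omega>. T j t \<omega> \<partial>M) \<partial>lborel) = 0"
proof -
  interpret M: prob_space M by fact
  interpret L: pair_sigma_finite lborel M ..
  have Tm': "(\<lambda>(t, \<omega>). T j t \<omega>) \<in> borel_measurable (lborel \<Otimes>\<^sub>M M)" if "j \<in> J" for j
    using Tm[OF that] by simp
  have dom: "integrable (lborel \<Otimes>\<^sub>M M) (\<lambda>(t, \<omega>). indicator {-R..R} t * W \<omega>)"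
  proof (rule L.Fubini_integrable)
    show "(\<lambda>(t, \<omega>). indicator {-R..R} t * W \<omega>) \<in> borel_measurable (lborel \<Otimes>\<^sub>M M)"
      using borel_measurable_integrable[OF W] by measurable
    show "AE t in lborel. integrable M (\<lambda>\<omega>. case (t, \<omega>) of (t, \<omega>) \<Rightarrow> indicator {-R..R} t * W \<omega>)"
      using W by simp
    have "integrable lborel (\<lambda>t. indicator {-R..R} t * (\<integral>\<omega>. \<bar>W \<omega>\<bar> \<partial>M))"
      by (intro integrable_mult_left integrable_real_indicator) (auto simp: emeasure_lborel_Icc_eq)
    then show "integrable lborel (\<lambda>t. \<integral>\<omega>. norm (case (t, \<omega>) of (t, \<omega>) \<Rightarrow> indicator {-R..R} t * W \<omega>) \<partial>M)"
      by (simp add: abs_mult)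
  qed
  have TI: "integrable (lborel \<Otimes>\<^sub>M M) (\<lambda>(t, \<omega>). T j t \<omega>)" if j: "j \<in> J" for j
  proof (rule Bochner_Integration.integrable_bound[OF dom Tm'[OF j]], rule AE_I2)
    fix p :: "real \<times> 'w" assume "p \<in> space (lborel \<Otimes>\<^sub>M M)"
    then have "snd p \<in> space M" by (auto simp: space_pair_measure)
    then show "norm (case p of (t, \<omega>) \<Rightarrow> T j t \<omega>) \<le> norm (case p of (t, \<omega>) \<Rightarrow> indicator {-R..R} t * W \<omega>)"
      using bound[OF j, of "snd p" "fst p"] by (auto simp: case_prod_unfold intro: order_trans)
  qed
  show "integrable lborel (\<lambda>t. \<integral>\<omega>. T j t \<omega> \<partial>M)" if "j \<in> J" for j
    using L.integrable_fst'[OF TI[OF that]] by simp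
  have SI: "integrable (lborel \<Otimes>\<^sub>M M) (\<lambda>(t, \<omega>). \<Sum>j\<in>J. T j t \<omega>)"
    using Bochner_Integration.integrable_sum[OF TI, of J] by (simp add: case_prod_unfold)
  have "(\<Sum>j\<in>J. \<integral>t. (\<integral>\<omega>. T j t \<omega> \<partial>M) \<partial>lborel) = (\<Sum>j\<in>J. \<integral>p. (case p of (t, \<omega>) \<Rightarrow> T j t \<omega>) \<partial>(lborel \<Otimes>\<^sub>M M))"
    by (intro sum.cong refl) (use L.integral_fst'[OF TI] in auto)
  also have "\<dots> = (\<integral>p. (\<Sum>j\<in>J. case p of (t, \<omega>) \<Rightarrow> T j t \<omega>) \<partial>(lborel \<Otimes>\<^sub>M M))"
    by (rule Bochner_Integration.integral_sum[symmetric]) (rule TI)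
  also have "\<dots> = (\<integral>p. (case p of (t, \<omega>) \<Rightarrow> \<Sum>j\<in>J. T j t \<omega>) \<partial>(lborel \<Otimes>\<^sub>M M))"
    by (simp add: case_prod_unfold)
  also have "\<dots> = (\<integral>\<omega>. (\<integral>t. (\<Sum>j\<in>J. T j t \<omega>) \<partial>lborel) \<partial>M)"
    using L.integral_snd[OF SI] by simp
  also have "\<dots> = 0"
  proof (rule integral_eq_zero_AE)
    have "AE \<omega> in M. integrable lborel (\<lambda>t. \<Sum>j\<in>J. T j t \<omega>)"
      using L.AE_integrable_snd[OF SI] by simp
    then show "AE \<omega> in M. (\<integral>t. (\<Sum>j\<in>J. T j t \<omega>) \<partial>lborel) = 0"
      using AE_space
    proof eventually_elim
      fix \<omega> assume i: "integrable lborel (\<lambda>t. \<Sum>j\<in>J. T j t \<omega>)" and \<omega>: "\<omega> \<in> space M"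
      let ?D = "\<lambda>t. \<Sum>j\<in>J. T j t \<omega>"
      \<comment> \<open>The end points lie beyond \<open>R\<close> because \<Psi> is known to vanish
        only where |t| exceeds \<open>R\<close> strictly.\<close>
      have "(?D has_integral (\<Psi> \<omega> (R + 1) - \<Psi> \<omega> (- R - 1))) {- R - 1..R + 1}"
        using R deriv[OF \<omega>]
        by (intro fundamental_theorem_of_calculus)
          (auto simp: has_real_derivative_iff_has_vector_derivative[symmetric] intro: has_field_derivative_at_within)
      then have "(?D has_integral 0) {- R - 1..R + 1}"
        using supp[OF \<omega>, of "R + 1"] supp[OF \<omega>, of "- R - 1"] R by simp
      then have "(?D has_integral 0) UNIV"
      proof (rule has_integral_on_superset)
        fix t :: real assume "t \<notin> {- R - 1..R + 1}"
        then have "t \<notin> {- R..R}" by auto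
        then have "T j t \<omega> = 0" if "j \<in> J" for j using bound[OF that \<omega>, of t] by simp
        then show "?D t = 0" by simp
      qed auto
      moreover have "(?D has_integral (\<integral>t. ?D t \<partial>lborel)) UNIV"
        by (rule has_integral_integral_lborel[OF i])
      ultimately show "(\<integral>t. ?D t \<partial>lborel) = 0" by (rule has_integral_unique[symmetric])
    qed
  qed
  finally show "(\<Sum>j\<in>J. \<integral>t. (\<integral>\<omega>. T j t \<omega> \<partial>M) \<partial>lborel) = 0" .
qed

context mean_field begin

text \<open>The flow is continuous in the measure, so it is a limit of functions that depend on the
  measure only through its nearest point in a countable dense set.\<close>

lemma flow_measurable_joint:
  "(\<lambda>(f, p). flow f (fst p) (snd p)) \<in> borel_measurable (P1_borel \<Otimes>\<^sub>M (borel \<Otimes>\<^sub>M borel))"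
proof -
  obtain D :: "(real^'d) measure set" where D: "countable D" "D \<subseteq> P1" "\<And>f e. f \<in> P1 \<Longrightarrow> 0 < e \<Longrightarrow> \<exists>a\<in>D. dist_MK f a < e"
    using pp.separable by metis
  have "D \<noteq> {}" using D(3)[OF return_0_P1, of 1] by auto
  define a where "a = from_nat_into D"
  have aP: "a i \<in> P1" for i using from_nat_into[OF \<open>D \<noteq> {}\<close>] D(2) a_def by blast
  define idx where "idx n f = (LEAST i. dist_MK f (a i) < 1 / real (Suc n))" for n f
  have idx: "dist_MK f (a (idx n f)) < 1 / real (Suc n)" if f: "f \<in> P1" for n f
  proof -
    obtain b where "b \<in> D" "dist_MK f b < 1 / real (Suc n)" using D(3)[OF f, of "1 / real (Suc n)"] by auto
    then have "\<exists>i. dist_MK f (a i) < 1 / real (Suc n)" unfolding a_def using from_nat_into_surj[OF D(1)] by metis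
    then show ?thesis unfolding idx_def by (rule LeastI_ex)
  qed
  note [measurable] = pp.dist_measurable'
  have aB: "(\<lambda>_. a i) \<in> P1_borel \<rightarrow>\<^sub>M P1_borel" for i using aP by (intro measurable_const) simp
  have idx_m: "idx n \<in> P1_borel \<rightarrow>\<^sub>M count_space UNIV" for n
    unfolding idx_def using aB by measurable
  have fl: "(\<lambda>x. flow (a i) (fst (snd x)) (snd (snd x))) \<in> borel_measurable ((P1_borel :: (real^'d) measure measure) \<Otimes>\<^sub>M (borel \<Otimes>\<^sub>M borel))" for i
  proof -
    have "(\<lambda>p. flow (a i) (fst p) (snd p)) \<in> borel_measurable (borel \<Otimes>\<^sub>M borel)"
      unfolding borel_prod using flow_continuous[OF aP[of i]] by (intro borel_measurable_continuous_onI) (simp add: case_prod_unfold)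
    from measurable_compose[OF measurable_snd this] show ?thesis .
  qed
  show ?thesis unfolding case_prod_unfold
  proof (rule borel_measurable_LIMSEQ_metric)
    show "(\<lambda>x. flow (a (idx n (fst x))) (fst (snd x)) (snd (snd x))) \<in> borel_measurable (P1_borel \<Otimes>\<^sub>M (borel \<Otimes>\<^sub>M borel))" for n
      by (rule measurable_compose_countable[OF fl measurable_compose[OF measurable_fst idx_m]])
    fix x :: "(real^'d) measure \<times> real \<times> (real^'d)" assume "x \<in> space (P1_borel \<Otimes>\<^sub>M (borel \<Otimes>\<^sub>M borel))"
    then have f: "fst x \<in> P1" by (auto simp: space_pair_measure)
    define c where "c = exp (2 * L * \<bar>fst (snd x)\<bar>)"
    have "(\<lambda>n. c * (1 / real (Suc n))) \<longlonglongrightarrow> c * 0"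
      by (intro tendsto_intros LIMSEQ_Suc lim_1_over_n)
    then have lim: "(\<lambda>n. c * (1 / real (Suc n))) \<longlonglongrightarrow> 0" by simp
    have "(\<lambda>n. dist (flow (a (idx n (fst x))) (fst (snd x)) (snd (snd x))) (flow (fst x) (fst (snd x)) (snd (snd x)))) \<longlonglongrightarrow> 0"
    proof (rule tendsto_sandwich[OF always_eventually always_eventually tendsto_const lim])
      show "\<forall>n. dist (flow (a (idx n (fst x))) (fst (snd x)) (snd (snd x))) (flow (fst x) (fst (snd x)) (snd (snd x))) \<le> c * (1 / real (Suc n))"
      proof
        fix n
        have "dist (flow (fst x) (fst (snd x)) (snd (snd x))) (flow (a (idx n (fst x))) (fst (snd x)) (snd (snd x))) \<le> c * dist_MK (fst x) (a (idx n (fst x)))"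
          unfolding c_def by (rule flow_measure_lipschitz[OF f aP])
        also have "\<dots> \<le> c * (1 / real (Suc n))"
          using idx[OF f, of n] by (intro mult_left_mono) (auto simp: c_def)
        finally show "dist (flow (a (idx n (fst x))) (fst (snd x)) (snd (snd x))) (flow (fst x) (fst (snd x)) (snd (snd x))) \<le> c * (1 / real (Suc n))"
          by (simp add: dist_commute)
      qed
    qed auto
    then show "(\<lambda>n. flow (a (idx n (fst x))) (fst (snd x)) (snd (snd x))) \<longlonglongrightarrow> flow (fst x) (fst (snd x)) (snd (snd x))"
      by (rule tendsto_dist_iff[THEN iffD2])
  qed
qed

lemma flow_measurable_comp:
  assumes "g \<in> M \<rightarrow>\<^sub>M P1_borel" "\<tau> \<in> borel_measurable M" "\<zeta> \<in> borel_measurable M"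
  shows "(\<lambda>x. flow (g x) (\<tau> x) (\<zeta> x)) \<in> borel_measurable M"
  using measurable_compose[OF measurable_Pair[OF assms(1) measurable_Pair[OF assms(2,3)]] flow_measurable_joint] by simp

definition velocity :: "(real^'d) measure \<Rightarrow> real \<Rightarrow> real^'d \<Rightarrow> real^'d" where
  "velocity f t z = (\<integral>x. K (flow f t z) (flow f t x) \<partial>f)"

lemma flow_has_velocity:
  assumes "f \<in> P1"
  shows "((\<lambda>s. flow f s z) has_vector_derivative velocity f t z) (at t)"
  using mf_solution_deriv[OF flow(1)[OF assms], of z t] P1D(4)[OF assms] by (simp add: velocity_def)

text \<open>The velocity is an integral over the varying measure itself. Writing it as the limit of
  difference quotients of the flow in time reduces its measurability to that of the flow.\<close>

lemma velocity_measurable_comp: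
  assumes g: "g \<in> M \<rightarrow>\<^sub>M P1_borel" and [measurable]: "\<tau> \<in> borel_measurable M" "\<zeta> \<in> borel_measurable M"
  shows "(\<lambda>x. velocity (g x) (\<tau> x) (\<zeta> x)) \<in> borel_measurable M"
proof (subst borel_measurable_euclidean_space, rule ballI)
  fix b :: "real^'d" assume "b \<in> Basis"
  define h where "h n = inverse (real (Suc n))" for n
  have h0: "h \<longlonglongrightarrow> 0" unfolding h_def by (rule LIMSEQ_inverse_real_of_nat)
  have hn: "h n \<noteq> 0" for n by (simp add: h_def)
  have h_at: "filterlim h (at 0) sequentially"
    using h0 hn by (simp add: filterlim_at)
  show "(\<lambda>x. velocity (g x) (\<tau> x) (\<zeta> x) \<bullet> b) \<in> borel_measurable M"
  proof (rule borel_measurable_LIMSEQ_metric)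
    note [measurable] = flow_measurable_comp[OF g]
    show "(\<lambda>x. (flow (g x) (\<tau> x + h n) (\<zeta> x) \<bullet> b - flow (g x) (\<tau> x) (\<zeta> x) \<bullet> b) / h n) \<in> borel_measurable M" for n
      by measurable
    fix x assume "x \<in> space M"
    then have f: "g x \<in> P1" using measurable_space[OF g] by simp
    have "((\<lambda>s. flow (g x) s (\<zeta> x) \<bullet> b) has_real_derivative velocity (g x) (\<tau> x) (\<zeta> x) \<bullet> b) (at (\<tau> x))"
      using flow_has_velocity[OF f, of "\<zeta> x" "\<tau> x"] unfolding has_real_derivative_iff_has_vector_derivative
      by (auto simp: has_vector_derivative_def intro!: derivative_eq_intros)
    then have "((\<lambda>h. (flow (g x) (\<tau> x + h) (\<zeta> x) \<bullet> b - flow (g x) (\<tau> x) (\<zeta> x) \<bullet> b) / h) \<longlongrightarrow> velocity (g x) (\<tau> x) (\<zeta> x) \<bullet> b) (at 0)"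
      by (simp add: DERIV_def)
    from filterlim_compose[OF this h_at]
    show "(\<lambda>n. (flow (g x) (\<tau> x + h n) (\<zeta> x) \<bullet> b - flow (g x) (\<tau> x) (\<zeta> x) \<bullet> b) / h n) \<longlonglongrightarrow> velocity (g x) (\<tau> x) (\<zeta> x) \<bullet> b" .
  qed
qed

definition flow_config :: "nat \<Rightarrow> real \<Rightarrow> (nat \<Rightarrow> real^'d) \<times> (real^'d) measure \<Rightarrow> (nat \<Rightarrow> real^'d)" where
  "flow_config m t w = (\<lambda>k\<in>{..<m}. flow (snd w) t (fst w k))"

lemma flow_config_measurable:
  assumes \<tau>: "\<tau> \<in> borel_measurable M" and X: "X \<in> M \<rightarrow>\<^sub>M config_algebra m \<Otimes>\<^sub>M P1_borel"
  shows "(\<lambda>x. flow_config m (\<tau> x) (X x)) \<in> M \<rightarrow>\<^sub>M config_algebra m"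
  unfolding flow_config_def
proof (rule measurable_restrict)
  fix k assume k: "k \<in> {..<m}"
  show "(\<lambda>x. flow (snd (X x)) (\<tau> x) (fst (X x) k)) \<in> borel_measurable M"
    using k by (intro flow_measurable_comp \<tau> measurable_compose[OF X measurable_snd]
        measurable_compose[OF measurable_compose[OF X measurable_fst] measurable_component_singleton])
qed

text \<open>A product of push-forwards is the push-forward of the product under the same map in each
  coordinate. So the time dependence passes from the law to a random variable on the fixed space
  \<open>tagged_law m P\<close>, where it can be differentiated.\<close>

lemma mixture_evolve:
  assumes P: "P \<in> P1P1"
  shows "mixture_power m (evolve t P) = distr (tagged_law m P) (config_algebra m) (flow_config m t)"
proof -
  have fm: "flow_config m t \<in> config_algebra m \<Otimes>\<^sub>M P1_borel \<rightarrow>\<^sub>M config_algebra m"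
    using flow_config_measurable[of "\<lambda>_. t" _ "\<lambda>x. x" m] by simp
  have pm: "push t \<in> P \<rightarrow>\<^sub>M P1_borel"
    using push_measurable unfolding measurable_cong_sets[OF P1P1D(2)[OF P] refl] .
  have "mixture_power m (evolve t P) = P \<bind> (\<lambda>f. PiM {..<m} (\<lambda>_. push t f))"
    unfolding mixture_power_def evolve_def
    by (rule bind_distr[OF pm measurable_prob_algebraD[OF P1_borel_PiM] prob_space.not_empty[OF P1P1D(1)[OF P]]])
  also have "\<dots> = P \<bind> (\<lambda>f. distr (PiM {..<m} (\<lambda>_. f)) (config_algebra m) (\<lambda>Z. flow_config m t (Z, f)))"
  proof (rule bind_cong[OF refl])
    fix f assume "f \<in> space P"
    then have f: "f \<in> P1" by (simp add: P1P1D(4)[OF P])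
    interpret prob_space f by (rule P1D(1)[OF f])
    note p = push_P1[OF f, of t]
    have ff: "flow f t \<in> f \<rightarrow>\<^sub>M push t f"
      using flow_measurable[OF f] unfolding measurable_cong_sets[OF P1D(2)[OF f] P1D(2)[OF p]] .
    have "distr (PiM {..<m} (\<lambda>_. f)) (config_algebra m) (\<lambda>Z. flow_config m t (Z, f))
        = distr (PiM {..<m} (\<lambda>_. f)) (PiM {..<m} (\<lambda>_. push t f)) (compose {..<m} (flow f t))"
      by (rule distr_cong) (auto simp: flow_config_def compose_def sets_PiM_borel[OF P1D(2)[OF p]])
    also have "\<dots> = PiM {..<m} (\<lambda>_. distr f (push t f) (flow f t))"
      by (rule distr_PiM_finite_prob_space'[OF _ _ _ ff]) (auto simp: prob_space_axioms P1D(1)[OF p])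
    also have "distr f (push t f) (flow f t) = push t f"
      unfolding push_def by (rule distr_cong) auto
    finally show "PiM {..<m} (\<lambda>_. push t f) = distr (PiM {..<m} (\<lambda>_. f)) (config_algebra m) (\<lambda>Z. flow_config m t (Z, f))"
      by simp
  qed
  also have "\<dots> = distr (tagged_law m P) (config_algebra m) (flow_config m t)"
    by (rule distr_tagged[OF P fm, symmetric])
  finally show ?thesis .
qed

end

section \<open>One more conditionally independent sample, and integrable majorants\<close>

definition tag_extend ::
    "nat \<Rightarrow> (nat \<Rightarrow> real^'d) \<times> (real^'d) measure \<Rightarrow> ((nat \<Rightarrow> real^'d) \<times> (real^'d) measure) measure" where
  "tag_extend m w = distr (snd w) (config_algebra (Suc m) \<Otimes>\<^sub>M P1_borel) (\<lambda>x. ((fst w)(m := x), snd w))"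

lemma tag_extend_map_measurable:
  "(\<lambda>(w, x). ((fst w)(m := x), snd w)) \<in>
    (config_algebra m \<Otimes>\<^sub>M (P1_borel :: (real^'d) measure measure)) \<Otimes>\<^sub>M borel \<rightarrow>\<^sub>M config_algebra (Suc m) \<Otimes>\<^sub>M P1_borel"
  unfolding case_prod_unfold
  by (intro measurable_Pair measurable_fun_upd[of _ "{..<m}"]) auto

lemma tag_extend_measurable:
  "tag_extend m \<in> config_algebra m \<Otimes>\<^sub>M P1_borel \<rightarrow>\<^sub>M prob_algebra (config_algebra (Suc m) \<Otimes>\<^sub>M P1_borel)"
  unfolding tag_extend_def
  by (rule measurable_distr_prob_space2[OF measurable_compose[OF measurable_snd P1_borel_prob_algebra] tag_extend_map_measurable])

lemma tag_extend_point_measurable: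
  fixes w :: "(nat \<Rightarrow> real^'d) \<times> (real^'d) measure"
  assumes w: "w \<in> config m \<times> P1"
  shows "(\<lambda>x. ((fst w)(m := x), snd w)) \<in> snd w \<rightarrow>\<^sub>M config_algebra (Suc m) \<Otimes>\<^sub>M P1_borel"
proof -
  have f: "snd w \<in> P1" using w by (simp only: mem_Times_iff)
  have "(\<lambda>x::real^'d. (w, x)) \<in> borel \<rightarrow>\<^sub>M (config_algebra m \<Otimes>\<^sub>M P1_borel) \<Otimes>\<^sub>M borel"
    by (rule measurable_Pair1') (use w in \<open>simp only: space_pair_measure space_PiM space_borel space_P1_borel\<close>)
  from measurable_compose[OF this tag_extend_map_measurable] show ?thesis
    unfolding measurable_cong_sets[OF P1D(2)[OF f] refl] prod.case .
qed

text \<open>Drawing one more particle from the tag: this is the conditional independence that turns the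
  last variable of the hierarchy into the mean field.\<close>

lemma tagged_law_Suc:
  fixes P :: "(real^'d) measure measure"
  assumes P: "P \<in> P1P1"
  shows "tagged_law (Suc m) P = tagged_law m P \<bind> tag_extend m"
proof -
  have pa: "tagged_law m P \<in> space (prob_algebra (config_algebra m \<Otimes>\<^sub>M P1_borel))"
    by (simp add: space_prob_algebra prob_space_tagged[OF P] sets_tagged[OF P])
  have sets2: "sets (tagged_law m P \<bind> tag_extend m) = sets (config_algebra (Suc m) \<Otimes>\<^sub>M P1_borel)"
    by (rule sets_bind'[OF pa tag_extend_measurable])
  have te: "tag_extend m \<in> tagged_law m P \<rightarrow>\<^sub>M subprob_algebra (config_algebra (Suc m) \<Otimes>\<^sub>M P1_borel)"
    using measurable_prob_algebraD[OF tag_extend_measurable] unfolding measurable_cong_sets[OF sets_tagged[OF P] refl] .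
  have eq: "(\<integral>\<^sup>+w. F w \<partial>tagged_law (Suc m) P) = (\<integral>\<^sup>+w. F w \<partial>(tagged_law m P \<bind> tag_extend m))"
    if F: "F \<in> borel_measurable (config_algebra (Suc m) \<Otimes>\<^sub>M P1_borel)" for F
  proof -
    have "(\<integral>\<^sup>+w. F w \<partial>(tagged_law m P \<bind> tag_extend m)) = (\<integral>\<^sup>+w. \<integral>\<^sup>+w'. F w' \<partial>tag_extend m w \<partial>tagged_law m P)"
      by (rule nn_integral_bind[OF F te])
    also have "\<dots> = (\<integral>\<^sup>+f. \<integral>\<^sup>+Z. \<integral>\<^sup>+w'. F w' \<partial>tag_extend m (Z, f) \<partial>PiM {..<m} (\<lambda>_. f) \<partial>P)"
      by (rule nn_integral_tagged[OF P])
        (rule measurable_compose[OF measurable_prob_algebraD[OF tag_extend_measurable] nn_integral_measurable_subprob_algebra[OF F]])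
    also have "\<dots> = (\<integral>\<^sup>+f. \<integral>\<^sup>+Z. F (Z, f) \<partial>PiM {..<Suc m} (\<lambda>_. f) \<partial>P)"
    proof (rule nn_integral_cong)
      fix f assume "f \<in> space P"
      then have f: "f \<in> P1" by (simp add: P1P1D(4)[OF P])
      interpret prob_space f by (rule P1D(1)[OF f])
      interpret product_sigma_finite "\<lambda>_::nat. f" by standard
      have "(\<integral>\<^sup>+Z. F (Z, f) \<partial>PiM {..<Suc m} (\<lambda>_. f)) = (\<integral>\<^sup>+Z. \<integral>\<^sup>+x. F (Z(m := x), f) \<partial>f \<partial>PiM {..<m} (\<lambda>_. f))"
        unfolding lessThan_Suc
        by (rule product_nn_integral_insert)
          (use measurable_compose[OF tag_measurable[OF f] F] in \<open>auto simp: lessThan_Suc\<close>)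
      also have "\<dots> = (\<integral>\<^sup>+Z. \<integral>\<^sup>+w'. F w' \<partial>tag_extend m (Z, f) \<partial>PiM {..<m} (\<lambda>_. f))"
      proof (rule nn_integral_cong)
        fix Z assume "Z \<in> space (PiM {..<m} (\<lambda>_. f))"
        then have w: "(Z, f) \<in> config m \<times> P1" using f by (simp add: space_PiM P1D(4)[OF f])
        show "(\<integral>\<^sup>+x. F (Z(m := x), f) \<partial>f) = (\<integral>\<^sup>+w'. F w' \<partial>tag_extend m (Z, f))"
          unfolding tag_extend_def using F by (subst nn_integral_distr[OF tag_extend_point_measurable[OF w]]) auto
      qed
      finally show "(\<integral>\<^sup>+Z. \<integral>\<^sup>+w'. F w' \<partial>tag_extend m (Z, f) \<partial>PiM {..<m} (\<lambda>_. f)) = (\<integral>\<^sup>+Z. F (Z, f) \<partial>PiM {..<Suc m} (\<lambda>_. f))" by simp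
    qed
    also have "\<dots> = (\<integral>\<^sup>+w. F w \<partial>tagged_law (Suc m) P)" by (rule nn_integral_tagged[OF P F, symmetric])
    finally show ?thesis by simp
  qed
  show ?thesis
  proof (rule measure_eqI)
    show "sets (tagged_law (Suc m) P) = sets (tagged_law m P \<bind> tag_extend m)"
      by (simp only: sets2 sets_tagged[OF P])
    fix A assume "A \<in> sets (tagged_law (Suc m) P)"
    then have A: "A \<in> sets (config_algebra (Suc m) \<Otimes>\<^sub>M P1_borel)" by (simp only: sets_tagged[OF P])
    have "emeasure (tagged_law (Suc m) P) A = (\<integral>\<^sup>+w. indicator A w \<partial>tagged_law (Suc m) P)"
      using A by (simp add: sets_tagged[OF P])
    also have "\<dots> = (\<integral>\<^sup>+w. indicator A w \<partial>(tagged_law m P \<bind> tag_extend m))" by (rule eq) (use A in measurable)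
    also have "\<dots> = emeasure (tagged_law m P \<bind> tag_extend m) A" using A by (simp add: sets2)
    finally show "emeasure (tagged_law (Suc m) P) A = emeasure (tagged_law m P \<bind> tag_extend m) A" .
  qed
qed

text \<open>A majorant, up to constants, for positions and velocities at bounded times: the distance
  to the Dirac mass at 0 stands for the first moment of the tag.\<close>

definition tag_weight :: "nat \<Rightarrow> (nat \<Rightarrow> real^'d) \<times> (real^'d) measure \<Rightarrow> real" where
  "tag_weight m w = (\<Sum>k<m. norm (fst w k)) + dist_MK (snd w) (return borel 0)"

lemma tag_weight_nonneg: "0 \<le> tag_weight m w"
  by (simp add: tag_weight_def sum_nonneg euc.W_nonneg)

lemma norm_le_tag_weight: "k < m \<Longrightarrow> norm (fst w k) \<le> tag_weight m w"
  unfolding tag_weight_def using member_le_sum[of k "{..<m}" "\<lambda>k. norm (fst w k)"] euc.W_nonneg[of "snd w" "return borel 0"]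
  by (simp add: add_increasing2)

lemma moment_le_tag_weight: "snd w \<in> P1 \<Longrightarrow> (\<integral>x. norm x \<partial>snd w) \<le> tag_weight m w"
  unfolding tag_weight_def using first_moment_le_dist_MK[of "snd w"] by (simp add: add_increasing sum_nonneg)

lemma tag_weight_integrable:
  fixes P :: "(real^'d) measure measure"
  assumes P: "P \<in> P1P1"
  shows "integrable (tagged_law m P) (tag_weight m)"
proof -
  note [measurable] = pp.dist_measurable' pp.x0_measurable
  have comp[measurable]: "(\<lambda>Z. Z k) \<in> borel_measurable (config_algebra m :: (nat \<Rightarrow> real^'d) measure)" if "k \<in> {..<m}" for k
    using that by (rule measurable_component_singleton)
  have meas: "tag_weight m \<in> borel_measurable (config_algebra m \<Otimes>\<^sub>M (P1_borel :: (real^'d) measure measure))"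
    unfolding tag_weight_def[abs_def]
    by (intro borel_measurable_add borel_measurable_sum borel_measurable_norm measurable_compose[OF measurable_fst comp]) measurable
  have "(\<integral>\<^sup>+w. ennreal (tag_weight m w) \<partial>tagged_law m P) = (\<integral>\<^sup>+f. \<integral>\<^sup>+Z. ennreal (tag_weight m (Z, f)) \<partial>PiM {..<m} (\<lambda>_. f) \<partial>P)"
    using meas by (intro nn_integral_tagged[OF P]) measurable
  \<comment> \<open>Each of the \<open>m\<close> positions has mean norm at most the distance of the
    tag to the Dirac mass at 0, and the tag contributes this distance once more.\<close>
  also have "\<dots> \<le> (\<integral>\<^sup>+f. of_nat (Suc m) * ennreal (dist_MK f (return borel 0)) \<partial>P)"
  proof (rule nn_integral_mono)
    fix f assume "f \<in> space P"
    then have f: "f \<in> P1" by (simp add: P1P1D(4)[OF P])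
    interpret prob_space "PiM {..<m} (\<lambda>_. f)" by (rule prob_space_PiM) (rule P1D(1)[OF f])
    have cf: "(\<lambda>Z. ennreal (norm (Z k))) \<in> borel_measurable (PiM {..<m} (\<lambda>_. f))" if "k \<in> {..<m}" for k
    proof -
      have "(\<lambda>Z. Z k) \<in> borel_measurable (PiM {..<m} (\<lambda>_. f))"
        using comp[OF that] unfolding measurable_cong_sets[OF sets_PiM_borel[OF P1D(2)[OF f]] refl] .
      then show ?thesis by measurable
    qed
    have "(\<integral>\<^sup>+Z. ennreal (tag_weight m (Z, f)) \<partial>PiM {..<m} (\<lambda>_. f))
        = (\<integral>\<^sup>+Z. (\<Sum>k<m. ennreal (norm (Z k))) + ennreal (dist_MK f (return borel 0)) \<partial>PiM {..<m} (\<lambda>_. f))"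
      by (intro nn_integral_cong) (simp add: tag_weight_def sum_nonneg euc.W_nonneg sum_ennreal)
    also have "\<dots> = (\<Sum>k<m. \<integral>\<^sup>+Z. ennreal (norm (Z k)) \<partial>PiM {..<m} (\<lambda>_. f)) + ennreal (dist_MK f (return borel 0))"
    proof -
      have "(\<integral>\<^sup>+Z. (\<Sum>k<m. ennreal (norm (Z k))) \<partial>PiM {..<m} (\<lambda>_. f)) = (\<Sum>k<m. \<integral>\<^sup>+Z. ennreal (norm (Z k)) \<partial>PiM {..<m} (\<lambda>_. f))"
        by (rule nn_integral_sum[OF cf])
      then show ?thesis
        by (subst nn_integral_add[OF borel_measurable_sum[OF cf]]) (simp_all add: emeasure_space_1 del: sum_ennreal)
    qed
    also have "(\<Sum>k<m. \<integral>\<^sup>+Z. ennreal (norm (Z k)) \<partial>PiM {..<m} (\<lambda>_. f)) = (\<Sum>k<m. \<integral>\<^sup>+x. ennreal (norm x) \<partial>f)"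
      using P1D(2)[OF f]
      by (intro sum.cong refl nn_integral_PiM_component[OF P1D(1)[OF f], of "\<lambda>x. ennreal (norm x)"])
        (auto cong: measurable_cong_sets)
    also have "\<dots> \<le> (\<Sum>k<m. ennreal (dist_MK f (return borel 0)))" by (intro sum_mono nn_integral_norm_P1 f)
    finally show "(\<integral>\<^sup>+Z. ennreal (tag_weight m (Z, f)) \<partial>PiM {..<m} (\<lambda>_. f)) \<le> of_nat (Suc m) * ennreal (dist_MK f (return borel 0))"
      by (simp add: distrib_right add.commute)
  qed
  also have "\<dots> = of_nat (Suc m) * (\<integral>\<^sup>+f. ennreal (dist_MK f (return borel 0)) \<partial>P)"
  proof (rule nn_integral_cmult)
    note [measurable_cong] = P1P1D(2)[OF P]
    show "(\<lambda>f. ennreal (dist_MK f (return borel 0))) \<in> borel_measurable P" by measurable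
  qed
  also have "\<dots> < \<infinity>" using P1P1D(3)[OF P] by (simp add: ennreal_mult_less_top of_nat_less_top del: of_nat_Suc)
  finally show ?thesis
    using meas by (intro integrableI_nonneg) (simp_all add: measurable_cong_sets[OF sets_tagged[OF P] refl] tag_weight_nonneg)
qed

text \<open>There are finitely many coordinate directions, so a single bound and a single time
  window serve the time derivative and all gradients.\<close>

lemma test_function_bounds:
  fixes \<phi> :: "real \<times> (nat \<Rightarrow> real^'d) \<Rightarrow> real"
  assumes \<phi>: "\<phi> \<in> test_functions m"
  obtains R B where "0 \<le> R" "0 \<le> B"
    "\<And>p. p \<in> spacetime m \<Longrightarrow> R < \<bar>fst p\<bar> \<Longrightarrow> \<phi> p = 0"
    "\<And>p. p \<in> spacetime m \<Longrightarrow> \<bar>dir_deriv time_dir \<phi> p\<bar> \<le> B"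
    "\<And>p. p \<in> spacetime m \<Longrightarrow> R < \<bar>fst p\<bar> \<Longrightarrow> dir_deriv time_dir \<phi> p = 0"
    "\<And>p k. p \<in> spacetime m \<Longrightarrow> k < m \<Longrightarrow> norm (grad k \<phi> p) \<le> B"
    "\<And>p k. p \<in> spacetime m \<Longrightarrow> k < m \<Longrightarrow> R < \<bar>fst p\<bar> \<Longrightarrow> grad k \<phi> p = 0"
proof -
  obtain R where R: "\<And>p. p \<in> spacetime m \<Longrightarrow> R < \<bar>fst p\<bar> \<Longrightarrow> \<phi> p = 0"
    "\<And>p v. v \<in> coord_dirs m \<Longrightarrow> p \<in> spacetime m \<Longrightarrow> R < \<bar>fst p\<bar> \<Longrightarrow> dir_deriv v \<phi> p = 0"
    "\<And>v. v \<in> coord_dirs m \<Longrightarrow> \<exists>B. \<forall>p\<in>spacetime m. \<bar>dir_deriv v \<phi> p\<bar> \<le> B"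
    by (rule test_function_dir_deriv[OF \<phi>]) (rule that)
  have time: "time_dir \<in> coord_dirs m" by (simp add: coord_dirs_def)
  have space: "space_dir k b \<in> coord_dirs m" if "k < m" "b \<in> Basis" for k and b :: "real^'d"
    using that by (auto simp: coord_dirs_def)
  have fin: "finite (coord_dirs m :: (real \<times> (nat \<Rightarrow> real^'d)) set)"
  proof -
    have "coord_dirs m = insert time_dir ((\<lambda>(k, b). space_dir k b) ` ({..<m} \<times> (Basis :: (real^'d) set)))"
      by (auto simp: coord_dirs_def)
    then show ?thesis by simp
  qed
  obtain Bv where Bv: "\<And>v p. v \<in> coord_dirs m \<Longrightarrow> p \<in> spacetime m \<Longrightarrow> \<bar>dir_deriv v \<phi> p\<bar> \<le> Bv v"
    using bchoice[of "coord_dirs m" "\<lambda>v B. \<forall>p\<in>spacetime m. \<bar>dir_deriv v \<phi> p\<bar> \<le> B"] R(3) by blast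
  define B where "B = (\<Sum>v\<in>coord_dirs m. \<bar>Bv v\<bar>)"
  have B: "\<bar>dir_deriv v \<phi> p\<bar> \<le> B" if "v \<in> coord_dirs m" "p \<in> spacetime m" for v p
    using Bv[OF that] member_le_sum[of v "coord_dirs m" "\<lambda>v. \<bar>Bv v\<bar>"] that(1) fin unfolding B_def by force
  have B0: "0 \<le> B" by (simp add: B_def sum_nonneg)
  \<comment> \<open>A gradient is a sum over the basis, which accounts for the dimension; the
    summand 1 lets the same bound cover the time derivative.\<close>
  define c where "c = 1 + real DIM(real^'d)"
  have cB: "B \<le> c * B" using B0 by (simp add: c_def distrib_right)
  show thesis
  proof (rule that[of "max R 0" "c * B"])
    show "0 \<le> c * B" using B0 cB by simp
    show "\<phi> p = 0" if "p \<in> spacetime m" "max R 0 < \<bar>fst p\<bar>" for p using R(1)[OF that(1)] that(2) by simp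
    show "\<bar>dir_deriv time_dir \<phi> p\<bar> \<le> c * B" if "p \<in> spacetime m" for p using B[OF time that] cB by simp
    show "dir_deriv time_dir \<phi> p = 0" if "p \<in> spacetime m" "max R 0 < \<bar>fst p\<bar>" for p
      using R(2)[OF time that(1)] that(2) by simp
    show "norm (grad k \<phi> p) \<le> c * B" if p: "p \<in> spacetime m" and k: "k < m" for p k
    proof -
      have "norm (grad k \<phi> p) \<le> (\<Sum>b\<in>Basis. norm (dir_deriv (space_dir k b) \<phi> p *\<^sub>R (b :: real^'d)))"
        unfolding grad_def by (rule norm_sum)
      also have "\<dots> \<le> (\<Sum>b\<in>(Basis :: (real^'d) set). B)"
        using B[OF space[OF k] p] by (intro sum_mono) simp
      also have "\<dots> \<le> c * B" using B0 by (simp add: c_def distrib_right)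
      finally show ?thesis .
    qed
    show "grad k \<phi> p = 0" if p: "p \<in> spacetime m" and k: "k < m" and "max R 0 < \<bar>fst p\<bar>" for p k
      using R(2)[OF space[OF k] p] that(3) by (simp add: grad_def)
  qed simp
qed

context mean_field begin

lemma flow_config_in: "flow_config m t w \<in> config m"
  by (simp add: flow_config_def)

text \<open>The chain rule runs on the space with \<open>m\<close> samples and the tag, where the
  velocity is the mean field of the tag. The equation instead contains the interaction with sample m
  + 1, on the space with one more sample; \<open>tagged_law_Suc\<close> makes the former the
  conditional expectation of the latter.\<close>

theorem evolve_hierarchy:
  assumes P: "P \<in> P1P1"
  shows "hierarchy_solution K (\<lambda>m t. mixture_power m (evolve t P))"
  unfolding hierarchy_solution_def Let_def
proof (intro allI impI ballI)
  fix m :: nat and \<phi> :: "real \<times> (nat \<Rightarrow> real^'d) \<Rightarrow> real"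
  assume \<phi>: "\<phi> \<in> test_functions m"
  then have tcd: "times_cont_diff m (Suc 0) \<phi>" unfolding test_functions_def by blast
  obtain R B where R: "0 \<le> R" and B: "0 \<le> B"
    and \<phi>0: "\<And>p. p \<in> spacetime m \<Longrightarrow> R < \<bar>fst p\<bar> \<Longrightarrow> \<phi> p = 0"
    and time_le: "\<And>p. p \<in> spacetime m \<Longrightarrow> \<bar>dir_deriv time_dir \<phi> p\<bar> \<le> B"
    and time_0: "\<And>p. p \<in> spacetime m \<Longrightarrow> R < \<bar>fst p\<bar> \<Longrightarrow> dir_deriv time_dir \<phi> p = 0"
    and grad_le: "\<And>p k. p \<in> spacetime m \<Longrightarrow> k < m \<Longrightarrow> norm (grad k \<phi> p) \<le> B"
    and grad_0: "\<And>p k. p \<in> spacetime m \<Longrightarrow> k < m \<Longrightarrow> R < \<bar>fst p\<bar> \<Longrightarrow> grad k \<phi> p = 0"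
    by (rule test_function_bounds[OF \<phi>]) (rule that)
  have time: "time_dir \<in> coord_dirs m" by (simp add: coord_dirs_def)
  have space: "space_dir k b \<in> coord_dirs m" if "k < m" "b \<in> Basis" for k and b :: "real^'d"
    using that by (auto simp: coord_dirs_def)
  let ?C = "config_algebra m :: (nat \<Rightarrow> real^'d) measure"
  let ?C' = "config_algebra (Suc m) :: (nat \<Rightarrow> real^'d) measure"
  let ?\<Omega> = "tagged_law m P" and ?\<Omega>' = "tagged_law (Suc m) P"
  interpret \<Omega>: prob_space ?\<Omega> by (rule prob_space_tagged[OF P])
  have \<Omega>'_prob: "prob_space ?\<Omega>'" by (rule prob_space_tagged[OF P])
  have fc: "flow_config n t \<in> tagged_law n P \<rightarrow>\<^sub>M config_algebra n" for n t
    using flow_config_measurable[of "\<lambda>_. t" _ "\<lambda>x. x" n] by (simp add: measurable_cong_sets[OF sets_tagged[OF P] refl])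
  have st: "(t, flow_config m t w) \<in> spacetime m" for t w by (simp add: flow_config_in)
  \<comment> \<open>The terms of the time derivative of the test function along the flow:
    \<open>None\<close> is the explicit time dependence, \<open>Some k\<close> the transport of
    sample \<open>k\<close>.\<close>
  define T where "T j t w = (case j of None \<Rightarrow> dir_deriv time_dir \<phi> (t, flow_config m t w)
      | Some k \<Rightarrow> velocity (snd w) t (fst w k) \<bullet> grad k \<phi> (t, flow_config m t w))" for j t w
  define J where "J = insert None (Some ` {..<m})"
  have sumJ: "(\<Sum>j\<in>J. F j) = F None + (\<Sum>k<m. F (Some k))" for F :: "nat option \<Rightarrow> real"
    unfolding J_def by (subst sum.insert) (auto simp: sum.reindex)
  \<comment> \<open>The velocity bound involves |z| plus twice the first moment, each at most
    \<open>tag_weight\<close>; hence the 3. The factor \<open>B\<close> bounds the gradient, and the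
    summand \<open>B\<close> in \<open>W\<close> covers the time derivative.\<close>
  define c where "c = L * exp (2 * L * R) * 3 * B"
  have c0: "0 \<le> c" using L_nonneg B by (simp add: c_def)
  define W where "W w = B + c * tag_weight m w" for w :: "(nat \<Rightarrow> real^'d) \<times> (real^'d) measure"
  have W_int: "integrable ?\<Omega> W"
    unfolding W_def using tag_weight_integrable[OF P, of m] by auto
  have T_meas: "(\<lambda>(t, w). T j t w) \<in> borel_measurable (borel \<Otimes>\<^sub>M ?\<Omega>)" if j: "j \<in> J" for j
  proof -
    have s2: "(\<lambda>x. snd x) \<in> borel \<Otimes>\<^sub>M ?\<Omega> \<rightarrow>\<^sub>M ?C \<Otimes>\<^sub>M P1_borel"
      using measurable_snd[of borel ?\<Omega>] by (simp add: measurable_cong_sets[OF refl sets_tagged[OF P]])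
    have fcm: "(\<lambda>x. flow_config m (fst x) (snd x)) \<in> borel \<Otimes>\<^sub>M ?\<Omega> \<rightarrow>\<^sub>M ?C"
      by (rule flow_config_measurable[OF measurable_fst s2])
    have dd: "(\<lambda>x. dir_deriv v \<phi> (fst x, flow_config m (fst x) (snd x))) \<in> borel_measurable (borel \<Otimes>\<^sub>M ?\<Omega>)"
      if "v \<in> coord_dirs m" for v
      by (rule measurable_on_spacetime[OF times_cont_diff_SucD(2)[OF tcd that] measurable_fst fcm])
    show ?thesis
    proof (cases j)
      case None
      then show ?thesis using dd[OF time] by (simp add: T_def case_prod_unfold)
    next
      case (Some k)
      then have k: "k < m" using j by (auto simp: J_def)
      have v: "(\<lambda>x. velocity (snd (snd x)) (fst x) (fst (snd x) k)) \<in> borel_measurable (borel \<Otimes>\<^sub>M ?\<Omega>)"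
        using k by (intro velocity_measurable_comp measurable_compose[OF s2 measurable_snd] measurable_fst
            measurable_compose[OF measurable_compose[OF s2 measurable_fst] measurable_component_singleton]) auto
      have "(\<lambda>x. \<Sum>b\<in>Basis. dir_deriv (space_dir k b) \<phi> (fst x, flow_config m (fst x) (snd x))
            * (velocity (snd (snd x)) (fst x) (fst (snd x) k) \<bullet> b)) \<in> borel_measurable (borel \<Otimes>\<^sub>M ?\<Omega>)"
        by (intro borel_measurable_sum borel_measurable_times dd space k borel_measurable_inner v borel_measurable_const)
      then show ?thesis using Some by (simp add: T_def case_prod_unfold grad_def inner_sum_right)
    qed
  qed
  have T_bound: "\<bar>T j t w\<bar> \<le> indicator {-R..R} t * W w" if j: "j \<in> J" and w: "w \<in> space ?\<Omega>" for j t w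
  proof (cases "t \<in> {-R..R}")
    case False
    then have "R < \<bar>t\<bar>" by auto
    then have "T j t w = 0"
      using j time_0[OF st, of t w] grad_0[OF st, of _ t w] by (auto simp: J_def T_def)
    then show ?thesis using False by simp
  next
    case True
    have f: "snd w \<in> P1" using w by (simp only: space_tagged[OF P] mem_Times_iff)
    have "\<bar>T j t w\<bar> \<le> W w"
    proof (cases j)
      case None
      then show ?thesis using time_le[OF st, of t w] c0 tag_weight_nonneg[of m w]
        by (simp add: T_def W_def add_increasing2)
    next
      case (Some k)
      then have k: "k < m" using j by (auto simp: J_def)
      have "\<bar>T j t w\<bar> \<le> norm (velocity (snd w) t (fst w k)) * norm (grad k \<phi> (t, flow_config m t w))"
        using Some by (simp add: T_def Cauchy_Schwarz_ineq2)
      also have "\<dots> \<le> (L * exp (2 * L * R) * (3 * tag_weight m w)) * B"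
      proof (rule mult_mono[OF _ grad_le[OF st k]])
        have "norm (velocity (snd w) t (fst w k)) \<le> L * exp (2 * L * R) * (norm (fst w k) + 2 * (\<integral>x. norm x \<partial>snd w))"
          unfolding velocity_def using True by (intro flow_velocity_bound[OF f]) auto
        also have "\<dots> \<le> L * exp (2 * L * R) * (3 * tag_weight m w)"
          using norm_le_tag_weight[OF k, of w] moment_le_tag_weight[OF f, of m] L_nonneg by (intro mult_left_mono) auto
        finally show "norm (velocity (snd w) t (fst w k)) \<le> L * exp (2 * L * R) * (3 * tag_weight m w)" .
      qed (use L_nonneg tag_weight_nonneg[of m w] in auto)
      also have "\<dots> \<le> W w" using B by (simp add: W_def c_def algebra_simps)
      finally show ?thesis .
    qed
    then show ?thesis using True by simp
  qed
  have T_deriv: "((\<lambda>t. \<phi> (t, flow_config m t w)) has_real_derivative (\<Sum>j\<in>J. T j t w)) (at t)"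
    if w: "w \<in> space ?\<Omega>" for t w
  proof -
    have f: "snd w \<in> P1" using w by (simp only: space_tagged[OF P] mem_Times_iff)
    have "((\<lambda>s. flow_config m s w k) has_vector_derivative velocity (snd w) t (fst w k)) (at t)" if "k < m" for k
      using flow_has_velocity[OF f, of "fst w k" t] that by (simp add: flow_config_def)
    from curve_chain_rule[OF tcd flow_config_in this]
    show ?thesis by (simp add: sumJ T_def)
  qed
  have finJ: "finite J" by (simp add: J_def)
  have supp: "\<phi> (t, flow_config m t w) = 0" if "R < \<bar>t\<bar>" for t w
    using that by (intro \<phi>0[OF st]) simp
  note main = time_integral_expectation_eq_0[where M="?\<Omega>" and J=J and T=T and W=W and R=R
      and \<Psi>="\<lambda>w t. \<phi> (t, flow_config m t w)", OF \<Omega>.prob_space_axioms finJ _ W_int _ _ _ R]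
  have T_lborel: "integrable lborel (\<lambda>t. \<integral>w. T j t w \<partial>?\<Omega>)" if "j \<in> J" for j
    by (rule main(1)[OF _ _ _ _ that]) (erule T_meas, erule (1) T_bound, erule T_deriv, erule supp)
  have T_sum: "(\<Sum>j\<in>J. \<integral>t. (\<integral>w. T j t w \<partial>?\<Omega>) \<partial>lborel) = 0"
    by (rule main(2)) (erule T_meas, erule (1) T_bound, erule T_deriv, erule supp)
  have A_meas: "(\<lambda>Z. dir_deriv time_dir \<phi> (t, Z)) \<in> borel_measurable ?C" for t
    by (rule measurable_on_spacetime[OF times_cont_diff_SucD(2)[OF tcd time], of "\<lambda>_. t" _ "\<lambda>Z. Z"]) auto
  have A_eq: "(\<integral>Z. dir_deriv time_dir \<phi> (t, Z) \<partial>mixture_power m (evolve t P)) = (\<integral>w. T None t w \<partial>?\<Omega>)" for t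
    unfolding mixture_evolve[OF P] by (subst integral_distr[OF fc A_meas]) (simp add: T_def[abs_def])
  have A_int: "integrable (mixture_power m (evolve t P)) (\<lambda>Z. dir_deriv time_dir \<phi> (t, Z))" for t
    unfolding mixture_evolve[OF P]
  proof (subst integrable_distr_eq[OF fc A_meas], rule \<Omega>.integrable_const_bound[of _ B])
    show "AE w in ?\<Omega>. norm (dir_deriv time_dir \<phi> (t, flow_config m t w)) \<le> B" using time_le[OF st] by auto
    show "(\<lambda>w. dir_deriv time_dir \<phi> (t, flow_config m t w)) \<in> borel_measurable ?\<Omega>"
      by (rule measurable_compose[OF fc A_meas])
  qed
  have B_meas: "(\<lambda>Z. K (Z k) (Z m) \<bullet> grad k \<phi> (t, restrict Z {..<m})) \<in> borel_measurable ?C'" if k: "k < m" for k t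
  proof -
    have r: "(\<lambda>Z. restrict Z {..<m}) \<in> ?C' \<rightarrow>\<^sub>M ?C"
      by (intro measurable_restrict measurable_component_singleton) auto
    have dd: "(\<lambda>Z. dir_deriv (space_dir k b) \<phi> (t, restrict Z {..<m})) \<in> borel_measurable ?C'" if "b \<in> Basis" for b
      by (rule measurable_on_spacetime[OF times_cont_diff_SucD(2)[OF tcd space[OF k that]] _ r]) auto
    have Km: "(\<lambda>Z. K (Z k) (Z m)) \<in> borel_measurable ?C'"
      using k by (intro K_measurable' measurable_component_singleton) auto
    have "(\<lambda>Z. \<Sum>b\<in>Basis. dir_deriv (space_dir k b) \<phi> (t, restrict Z {..<m}) * (K (Z k) (Z m) \<bullet> b)) \<in> borel_measurable ?C'"
      by (intro borel_measurable_sum borel_measurable_times dd borel_measurable_inner Km borel_measurable_const)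
    then show ?thesis by (simp add: grad_def inner_sum_right)
  qed
  \<comment> \<open>The interaction term before averaging, along the flow of m + 1 samples.\<close>
  define H where "H k t w = K (flow (snd w) t (fst w k)) (flow (snd w) t (fst w m)) \<bullet> grad k \<phi> (t, restrict (flow_config (Suc m) t w) {..<m})"
    for k t w
  have H_eq: "K (flow_config (Suc m) t w k) (flow_config (Suc m) t w m) \<bullet> grad k \<phi> (t, restrict (flow_config (Suc m) t w) {..<m}) = H k t w"
    if "k < m" for k t w using that by (simp add: H_def flow_config_def)
  have H_meas: "H k t \<in> borel_measurable ?\<Omega>'" if k: "k < m" for k t
    using measurable_compose[OF fc[of "Suc m" t] B_meas[OF k, of t]] unfolding H_eq[OF k] .
  have H_int: "integrable ?\<Omega>' (H k t)" if k: "k < m" for k t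
  proof (rule Bochner_Integration.integrable_bound[OF _ H_meas[OF k]])
    \<comment> \<open>Integrability is required at every time, so the bound uses |t| and not the
      time window of the test function. Each of the two positions is at most \<open>?e\<close> times
      twice the weight, which gives the factor 4.\<close>
    let ?e = "exp (2 * L * \<bar>t\<bar>)"
    show "integrable ?\<Omega>' (\<lambda>w. (L * (4 * ?e) * B) * tag_weight (Suc m) w)"
      using tag_weight_integrable[OF P, of "Suc m"] by auto
    show "AE w in ?\<Omega>'. norm (H k t w) \<le> norm ((L * (4 * ?e) * B) * tag_weight (Suc m) w)"
    proof (rule AE_I2)
      fix w assume w: "w \<in> space ?\<Omega>'"
      have f: "snd w \<in> P1" using w by (simp only: space_tagged[OF P] mem_Times_iff)
      have fl: "norm (flow (snd w) t (fst w l)) \<le> ?e * (2 * tag_weight (Suc m) w)" if "l < Suc m" for l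
        using norm_le_tag_weight[OF that, of w] moment_le_tag_weight[OF f, of "Suc m"]
        by (intro order_trans[OF flow_bound(1)[OF f]] mult_left_mono) auto
      have "norm (H k t w) \<le> norm (K (flow (snd w) t (fst w k)) (flow (snd w) t (fst w m))) * norm (grad k \<phi> (t, restrict (flow_config (Suc m) t w) {..<m}))"
        by (simp add: H_def Cauchy_Schwarz_ineq2)
      also have "\<dots> \<le> (L * (?e * (2 * tag_weight (Suc m) w) + ?e * (2 * tag_weight (Suc m) w))) * B"
      proof (rule mult_mono[OF _ grad_le[OF _ k]])
        show "norm (K (flow (snd w) t (fst w k)) (flow (snd w) t (fst w m))) \<le> L * (?e * (2 * tag_weight (Suc m) w) + ?e * (2 * tag_weight (Suc m) w))"
          using k by (intro order_trans[OF K_bound] mult_left_mono add_mono fl L_nonneg) auto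
      qed (use L_nonneg tag_weight_nonneg[of "Suc m" w] in auto)
      also have "\<dots> = (L * (4 * ?e) * B) * tag_weight (Suc m) w" by (simp add: algebra_simps)
      finally show "norm (H k t w) \<le> norm ((L * (4 * ?e) * B) * tag_weight (Suc m) w)" by simp
    qed
  qed
  have B_int: "integrable (mixture_power (Suc m) (evolve t P)) (\<lambda>Z. K (Z k) (Z m) \<bullet> grad k \<phi> (t, restrict Z {..<m}))"
    if k: "k < m" for k t
    unfolding mixture_evolve[OF P] by (subst integrable_distr_eq[OF fc B_meas[OF k]]) (use H_int[OF k, of t] in \<open>simp only: H_eq[OF k]\<close>)
  have B_eq: "(\<integral>Z. K (Z k) (Z m) \<bullet> grad k \<phi> (t, restrict Z {..<m}) \<partial>mixture_power (Suc m) (evolve t P)) = (\<integral>w. T (Some k) t w \<partial>?\<Omega>)"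
    if k: "k < m" for k t
  proof -
    have te: "tag_extend m \<in> ?\<Omega> \<rightarrow>\<^sub>M subprob_algebra (?C' \<Otimes>\<^sub>M P1_borel)"
      using measurable_prob_algebraD[OF tag_extend_measurable] unfolding measurable_cong_sets[OF sets_tagged[OF P] refl] .
    have "(\<integral>Z. K (Z k) (Z m) \<bullet> grad k \<phi> (t, restrict Z {..<m}) \<partial>mixture_power (Suc m) (evolve t P)) = (\<integral>w. H k t w \<partial>?\<Omega>')"
      unfolding mixture_evolve[OF P] by (subst integral_distr[OF fc B_meas[OF k]]) (simp only: H_eq[OF k])
    \<comment> \<open>Integrating out the last sample with the tag and the other samples fixed turns
      the interaction into the velocity.\<close>
    also have "\<dots> = (\<integral>w. \<integral>w'. H k t w' \<partial>tag_extend m w \<partial>?\<Omega>)"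
      using H_int[OF k, of t] unfolding tagged_law_Suc[OF P] by (rule integral_bind_real(2)[OF te \<Omega>.not_empty])
    also have "\<dots> = (\<integral>w. T (Some k) t w \<partial>?\<Omega>)"
    proof (rule Bochner_Integration.integral_cong[OF refl])
      fix w assume "w \<in> space ?\<Omega>"
      then have w: "w \<in> config m \<times> P1" by (simp add: space_tagged[OF P])
      then have f: "snd w \<in> P1" by (simp only: mem_Times_iff)
      interpret f: prob_space "snd w" by (rule P1D(1)[OF f])
      have i: "integrable (snd w) (flow (snd w) t)" by (rule mf_solution_integrable[OF flow(1)[OF f]])
      have Ki: "integrable (snd w) (\<lambda>x. K (flow (snd w) t (fst w k)) (flow (snd w) t x))"
        by (rule integrable_K[OF f.finite_measure_axioms i]) (use i in auto)
      have r: "restrict (flow_config (Suc m) t ((fst w)(m := x), snd w)) {..<m} = flow_config m t w" for x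
        by (auto simp: flow_config_def fun_eq_iff)
      have "(\<integral>w'. H k t w' \<partial>tag_extend m w) = (\<integral>x. H k t ((fst w)(m := x), snd w) \<partial>snd w)"
        unfolding tag_extend_def using H_meas[OF k, of t]
        by (subst integral_distr[OF tag_extend_point_measurable[OF w]])
          (auto simp: measurable_cong_sets[OF sets_tagged[OF P] refl])
      also have "\<dots> = (\<integral>x. K (flow (snd w) t (fst w k)) (flow (snd w) t x) \<bullet> grad k \<phi> (t, flow_config m t w) \<partial>snd w)"
        unfolding H_def r using k by simp
      also have "\<dots> = T (Some k) t w"
        using Ki by (simp add: T_def velocity_def)
      finally show "(\<integral>w'. H k t w' \<partial>tag_extend m w) = T (Some k) t w" .
    qed
    finally show ?thesis .
  qed
  show "(\<forall>t. integrable (mixture_power m (evolve t P)) (\<lambda>Z. dir_deriv time_dir \<phi> (t, Z))) \<and>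
      (\<forall>t. \<forall>k<m. integrable (mixture_power (Suc m) (evolve t P)) (\<lambda>Z. K (Z k) (Z m) \<bullet> grad k \<phi> (t, restrict Z {..<m}))) \<and>
      integrable lborel (\<lambda>t. \<integral>Z. dir_deriv time_dir \<phi> (t, Z) \<partial>mixture_power m (evolve t P)) \<and>
      (\<forall>k<m. integrable lborel (\<lambda>t. \<integral>Z. K (Z k) (Z m) \<bullet> grad k \<phi> (t, restrict Z {..<m}) \<partial>mixture_power (Suc m) (evolve t P))) \<and>
      (\<integral>t. (\<integral>Z. dir_deriv time_dir \<phi> (t, Z) \<partial>mixture_power m (evolve t P)) \<partial>lborel) +
      (\<Sum>k<m. \<integral>t. (\<integral>Z. K (Z k) (Z m) \<bullet> grad k \<phi> (t, restrict Z {..<m}) \<partial>mixture_power (Suc m) (evolve t P)) \<partial>lborel) = 0"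
  proof (intro conjI allI impI)
    show "integrable lborel (\<lambda>t. \<integral>Z. dir_deriv time_dir \<phi> (t, Z) \<partial>mixture_power m (evolve t P))"
      unfolding A_eq by (rule T_lborel) (simp add: J_def)
    show "integrable lborel (\<lambda>t. \<integral>Z. K (Z k) (Z m) \<bullet> grad k \<phi> (t, restrict Z {..<m}) \<partial>mixture_power (Suc m) (evolve t P))"
      if "k < m" for k unfolding B_eq[OF that] by (rule T_lborel) (use that in \<open>simp add: J_def\<close>)
    have "(\<Sum>k<m. \<integral>t. (\<integral>Z. K (Z k) (Z m) \<bullet> grad k \<phi> (t, restrict Z {..<m}) \<partial>mixture_power (Suc m) (evolve t P)) \<partial>lborel)
        = (\<Sum>k<m. \<integral>t. (\<integral>w. T (Some k) t w \<partial>?\<Omega>) \<partial>lborel)"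
      by (intro sum.cong refl) (simp add: B_eq)
    then show "(\<integral>t. (\<integral>Z. dir_deriv time_dir \<phi> (t, Z) \<partial>mixture_power m (evolve t P)) \<partial>lborel) +
      (\<Sum>k<m. \<integral>t. (\<integral>Z. K (Z k) (Z m) \<bullet> grad k \<phi> (t, restrict Z {..<m}) \<partial>mixture_power (Suc m) (evolve t P)) \<partial>lborel) = 0"
      using T_sum by (simp add: sumJ A_eq)
  qed (use A_int B_int in auto)
qed

end

theorem theorem5p1:
  fixes K :: "real^'d \<Rightarrow> real^'d \<Rightarrow> real^'d" and L :: real
  assumes "continuous_on UNIV (\<lambda>(z, z'). K z z')"
    and "\<And>z z'. K z z' + K z' z = 0"
    and "\<And>z1 z2 z'. norm (K z1 z' - K z2 z') \<le> L * norm (z1 - z2)"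
    and "\<And>z1 z2 z. norm (K z z1 - K z z2) \<le> L * norm (z1 - z2)"
  shows "\<exists>!T :: real \<Rightarrow> (real^'d) measure measure \<Rightarrow> (real^'d) measure measure.
    one_param_group moment_class T \<and>
    (\<forall>P\<in>moment_class. \<forall>PN :: nat \<Rightarrow> (nat \<Rightarrow> real^'d) measure.
       (\<forall>N\<ge>1. PN N \<in> P1_sym N) \<and> (\<lambda>N. Dist_MK (empirical_law N (PN N)) P) \<longlonglongrightarrow> 0 \<longrightarrow>
       (\<forall>R>0. uniform_limit {-R..R}
          (\<lambda>N t. Dist_MK (empirical_law N (flow_push K N t (PN N))) (T t P)) (\<lambda>_. 0) sequentially)) \<and>
    (\<forall>P\<in>moment_class.
       continuous_map euclidean (Metric_space.mtopology P1P1 Dist_MK) (\<lambda>t. T t P)) \<and>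
    (\<forall>P\<in>moment_class. hierarchy_solution K (\<lambda>m t. mixture_power m (T t P))) \<and>
    (\<forall>P\<in>moment_class. \<forall>Q\<in>moment_class. \<forall>t.
       Dist_MK (T t P) (T t Q) \<le> exp (2 * L * \<bar>t\<bar>) * Dist_MK P Q)"
    (is "\<exists>!T. ?grp T \<and> ?lim T \<and> ?cont T \<and> ?hier T \<and> ?lip T")
proof -
  interpret mean_field K L by unfold_locales (fact assms)+
  have P1P1: "P \<in> P1P1" if "P \<in> moment_class" for P :: "(real^'d) measure measure"
    using that by (simp add: moment_class_def)
  \<comment> \<open>\<open>one_param_group\<close> wants extensional maps, so \<open>evolve\<close>
    is cut off outside \<open>moment_class\<close>.\<close>
  define T where "T t = restrict (evolve t) moment_class" for t
  have T_eq: "T t P = evolve t P" if "P \<in> moment_class" for t P using that by (simp add: T_def)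
  show ?thesis
  proof (rule ex1I[of _ T], intro conjI)
    show "?grp T"
      unfolding one_param_group_def
    proof (intro conjI allI ballI)
      show "T t \<in> moment_class \<rightarrow>\<^sub>E moment_class" for t
        by (simp add: T_def evolve_moment_class)
      show "T 0 P = P" if "P \<in> moment_class" for P
        using that by (simp add: T_eq evolve_0 P1P1)
      show "T (t + s) P = T t (T s P)" if "P \<in> moment_class" for t s P
        using that by (simp add: T_eq evolve_add P1P1 evolve_moment_class)
    qed
    show "?lim T" using mean_field_limit P1P1 by (auto simp: T_eq)
    show "?cont T" using evolve_continuous P1P1 by (auto simp: T_eq)
    show "?hier T" using evolve_hierarchy P1P1 by (auto simp: T_eq)
    show "?lip T" using evolve_lipschitz P1P1 by (auto simp: T_eq)
  next
    fix T' :: "real \<Rightarrow> (real^'d) measure measure \<Rightarrow> (real^'d) measure measure"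
    assume T': "?grp T' \<and> ?lim T' \<and> ?cont T' \<and> ?hier T' \<and> ?lip T'"
    have T'_fun: "T' t \<in> moment_class \<rightarrow>\<^sub>E moment_class" for t
      using T' by (simp add: one_param_group_def)
    show "T' = T"
    proof (intro ext)
      fix t and P :: "(real^'d) measure measure"
      show "T' t P = T t P"
      proof (cases "P \<in> moment_class")
        case False
        then show ?thesis using PiE_arb[OF T'_fun False] by (simp add: T_def)
      next
        case True
        note P = P1P1[OF True]
        \<comment> \<open>Property (a) of the competitor \<open>T'\<close>, applied to the mixtures.
          None of its other properties is used below except that it maps \<open>moment_class\<close>
          to itself and is extensional.\<close>
        have "\<forall>R>0. uniform_limit {-R..R}
            (\<lambda>N s. Dist_MK (empirical_law N (flow_push K N s (mixture_power N P))) (T' s P)) (\<lambda>_. 0) sequentially"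
          using T'[THEN conjunct2, THEN conjunct1, THEN bspec, OF True, THEN spec, of "\<lambda>N. mixture_power N P"]
            mixture_P1_sym[OF P] mixture_approximates[OF P] by blast
        \<comment> \<open>The window is larger than |t| by 1 because (a) speaks of positive
          \<open>R\<close> only and \<open>t\<close> may be 0.\<close>
        from this[rule_format, of "\<bar>t\<bar> + 1"] have lim: "uniform_limit {- (\<bar>t\<bar> + 1)..\<bar>t\<bar> + 1}
            (\<lambda>N s. Dist_MK (empirical_law N (flow_push K N s (mixture_power N P))) (T' s P)) (\<lambda>_. 0) sequentially"
          by simp
        have "T' t P \<in> moment_class" using PiE_mem[OF T'_fun True] .
        moreover have "(\<lambda>N. Dist_MK (empirical_law N (flow_push K N t (mixture_power N P))) (T' t P)) \<longlonglongrightarrow> 0"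
          by (rule tendsto_uniform_limitI[OF lim]) (simp add: abs_real_def)
        moreover have "(\<lambda>N. Dist_MK (empirical_law N (flow_push K N t (mixture_power N P))) (evolve t P)) \<longlonglongrightarrow> 0"
          by (rule tendsto_uniform_limitI[OF mean_field_limit[OF P mixture_P1_sym[OF P] mixture_approximates[OF P], of "\<bar>t\<bar>"]])
            (simp add: abs_real_def)
        ultimately have "T' t P = evolve t P"
          by (intro evolution_unique[OF P P1P1 evolve_P1P1[OF P]])
        then show ?thesis by (simp add: T_eq[OF True])
      qed
    qed
  qed
qed

end
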